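(* Let $(\mathcal{M}_h)_h$ be a regular sequence of polyhedral meshes $\mathcal{M}_h=(\mathcal{T}_h,\mathcal{F}_h)$ of $\Omega$ and let $k\ge 1$ be an integer. There is a real number $C_{\rm K}>0$, only depending on $\Omega$, $d$, and the mesh regularity parameter, such that, for all $\underline{\boldsymbol v}_h\in\underline{\boldsymbol U}^k_{h,\mathrm{D}}$, $$\|\boldsymbol v_h\|_\Omega\le C_{\rm K}\,\|\underline{\boldsymbol v}_h\|_{\boldsymbol\varepsilon,h}.$$
   Context: **Domain and meshes.** $d\in\{2,3\}$ and $\Omega\subset\mathbb{R}^d$ is a bounded connected polyhedral domain, scaled so that its diameter equals $1$. A mesh is a couple $\mathcal{M}_h=(\mathcal{T}_h,\mathcal{F}_h)$, where $\mathcal{T}_h$ is a finite collection of nonempty, pairwise disjoint, open polygonal/polyhedral elements $T$ of diameter $h_T$ with $\overline\Omega=\bigcup_{T\in\mathcal{T}_h}\overline T$ and $h=\max_{T}h_T>0$, and $\mathcal{F}_h$ is a finite collection of pairwise disjoint hyperplanar faces $F$ (nonempty, relatively open, connected subsets of hyperplanes) of diameter $h_F$, such that each $F$ is either an internal face (there are two distinct elements $T_1,T_2$ with $F\subset\partial T_1\cap\partial T_2$) or a boundary face (there is $T$ with $F\subset\partial T\cap\partial\Omega$), and, for each $T\in\mathcal{T}_h$, $\partial T=\bigcup_{F\in\mathcal{F}_T}\overline F$, where $\mathcal{F}_T$ is the set of faces of $\mathcal{F}_h$ lying on $\partial T$. $\mathcal{F}_h^{\rm b}$ is the set of boundary faces.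 Nonmatching interfaces are allowed. **Mesh regularity.** The mesh sequence is regular with parameter $\varrho\in(0,1)$: each $\mathcal{M}_h$ admits a matching simplicial submesh (a conforming simplicial mesh each simplex of which is contained in exactly one element of $\mathcal{T}_h$ and each simplicial face of which is, for every $F\in\mathcal{F}_h$, either disjoint from $F$ or contained in $F$) such that every simplex $S$ of the submesh, with diameter $h_S$ and inradius $r_S$, satisfies $\varrho h_S\le r_S$, and $\varrho h_T\le h_S$ whenever $S\subset T\in\mathcal{T}_h$. Moreover each element is star-shaped with respect to every point of a ball of radius uniformly comparable to its diameter. **Discrete space.** $\boldsymbol P^k(X)$ denotes the space of $\mathbb{R}^d$-valued polynomials of total degree $\le k$ restricted to $X$. Set $$\underline{\boldsymbol U}^k_h=\{\underline{\boldsymbol v}_h=((\boldsymbol v_T)_{T\in\mathcal{T}_h},(\boldsymbol v_F)_{F\in\mathcal{F}_h}) : \boldsymbol v_T\in\boldsymbol P^k(T)\ \forall T\in\mathcal{T}_h,\ \boldsymbol v_F\in\boldsymbol P^k(F)\ \forall F\in\mathcal{F}_h\},$$ $$\underline{\boldsymbol U}^k_{h,\mathrm{D}}=\{\underline{\boldsymbol v}_h\in\underline{\boldsymbol U}^k_h:\boldsymbol v_F=\boldsymbol 0\ \forall F\in\mathcal{F}_h^{\rm b}\}.$$ For $\underline{\boldsymbol v}_h\in\underline{\boldsymbol U}_h^k$, $\boldsymbol v_h$ is the piecewise polynomial field on $\Omega$ with $(\boldsymbol v_h)_{|T}=\boldsymbol v_T$ for all $T\in\mathcal{T}_h$. **Norms.**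 $\|\cdot\|_X$ is the $L^2(X)$-norm (scalar, vector or tensor), $\boldsymbol\nabla_{\rm s}$ is the symmetric gradient, and $$\|\underline{\boldsymbol v}_h\|_{\boldsymbol\varepsilon,h}=\Big[\sum_{T\in\mathcal{T}_h}\Big(\|\boldsymbol\nabla_{\rm s}\boldsymbol v_T\|_T^2+\sum_{F\in\mathcal{F}_T}h_F^{-1}\|\boldsymbol v_F-\boldsymbol v_T\|_F^2\Big)\Big]^{1/2}.$$ *)

theory Defs
  imports "HOL-Analysis.Analysis"
begin

section \<open>Polyhedral domains and meshes\<close>

text \<open>A polyhedral set is open and may be nonconvex; being the interior of a union of convex
  polytopes, it lies locally on one side of its boundary facets (no cracks).\<close>

definition polyhedral :: "'a::euclidean_space set \<Rightarrow> bool" where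
  "polyhedral P \<longleftrightarrow> (\<exists>\<Q>. finite \<Q> \<and> (\<forall>Q\<in>\<Q>. polytope Q) \<and> P = interior (\<Union>\<Q>))"

definition polyhedral_domain :: "'a::euclidean_space set \<Rightarrow> bool" where
  "polyhedral_domain \<Omega> \<longleftrightarrow>
     \<Omega> \<noteq> {} \<and> open \<Omega> \<and> bounded \<Omega> \<and> connected \<Omega> \<and> polyhedral \<Omega>"

type_synonym 'n mesh = "(real^'n) set set \<times> (real^'n) set set"

abbreviation elements :: "'n::finite mesh \<Rightarrow> (real^'n) set set" where
  "elements M \<equiv> fst M"

abbreviation faces :: "'n::finite mesh \<Rightarrow> (real^'n) set set" where
  "faces M \<equiv> snd M"

definition mesh_size :: "'n::finite mesh \<Rightarrow> real" where
  "mesh_size M = Max (diameter ` elements M)"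

definition hyperplanar_face :: "'a::euclidean_space set \<Rightarrow> bool" where
  "hyperplanar_face F \<longleftrightarrow> F \<noteq> {} \<and> connected F \<and>
     (\<exists>a b. a \<noteq> 0 \<and> openin (top_of_set {x. a \<bullet> x = b}) F)"

definition internal_face :: "'n::finite mesh \<Rightarrow> (real^'n) set \<Rightarrow> bool" where
  "internal_face M F \<longleftrightarrow>
     (\<exists>T1\<in>elements M. \<exists>T2\<in>elements M. T1 \<noteq> T2 \<and> F \<subseteq> frontier T1 \<inter> frontier T2)"

definition boundary_faces :: "(real^'n) set \<Rightarrow> 'n::finite mesh \<Rightarrow> (real^'n) set set" where
  "boundary_faces \<Omega> M = {F \<in> faces M. \<exists>T\<in>elements M. F \<subseteq> frontier T \<inter> frontier \<Omega>}"

definition faces_of_element :: "'n::finite mesh \<Rightarrow> (real^'n) set \<Rightarrow> (real^'n) set set" where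
  "faces_of_element M T = {F \<in> faces M. F \<subseteq> frontier T}"

definition polyhedral_mesh :: "(real^'n) set \<Rightarrow> 'n::finite mesh \<Rightarrow> bool" where
  "polyhedral_mesh \<Omega> M \<longleftrightarrow>
     finite (elements M) \<and> pairwise disjnt (elements M) \<and>
     (\<forall>T\<in>elements M. T \<noteq> {} \<and> open T \<and> polyhedral T) \<and>
     closure \<Omega> = (\<Union>T\<in>elements M. closure T) \<and>
     mesh_size M > 0 \<and>
     finite (faces M) \<and> pairwise disjnt (faces M) \<and>
     (\<forall>F\<in>faces M. hyperplanar_face F \<and> (internal_face M F \<or> F \<in> boundary_faces \<Omega> M)) \<and>
     (\<forall>T\<in>elements M. frontier T = (\<Union>F\<in>faces_of_element M T. closure F))"

section \<open>Mesh regularity\<close>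

definition inradius :: "'a::euclidean_space set \<Rightarrow> real" where
  "inradius S = Sup {r. 0 \<le> r \<and> (\<exists>x. cball x r \<subseteq> S)}"

text \<open>Simplices of \<^const>\<open>triangulation\<close> are closed; the open simplex is \<open>interior S\<close>, and
  the corresponding relatively open simplicial faces are \<open>rel_interior E\<close> for \<open>E facet_of S\<close>.\<close>

definition matching_simplicial_submesh ::
    "(real^'n) set \<Rightarrow> 'n::finite mesh \<Rightarrow> (real^'n) set set \<Rightarrow> bool" where
  "matching_simplicial_submesh \<Omega> M \<S> \<longleftrightarrow>
     triangulation \<S> \<and> (\<forall>S\<in>\<S>. int CARD('n) simplex S) \<and> \<Union>\<S> = closure \<Omega> \<and>
     (\<forall>S\<in>\<S>. \<exists>!T. T \<in> elements M \<and> interior S \<subseteq> T) \<and>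
     (\<forall>S\<in>\<S>. \<forall>E. E facet_of S \<longrightarrow>
        (\<forall>F\<in>faces M. rel_interior E \<inter> F = {} \<or> rel_interior E \<subseteq> F))"

definition submesh_regular ::
    "real \<Rightarrow> 'n::finite mesh \<Rightarrow> (real^'n) set set \<Rightarrow> bool" where
  "submesh_regular \<rho> M \<S> \<longleftrightarrow>
     (\<forall>S\<in>\<S>. \<rho> * diameter S \<le> inradius S \<and>
        (\<forall>T\<in>elements M. interior S \<subseteq> T \<longrightarrow> \<rho> * diameter T \<le> diameter S))"

definition star_shaped_wrt_point :: "'a::real_vector set \<Rightarrow> 'a \<Rightarrow> bool" where
  "star_shaped_wrt_point T y \<longleftrightarrow> y \<in> T \<and> (\<forall>x\<in>T. closed_segment y x \<subseteq> T)"

definition star_shaped_wrt_ball :: "real \<Rightarrow> 'a::euclidean_space set \<Rightarrow> bool" where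
  "star_shaped_wrt_ball \<sigma> T \<longleftrightarrow>
     (\<exists>x r. \<sigma> * diameter T \<le> r \<and> (\<forall>y\<in>ball x r. star_shaped_wrt_point T y))"

text \<open>The star-shapedness ratio \<open>\<sigma>\<close> is uniform along the sequence, but it is not counted as part of
  the regularity parameter \<open>\<rho>\<close>.\<close>

definition regular_mesh_sequence ::
    "(real^'n) set \<Rightarrow> real \<Rightarrow> (nat \<Rightarrow> 'n::finite mesh) \<Rightarrow> bool" where
  "regular_mesh_sequence \<Omega> \<rho> \<M> \<longleftrightarrow>
     (\<forall>i. polyhedral_mesh \<Omega> (\<M> i)) \<and>
     (\<forall>i. \<exists>\<S>. matching_simplicial_submesh \<Omega> (\<M> i) \<S> \<and> submesh_regular \<rho> (\<M> i) \<S>) \<and>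
     (\<exists>\<sigma>>0. \<forall>i. \<forall>T\<in>elements (\<M> i). star_shaped_wrt_ball \<sigma> T)"

section \<open>Lebesgue measure on affine subspaces and norms\<close>

text \<open>Lebesgue measure (of the dimension of \<open>A\<close>) on a nonempty affine subspace \<open>A\<close>, transported by
  orthonormal coordinates and regarded as a Borel measure on the ambient space. By invariance of
  Lebesgue measure under isometries, it depends neither on the origin \<open>p\<close> nor on the orthonormal
  basis \<open>B\<close> of the direction of \<open>A\<close>.\<close>

definition affine_lborel :: "'a::euclidean_space set \<Rightarrow> 'a measure" where
  "affine_lborel A =
     (let p = (SOME p. p \<in> A);
          B = (SOME B. pairwise orthogonal B \<and> (\<forall>b\<in>B. norm b = 1) \<and> A = (\<lambda>x. p + x) ` span B)
      in distr (\<Pi>\<^sub>M b\<in>B. lborel) borel (\<lambda>f. p + (\<Sum>b\<in>B. f b *\<^sub>R b)))"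

abbreviation face_measure :: "'a::euclidean_space set \<Rightarrow> 'a measure" where
  "face_measure F \<equiv> affine_lborel (affine hull F)"

text \<open>On matrices, \<^const>\<open>norm\<close> is the Frobenius norm.\<close>

definition L2_norm_on :: "'a measure \<Rightarrow> 'a set \<Rightarrow> ('a \<Rightarrow> 'b::real_normed_vector) \<Rightarrow> real" where
  "L2_norm_on \<mu> X v = sqrt (LINT x:X|\<mu>. (norm (v x))\<^sup>2)"

definition sym_grad :: "(real^'n \<Rightarrow> real^'n) \<Rightarrow> real^'n \<Rightarrow> real^'n^'n" where
  "sym_grad v x = (1/2) *\<^sub>R (jacobian v (at x) + transpose (jacobian v (at x)))"

section \<open>The hybrid discrete space\<close>

definition vec_poly :: "nat \<Rightarrow> (real^'n \<Rightarrow> real^'n) set" where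
  "vec_poly k = {p. \<exists>c :: ('n \<Rightarrow> nat) \<Rightarrow> real^'n.
     \<forall>x. p x = (\<Sum>\<alpha> | (\<Sum>i\<in>UNIV. \<alpha> i) \<le> k. (\<Prod>i\<in>UNIV. (x $ i) ^ \<alpha> i) *\<^sub>R c \<alpha>)}"

text \<open>A field on \<open>X\<close> is represented by a total function whose values off \<open>X\<close> are irrelevant.\<close>

definition vec_poly_on :: "nat \<Rightarrow> (real^'n) set \<Rightarrow> (real^'n \<Rightarrow> real^'n) set" where
  "vec_poly_on k X = {v. \<exists>p\<in>vec_poly k. \<forall>x\<in>X. v x = p x}"

type_synonym 'n hybrid =
  "((real^'n) set \<Rightarrow> real^'n \<Rightarrow> real^'n) \<times> ((real^'n) set \<Rightarrow> real^'n \<Rightarrow> real^'n)"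

text \<open>Element unknowns are prescribed on \<open>closure T\<close>, so that their values on faces of \<open>T\<close>
  are the traces of the polynomial on \<open>T\<close>.\<close>

definition hybrid_space :: "nat \<Rightarrow> 'n::finite mesh \<Rightarrow> 'n hybrid set" where
  "hybrid_space k M =
     {v. (\<forall>T\<in>elements M. fst v T \<in> vec_poly_on k (closure T)) \<and>
         (\<forall>F\<in>faces M. snd v F \<in> vec_poly_on k F)}"

definition hybrid_space_D :: "(real^'n) set \<Rightarrow> nat \<Rightarrow> 'n::finite mesh \<Rightarrow> 'n hybrid set" where
  "hybrid_space_D \<Omega> k M =
     {v \<in> hybrid_space k M. \<forall>F\<in>boundary_faces \<Omega> M. \<forall>x\<in>F. snd v F x = 0}"

text \<open>The broken field \<open>v\<^sub>h\<close>; elements being disjoint, it equals \<open>v\<^sub>T\<close> on each \<open>T\<close>, and it is set to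
  zero on the (Lebesgue-null) mesh skeleton.\<close>

definition broken_field :: "'n::finite mesh \<Rightarrow> 'n hybrid \<Rightarrow> real^'n \<Rightarrow> real^'n" where
  "broken_field M v x = (\<Sum>T\<in>elements M. indicator T x *\<^sub>R fst v T x)"

definition strain_norm :: "'n::finite mesh \<Rightarrow> 'n hybrid \<Rightarrow> real" where
  "strain_norm M v =
     sqrt (\<Sum>T\<in>elements M.
       (L2_norm_on lborel T (sym_grad (fst v T)))\<^sup>2 +
       (\<Sum>F\<in>faces_of_element M T.
          inverse (diameter F) * (L2_norm_on (face_measure F) F (\<lambda>x. snd v F x - fst v T x))\<^sup>2))"

end

theory Submission
  imports Defs "HOL-Probability.Distributions"
begin

text \<open>Let \<open>\<xi>\<close> be a unit vector and let \<open>v\<close> be smooth. Along a line of direction \<open>\<xi>\<close> the component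
  \<open>w(t) = v(x + t \<xi>) \<bullet> \<xi>\<close> has the derivative \<open>(\<nabla>\<^sub>s v \<xi>) \<bullet> \<xi>\<close>: it involves the symmetric gradient only.
  Hence the Poincare inequality for the component \<open>v \<bullet> \<xi>\<close> in its own direction is already a Korn
  inequality, and summing over the directions of an orthonormal basis gives the full \<open>L\<^sup>2\<close> norm.

  For a broken field this is done chord by chord. A generic line cuts the simplices of the submesh
  in nonoverlapping intervals, and on each of them the derivative of \<open>(t - t0) w\<^sup>2\<close> is integrated, where
  \<open>\<bar>t - t0\<bar> \<le> 1\<close> because the domain has diameter 1. If the end values were those of a single-valued field
  that vanishes where the line leaves the domain, the boundary terms would telescope to zero
  (\<open>chords_telescope\<close>). Such a field is given by the element fields inside the elements and by the
  face unknowns on the faces, so that the defect at an end point is a product of \<open>w\<close> and of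
  \<open>v\<^sub>F - v\<^sub>T\<close>, plus a square. Young's inequality with weight \<open>h\<^sub>F\<close> turns it into
  \<open>\<epsilon> h\<^sub>F w\<^sup>2 + (1 + 1 / \<epsilon>) h\<^sub>F\<^sup>-\<^sup>1 \<bar>v\<^sub>F - v\<^sub>T\<bar>\<^sup>2\<close> (\<open>endpoint_defect\<close>, \<open>line_energy_estimate\<close>). Integrated over all lines,
  the second part is the jump part of the strain norm, since a hyperplane with unit normal \<open>n\<close> is seen
  by the lines with the density \<open>\<bar>n \<bullet> \<xi>\<bar> \<le> 1\<close> (\<open>nn_integral_along_hyperplane\<close>).

  The first part is a trace term which has to be absorbed. An inverse inequality would bring in the
  polynomial degree. Instead, \<open>simplex_trace_inequality\<close> bounds \<open>h \<parallel>v\<parallel>\<^sup>2\<close> on a facet by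
  \<open>\<parallel>v\<parallel>\<^sup>2 + h\<^sup>2 \<parallel>\<nabla>\<^sub>s v\<parallel>\<^sup>2\<close> on the simplex, again with one-dimensional estimates: the facet is split into pieces, one for
  each of its vertices, each piece can be translated into the simplex along as many independent
  directions \<open>\<eta>\<close> as there are dimensions, and \<open>v \<bullet> \<eta>\<close> along \<open>\<eta>\<close> is controlled by the symmetric gradient.
  A small \<open>\<epsilon>\<close> then allows absorption; the resulting constant depends on the dimension and on the
  regularity parameter only.\<close>

section \<open>Rotation invariance of Lebesgue measure\<close>

lemma PiM_lborel_shift:
  fixes u :: "'b \<Rightarrow> real"
  assumes "finite B"
  shows "distr (\<Pi>\<^sub>M b\<in>B. lborel) (\<Pi>\<^sub>M b\<in>B. lborel) (\<lambda>f. \<lambda>b\<in>B. f b + u b) = (\<Pi>\<^sub>M b\<in>B. lborel)"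
proof -
  interpret product_sigma_finite "\<lambda>b::'b. lborel :: real measure"
    by (simp add: product_sigma_finite_def sigma_finite_lborel)
  have meas: "(\<lambda>f. \<lambda>b\<in>B. f b + u b) \<in> measurable (\<Pi>\<^sub>M b\<in>B. lborel) (\<Pi>\<^sub>M b\<in>B. (lborel::real measure))"
    by measurable
  show ?thesis
  proof (rule PiM_eqI[OF assms])
    fix A :: "'b \<Rightarrow> real set" assume A: "\<And>i. i \<in> B \<Longrightarrow> A i \<in> sets lborel"
    have "(\<lambda>f. \<lambda>b\<in>B. f b + u b) -` (Pi\<^sub>E B A) \<inter> space (\<Pi>\<^sub>M b\<in>B. lborel) = Pi\<^sub>E B (\<lambda>b. (\<lambda>t. t + u b) -` A b)"
      by (auto simp: space_PiM PiE_iff)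
    moreover have m: "(\<lambda>t. t + u b) -` A b \<in> sets lborel" if "b \<in> B" for b
      using measurable_sets_borel[of "\<lambda>t. t + u b" borel "A b"] A[OF that] by simp
    moreover have "emeasure lborel ((\<lambda>t. t + u b) -` A b) = emeasure lborel (A b)" if "b \<in> B" for b
    proof -
      have "emeasure lborel (A b) = emeasure (distr lborel borel ((+) (u b))) (A b)"
        by (simp add: lborel_distr_plus)
      also have "\<dots> = emeasure lborel ((+) (u b) -` A b)"
        using A[OF that] by (subst emeasure_distr) auto
      finally show ?thesis by (simp add: vimage_def add.commute)
    qed
    ultimately show "emeasure (distr (\<Pi>\<^sub>M b\<in>B. lborel) (\<Pi>\<^sub>M b\<in>B. lborel) (\<lambda>f. \<lambda>b\<in>B. f b + u b)) (Pi\<^sub>E B A)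
        = (\<Prod>i\<in>B. emeasure lborel (A i))"
      using A assms meas by (subst emeasure_distr) (auto intro!: sets_PiM_I_finite simp: emeasure_PiM)
  qed simp
qed

lemma nn_integral_orthonormal_shift:
  fixes B :: "'a::euclidean_space set" and g :: "'a \<Rightarrow> ennreal"
  assumes "finite B" "c \<in> span B" and [measurable]: "g \<in> borel_measurable borel"
  shows "(\<integral>\<^sup>+f. g ((\<Sum>b\<in>B. f b *\<^sub>R b) + c) \<partial>(\<Pi>\<^sub>M b\<in>B. lborel)) = (\<integral>\<^sup>+f. g (\<Sum>b\<in>B. f b *\<^sub>R b) \<partial>(\<Pi>\<^sub>M b\<in>B. lborel))"
proof -
  obtain u where u: "c = (\<Sum>b\<in>B. u b *\<^sub>R b)"
    using assms(2) unfolding span_finite[OF assms(1)] by auto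
  have "(\<integral>\<^sup>+f. g (\<Sum>b\<in>B. f b *\<^sub>R b) \<partial>(\<Pi>\<^sub>M b\<in>B. lborel))
      = (\<integral>\<^sup>+f. g (\<Sum>b\<in>B. f b *\<^sub>R b) \<partial>distr (\<Pi>\<^sub>M b\<in>B. lborel) (\<Pi>\<^sub>M b\<in>B. lborel) (\<lambda>f. \<lambda>b\<in>B. f b + u b))"
    by (simp add: PiM_lborel_shift assms)
  also have "\<dots> = (\<integral>\<^sup>+f. g (\<Sum>b\<in>B. (f b + u b) *\<^sub>R b) \<partial>(\<Pi>\<^sub>M b\<in>B. lborel))"
    by (subst nn_integral_distr) (auto intro!: nn_integral_cong arg_cong[where f=g] sum.cong)
  finally show ?thesis
    by (simp add: u sum.distrib scaleR_add_left)
qed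

lemma nn_integral_lborel_shift:
  fixes g :: "'a::euclidean_space \<Rightarrow> ennreal"
  assumes [measurable]: "g \<in> borel_measurable borel"
  shows "(\<integral>\<^sup>+x. g (x + c) \<partial>lborel) = (\<integral>\<^sup>+x. g x \<partial>lborel)"
proof -
  have "(\<integral>\<^sup>+x. g x \<partial>distr lborel borel ((+) c)) = (\<integral>\<^sup>+x. g (c + x) \<partial>lborel)"
    by (rule nn_integral_distr) auto
  then show ?thesis unfolding lborel_distr_plus by (simp add: add.commute)
qed

lemma orthonormal_sum_inner:
  assumes "pairwise orthogonal B" "\<And>b. b \<in> B \<Longrightarrow> norm b = 1" "finite B" "c \<in> B"
  shows "(\<Sum>b\<in>B. f b *\<^sub>R b) \<bullet> c = f c"
proof -
  have "(\<Sum>b\<in>B. f b *\<^sub>R b) \<bullet> c = (\<Sum>b\<in>B. if b = c then f b else 0)"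
    unfolding inner_sum_left
  proof (intro sum.cong refl)
    fix b assume "b \<in> B"
    have "c \<bullet> c = 1" using assms(2,4) by (simp add: norm_eq_1)
    moreover have "b \<noteq> c \<Longrightarrow> b \<bullet> c = 0"
      using assms(1,4) \<open>b \<in> B\<close> by (auto simp: pairwise_def orthogonal_def)
    ultimately show "f b *\<^sub>R b \<bullet> c = (if b = c then f b else 0)" by auto
  qed
  also have "\<dots> = f c" using assms by simp
  finally show ?thesis .
qed

lemma nn_integral_std_normal: "(\<integral>\<^sup>+t. ennreal (std_normal_density t) \<partial>lborel) = 1"
proof -
  interpret prob_space "density lborel (\<lambda>x. ennreal (std_normal_density x))"
    by (rule prob_space_normal_density) simp
  show ?thesis using emeasure_space_1 by (simp add: emeasure_density)
qed

text \<open>The standard Gaussian is a product of one-dimensional densities in every orthonormal basis and at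
  the same time depends on the norm alone. Its integral is therefore one in all orthonormal
  coordinates, which normalizes the comparison in \<open>nn_integral_orthonormal_basis\<close>.\<close>

definition gauss :: "'a::euclidean_space \<Rightarrow> real" where
  "gauss x = (1 / sqrt (2 * pi)) ^ DIM('a) * exp (- (norm x)\<^sup>2 / 2)"

lemma nn_integral_gauss_orthonormal:
  fixes B :: "'a::euclidean_space set"
  assumes B: "pairwise orthogonal B" "\<And>b. b \<in> B \<Longrightarrow> norm b = 1" "span B = UNIV"
  shows "(\<integral>\<^sup>+f. ennreal (gauss (\<Sum>b\<in>B. f b *\<^sub>R b)) \<partial>(\<Pi>\<^sub>M b\<in>B. lborel)) = 1"
proof -
  have ind: "independent B"
    using B pairwise_orthogonal_independent by force
  then have fin: "finite B" by (rule independent_imp_finite)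
  have card: "card B = DIM('a)"
    using ind B(3) by (metis dim_UNIV dim_eq_card_independent dim_span)
  interpret product_sigma_finite "\<lambda>b::'a. lborel :: real measure"
    by (simp add: product_sigma_finite_def sigma_finite_lborel)
  have "gauss (\<Sum>b\<in>B. f b *\<^sub>R b) = (\<Prod>b\<in>B. std_normal_density (f b))" for f :: "'a \<Rightarrow> real"
  proof -
    have "(norm (\<Sum>b\<in>B. f b *\<^sub>R b))\<^sup>2 = (\<Sum>b\<in>B. (f b)\<^sup>2)"
    proof -
      have "(\<Sum>b\<in>B. f b *\<^sub>R b) \<bullet> (\<Sum>b\<in>B. f b *\<^sub>R b) = (\<Sum>c\<in>B. f c * ((\<Sum>b\<in>B. f b *\<^sub>R b) \<bullet> c))"
        by (simp add: inner_sum_right)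
      also have "\<dots> = (\<Sum>c\<in>B. f c * f c)"
        using orthonormal_sum_inner[OF B(1,2) fin] by (intro sum.cong) auto
      finally show ?thesis unfolding power2_norm_eq_inner by (simp add: power2_eq_square)
    qed
    then have "gauss (\<Sum>b\<in>B. f b *\<^sub>R b)
        = (\<Prod>b\<in>B. 1 / sqrt (2 * pi)) * exp (\<Sum>b\<in>B. - (f b)\<^sup>2 / 2)"
      unfolding gauss_def by (simp only: card[symmetric] prod_constant sum_divide_distrib[symmetric] sum_negf)
    also have "\<dots> = (\<Prod>b\<in>B. 1 / sqrt (2 * pi) * exp (- (f b)\<^sup>2 / 2))"
      by (simp only: exp_sum[OF fin] prod.distrib)
    finally show ?thesis by (simp add: normal_density_def)
  qed
  then have "(\<integral>\<^sup>+f. ennreal (gauss (\<Sum>b\<in>B. f b *\<^sub>R b)) \<partial>(\<Pi>\<^sub>M b\<in>B. lborel))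
     = (\<integral>\<^sup>+f. (\<Prod>b\<in>B. ennreal (std_normal_density (f b))) \<partial>(\<Pi>\<^sub>M b\<in>B. lborel))"
    by (simp add: prod_ennreal)
  also have "\<dots> = 1"
    using fin by (subst product_nn_integral_prod) (auto simp: nn_integral_std_normal)
  finally show ?thesis .
qed

lemma nn_integral_gauss: "(\<integral>\<^sup>+x. ennreal (gauss (x::'a::euclidean_space)) \<partial>lborel) = 1"
proof -
  have "(\<integral>\<^sup>+x. ennreal (gauss (x::'a)) \<partial>lborel) = 
    (\<integral>\<^sup>+f. ennreal (gauss (\<Sum>b\<in>Basis. f b *\<^sub>R b :: 'a)) \<partial>(\<Pi>\<^sub>M b\<in>Basis. lborel))"
    by (subst lborel_eq, subst nn_integral_distr) (auto simp: gauss_def)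
  also have "\<dots> = 1"
    by (rule nn_integral_gauss_orthonormal) (auto simp: pairwise_def orthogonal_def inner_not_same_Basis)
  finally show ?thesis .
qed

text \<open>Integration in the orthonormal coordinates and Lebesgue integration are both translation invariant.
  Tonelli's theorem for the convolution of \<open>g\<close> with the Gaussian shows that two such integrals are
  proportional, and the Gaussian has integral one for both of them.\<close>

lemma nn_integral_orthonormal_basis:
  fixes B :: "'a::euclidean_space set" and g :: "'a \<Rightarrow> ennreal"
  assumes B: "pairwise orthogonal B" "\<And>b. b \<in> B \<Longrightarrow> norm b = 1" "span B = UNIV"
    and [measurable]: "g \<in> borel_measurable borel"
  shows "(\<integral>\<^sup>+f. g (\<Sum>b\<in>B. f b *\<^sub>R b) \<partial>(\<Pi>\<^sub>M b\<in>B. lborel)) = (\<integral>\<^sup>+x. g x \<partial>lborel)"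
proof -
  have fin: "finite B"
    using B pairwise_orthogonal_independent independent_imp_finite by force
  interpret product_sigma_finite "\<lambda>b::'a. lborel :: real measure"
    by (simp add: product_sigma_finite_def sigma_finite_lborel)
  interpret P: pair_sigma_finite "\<Pi>\<^sub>M b\<in>B. (lborel::real measure)" "lborel :: 'a measure"
    by (simp add: pair_sigma_finite_def sigma_finite[OF fin] sigma_finite_lborel)
  define X where "X = (\<lambda>f::'a\<Rightarrow>real. \<Sum>b\<in>B. f b *\<^sub>R b)"
  have [measurable]: "X \<in> measurable (\<Pi>\<^sub>M b\<in>B. lborel) borel"
    unfolding X_def by measurable
  have [measurable]: "gauss \<in> borel_measurable (borel :: 'a measure)"
    unfolding gauss_def by measurable
  let ?M = "\<Pi>\<^sub>M b\<in>B. (lborel::real measure)"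
  let ?h = "\<lambda>x::'a. ennreal (gauss x)"
  have "(\<integral>\<^sup>+f. g (X f) \<partial>?M) = (\<integral>\<^sup>+y. ?h y * (\<integral>\<^sup>+f. g (X f) \<partial>?M) \<partial>lborel)"
    by (simp add: nn_integral_multc nn_integral_gauss)
  also have "\<dots> = (\<integral>\<^sup>+y. (\<integral>\<^sup>+f. ?h y * g (X f + y) \<partial>?M) \<partial>lborel)"
    using nn_integral_orthonormal_shift[OF fin, of _ g] B(3)
    by (intro nn_integral_cong) (simp add: X_def nn_integral_cmult)
  also have "\<dots> = (\<integral>\<^sup>+f. (\<integral>\<^sup>+y. ?h y * g (X f + y) \<partial>lborel) \<partial>?M)"
    by (rule P.Fubini') measurable
  also have "\<dots> = (\<integral>\<^sup>+f. (\<integral>\<^sup>+y. ?h (y - X f) * g y \<partial>lborel) \<partial>?M)"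
  proof (rule nn_integral_cong)
    fix f
    show "(\<integral>\<^sup>+y. ?h y * g (X f + y) \<partial>lborel) = (\<integral>\<^sup>+y. ?h (y - X f) * g y \<partial>lborel)"
      using nn_integral_lborel_shift[of "\<lambda>y. ?h (y - X f) * g y" "X f"] by (simp add: add.commute)
  qed
  also have "\<dots> = (\<integral>\<^sup>+y. (\<integral>\<^sup>+f. ?h (y - X f) * g y \<partial>?M) \<partial>lborel)"
    by (rule P.Fubini'[symmetric]) measurable
  also have "\<dots> = (\<integral>\<^sup>+y. g y \<partial>lborel)"
  proof (intro nn_integral_cong)
    fix y
    have "(\<integral>\<^sup>+f. ?h (y - X f) \<partial>?M) = (\<integral>\<^sup>+f. ?h (X f + - y) \<partial>?M)"
      by (intro nn_integral_cong) (simp add: gauss_def norm_minus_commute)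
    also have "\<dots> = 1"
      using nn_integral_orthonormal_shift[OF fin, of "-y" ?h] B(3) nn_integral_gauss_orthonormal[OF B]
      by (simp add: X_def)
    finally show "(\<integral>\<^sup>+f. ?h (y - X f) * g y \<partial>?M) = g y"
      by (simp add: nn_integral_multc)
  qed
  finally show ?thesis by (simp add: X_def)
qed

section \<open>Integration along a hyperplane\<close>

abbreviation plane :: "'a::euclidean_space \<Rightarrow> real \<Rightarrow> 'a set" where
  "plane n b \<equiv> {x. n \<bullet> x = b}"

abbreviation slab :: "'a::euclidean_space \<Rightarrow> 'a set" where
  "slab \<xi> \<equiv> {x. 0 \<le> x \<bullet> \<xi> \<and> x \<bullet> \<xi> \<le> 1}"

abbreviation nn_integral_on :: "'a::euclidean_space set \<Rightarrow> ('a \<Rightarrow> real) \<Rightarrow> ennreal" where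
  "nn_integral_on S f \<equiv> \<integral>\<^sup>+x. indicator S x * ennreal (f x) \<partial>lborel"

text \<open>The origin and the orthonormal basis that are chosen in the definition of the measure exist, and
  the unit normal completes this basis to one of the whole space.\<close>

lemma affine_lborel_hyperplane_coordinates:
  fixes n :: "'a::euclidean_space"
  assumes n: "norm n = 1"
  obtains p B where "n \<bullet> p = b" "finite B" "n \<notin> B" "\<forall>c. c \<in> span B \<longleftrightarrow> n \<bullet> c = 0"
    "pairwise orthogonal (insert n B)" "\<forall>c\<in>insert n B. norm c = 1" "span (insert n B) = UNIV"
    "affine_lborel (plane n b) = distr (\<Pi>\<^sub>M b\<in>B. lborel) borel (\<lambda>f. p + (\<Sum>b\<in>B. f b *\<^sub>R b))"
proof -
  let ?A = "plane n b"
  define p where "p = (SOME p. p \<in> ?A)"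
  have nn: "n \<bullet> n = 1" using n by (simp add: norm_eq_1)
  have "b *\<^sub>R n \<in> ?A" using nn by simp
  then have p: "p \<in> ?A" unfolding p_def by (rule someI)
  let ?P = "\<lambda>B. pairwise orthogonal B \<and> (\<forall>b\<in>B. norm b = 1) \<and> ?A = (\<lambda>x. p + x) ` span B"
  define B where "B = (SOME B. ?P B)"
  have A: "?A = (\<lambda>x. p + x) ` {c. n \<bullet> c = 0}"
  proof (intro set_eqI iffI)
    fix x assume "x \<in> ?A"
    then show "x \<in> (\<lambda>x. p + x) ` {c. n \<bullet> c = 0}"
      using p by (intro image_eqI[of _ _ "x - p"]) (auto simp: inner_diff_right)
  qed (use p in \<open>auto simp: inner_add_right\<close>)
  obtain B0 where "B0 \<subseteq> {c. n \<bullet> c = 0}" "pairwise orthogonal B0"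
      "\<And>x. x \<in> B0 \<Longrightarrow> norm x = 1" "span B0 = {c. n \<bullet> c = 0}"
    using orthonormal_basis_subspace[OF subspace_hyperplane[of n]] by metis
  then have "?P B0" using A by auto
  then have B: "?P B" unfolding B_def by (rule someI)
  have span: "c \<in> span B \<longleftrightarrow> n \<bullet> c = 0" for c
  proof -
    have "(\<lambda>x. p + x) ` span B = (\<lambda>x. p + x) ` {c. n \<bullet> c = 0}" using B A by simp
    then have "span B = {c. n \<bullet> c = 0}"
      by (simp add: inj_image_eq_iff)
    then show ?thesis by auto
  qed
  have "0 \<notin> B" using B by force
  then have "independent B" using B pairwise_orthogonal_independent by blast
  then have fin: "finite B" by (rule independent_imp_finite)
  have orth: "n \<bullet> c = 0" if "c \<in> B" for c
    using span[of c] that span_base by blast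
  have nB: "n \<notin> B" using orth nn by force
  have po: "pairwise orthogonal (insert n B)"
    using B orth by (auto simp: pairwise_insert orthogonal_def inner_commute)
  have full: "span (insert n B) = UNIV"
  proof -
    have "c \<in> span (insert n B)" for c
    proof -
      have "c - (n \<bullet> c) *\<^sub>R n \<in> span B"
        using span nn by (simp add: inner_diff_right)
      then show ?thesis by (subst span_breakdown_eq) blast
    qed
    then show ?thesis by auto
  qed
  have "affine_lborel ?A = distr (\<Pi>\<^sub>M b\<in>B. lborel) borel (\<lambda>f. p + (\<Sum>b\<in>B. f b *\<^sub>R b))"
    unfolding affine_lborel_def Let_def p_def[symmetric] B_def[symmetric] by simp
  then show thesis
    by (intro that[of p B]) (use p fin nB span po B n full in auto)
qed

lemma space_affine_lborel [simp]: "space (affine_lborel A) = UNIV"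
  and sets_affine_lborel [measurable_cong, simp]: "sets (affine_lborel A) = sets borel"
  by (simp_all add: affine_lborel_def Let_def)

lemma AE_affine_lborel_hyperplane:
  fixes n :: "'a::euclidean_space"
  assumes n: "norm n = 1"
  shows "AE x in affine_lborel (plane n b). n \<bullet> x = b"
proof -
  obtain p B where pB: "n \<bullet> p = b" "finite B" "n \<notin> B" "\<forall>c. c \<in> span B \<longleftrightarrow> n \<bullet> c = 0"
    "pairwise orthogonal (insert n B)" "\<forall>c\<in>insert n B. norm c = 1" "span (insert n B) = UNIV"
    and A: "affine_lborel (plane n b) = distr (\<Pi>\<^sub>M b\<in>B. lborel) borel (\<lambda>f. p + (\<Sum>b\<in>B. f b *\<^sub>R b))"
    by (rule affine_lborel_hyperplane_coordinates[OF n, of b])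
  have "n \<bullet> (\<Sum>b\<in>B. f b *\<^sub>R b) = 0" for f
    using pB(4)[rule_format, of "\<Sum>b\<in>B. f b *\<^sub>R b"] by (simp add: span_base span_scale span_sum)
  then show ?thesis unfolding A
    by (subst AE_distr_iff) (auto simp: inner_add_right pB(1))
qed

lemma nn_integral_lborel_scale:
  fixes h :: "real \<Rightarrow> ennreal"
  assumes [measurable]: "h \<in> borel_measurable borel" and "\<kappa> \<noteq> 0"
  shows "(\<integral>\<^sup>+t. h t \<partial>lborel) = ennreal \<bar>\<kappa>\<bar> * (\<integral>\<^sup>+s. h (\<kappa> * s) \<partial>lborel)"
  by (rule nn_integral_real_affine[OF assms, of 0, unfolded add_0_left])

text \<open>Fubini's theorem in oblique coordinates. For \<open>\<eta> = n\<close> it is integration in an orthonormal basis. The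
  part of \<open>\<eta>\<close> parallel to the hyperplane amounts to a translation within each parallel hyperplane,
  which changes nothing; the normal part rescales the line parameter by \<open>\<eta> \<bullet> n\<close>.\<close>

theorem nn_integral_along_hyperplane:
  fixes n \<eta> :: "'a::euclidean_space" and f :: "'a \<Rightarrow> ennreal"
  assumes n: "norm n = 1" and \<eta>: "\<eta> \<bullet> n \<noteq> 0" and [measurable]: "f \<in> borel_measurable borel"
  shows "(\<integral>\<^sup>+x. f x \<partial>lborel) =
    ennreal \<bar>\<eta> \<bullet> n\<bar> * (\<integral>\<^sup>+x. (\<integral>\<^sup>+t. f (x + t *\<^sub>R \<eta>) \<partial>lborel) \<partial>affine_lborel (plane n b))"
proof -
  obtain p B where pB: "n \<bullet> p = b" "finite B" "n \<notin> B" "\<forall>c. c \<in> span B \<longleftrightarrow> n \<bullet> c = 0"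
    "pairwise orthogonal (insert n B)" "\<forall>c\<in>insert n B. norm c = 1" "span (insert n B) = UNIV"
    and A: "affine_lborel (plane n b) = distr (\<Pi>\<^sub>M b\<in>B. lborel) borel (\<lambda>f. p + (\<Sum>b\<in>B. f b *\<^sub>R b))"
    by (rule affine_lborel_hyperplane_coordinates[OF n, of b])
  interpret product_sigma_finite "\<lambda>b::'a. lborel :: real measure"
    by (simp add: product_sigma_finite_def sigma_finite_lborel)
  let ?M = "\<Pi>\<^sub>M b\<in>B. (lborel::real measure)"
  interpret P: pair_sigma_finite ?M "lborel :: real measure"
    by (simp add: pair_sigma_finite_def sigma_finite[OF pB(2)] sigma_finite_lborel)
  define X where "X = (\<lambda>f::'a\<Rightarrow>real. \<Sum>b\<in>B. f b *\<^sub>R b)"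
  have [measurable]: "X \<in> measurable ?M borel"
    unfolding X_def by measurable
  define \<kappa> where "\<kappa> = \<eta> \<bullet> n"
  have "(\<integral>\<^sup>+x. f x \<partial>lborel) = (\<integral>\<^sup>+x. f (x + p) \<partial>lborel)"
    by (simp add: nn_integral_lborel_shift)
  also have "\<dots> = (\<integral>\<^sup>+u. f ((\<Sum>b\<in>insert n B. u b *\<^sub>R b) + p) \<partial>(\<Pi>\<^sub>M b\<in>insert n B. lborel))"
    by (rule nn_integral_orthonormal_basis[symmetric, OF pB(5) _ pB(7)]) (use pB(6) in auto)
  also have "\<dots> = (\<integral>\<^sup>+t. (\<integral>\<^sup>+u. f ((\<Sum>b\<in>insert n B. (u(n := t)) b *\<^sub>R b) + p) \<partial>?M) \<partial>lborel)"
    by (rule product_nn_integral_insert_rev[OF pB(2,3)]) measurable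
  also have "\<dots> = (\<integral>\<^sup>+t. (\<integral>\<^sup>+u. f (p + X u + t *\<^sub>R n) \<partial>?M) \<partial>lborel)"
  proof -
    have "(\<Sum>b\<in>insert n B. (u(n := t)) b *\<^sub>R b) + p = p + X u + t *\<^sub>R n" for u t
    proof -
      have "(\<Sum>b\<in>B. (u(n := t)) b *\<^sub>R b) = X u"
        unfolding X_def using pB(3) by (intro sum.cong) auto
      then show ?thesis by (subst sum.insert[OF pB(2,3)]) (simp add: add_ac)
    qed
    then show ?thesis by (simp only:)
  qed
  also have "\<dots> = ennreal \<bar>\<kappa>\<bar> * (\<integral>\<^sup>+s. (\<integral>\<^sup>+u. f (p + X u + (\<kappa> * s) *\<^sub>R n) \<partial>?M) \<partial>lborel)"
  proof (rule nn_integral_lborel_scale)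
    show "\<kappa> \<noteq> 0" using \<eta> by (simp add: \<kappa>_def)
    show "(\<lambda>t. \<integral>\<^sup>+u. f (p + X u + t *\<^sub>R n) \<partial>?M) \<in> borel_measurable borel"
      using sigma_finite_measure.borel_measurable_nn_integral[OF sigma_finite[OF pB(2)],
        of "\<lambda>t u. f (p + X u + t *\<^sub>R n)" borel] by simp
  qed
  also have "(\<integral>\<^sup>+s. (\<integral>\<^sup>+u. f (p + X u + (\<kappa> * s) *\<^sub>R n) \<partial>?M) \<partial>lborel)
      = (\<integral>\<^sup>+s. (\<integral>\<^sup>+u. f (p + X u + s *\<^sub>R \<eta>) \<partial>?M) \<partial>lborel)"
  proof (rule nn_integral_cong)
    fix s :: real
    have "n \<bullet> n = 1" using n by (simp add: norm_eq_1)
    then have "s *\<^sub>R (\<eta> - \<kappa> *\<^sub>R n) \<in> span B"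
      by (simp add: pB(4)[rule_format] inner_diff_right \<kappa>_def inner_commute)
    then have "(\<integral>\<^sup>+u. f (p + (X u + s *\<^sub>R (\<eta> - \<kappa> *\<^sub>R n)) + (\<kappa> * s) *\<^sub>R n) \<partial>?M)
        = (\<integral>\<^sup>+u. f (p + X u + (\<kappa> * s) *\<^sub>R n) \<partial>?M)"
      unfolding X_def
      by (intro nn_integral_orthonormal_shift[OF pB(2), of _ "\<lambda>x. f (p + x + (\<kappa> * s) *\<^sub>R n)"]) measurable
    moreover have "p + (X u + s *\<^sub>R (\<eta> - \<kappa> *\<^sub>R n)) + (\<kappa> * s) *\<^sub>R n = p + X u + s *\<^sub>R \<eta>" for u
      by (simp add: algebra_simps)
    ultimately show "(\<integral>\<^sup>+u. f (p + X u + (\<kappa> * s) *\<^sub>R n) \<partial>?M) = (\<integral>\<^sup>+u. f (p + X u + s *\<^sub>R \<eta>) \<partial>?M)"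
      by (simp only:)
  qed
  also have "\<dots> = (\<integral>\<^sup>+u. (\<integral>\<^sup>+s. f (p + X u + s *\<^sub>R \<eta>) \<partial>lborel) \<partial>?M)"
    by (rule P.Fubini') measurable
  also have "\<dots> = (\<integral>\<^sup>+x. (\<integral>\<^sup>+t. f (x + t *\<^sub>R \<eta>) \<partial>lborel) \<partial>affine_lborel (plane n b))"
    unfolding A X_def by (subst nn_integral_distr) auto
  finally show ?thesis by (simp add: \<kappa>_def)
qed

text \<open>Every line of direction \<open>\<xi>\<close> meets the slab \<open>0 \<le> x \<bullet> \<xi> \<le> 1\<close> in a segment of length one. Integrating over the
  slab a quantity that depends on the line through \<open>x\<close> thus integrates it over the space of lines,
  with no need to choose a transversal hyperplane.\<close>

lemma nn_integral_slab_lines: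
  fixes \<xi> :: "'a::euclidean_space" and f :: "'a \<Rightarrow> ennreal"
  assumes \<xi>: "norm \<xi> = 1" and [measurable]: "f \<in> borel_measurable borel"
  shows "(\<integral>\<^sup>+x. indicator (slab \<xi>) x * (\<integral>\<^sup>+t. f (x + t *\<^sub>R \<xi>) \<partial>lborel) \<partial>lborel)
     = (\<integral>\<^sup>+x. f x \<partial>lborel)"
proof -
  let ?S = "slab \<xi>"
  have \<xi>\<xi>: "\<xi> \<bullet> \<xi> = 1" using \<xi> by (simp add: norm_eq_1)
  have [measurable]: "?S \<in> sets borel" by measurable
  have "(\<integral>\<^sup>+x. indicator ?S x * (\<integral>\<^sup>+t. f (x + t *\<^sub>R \<xi>) \<partial>lborel) \<partial>lborel)
      = (\<integral>\<^sup>+x. (\<integral>\<^sup>+t. indicator ?S x * f (x + t *\<^sub>R \<xi>) \<partial>lborel) \<partial>lborel)"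
    by (intro nn_integral_cong) (simp add: nn_integral_cmult)
  also have "\<dots> = (\<integral>\<^sup>+t. (\<integral>\<^sup>+x. indicator ?S x * f (x + t *\<^sub>R \<xi>) \<partial>lborel) \<partial>lborel)"
    by (rule lborel_pair.Fubini'[symmetric]) measurable
  also have "\<dots> = (\<integral>\<^sup>+t. (\<integral>\<^sup>+x. indicator ?S (x - t *\<^sub>R \<xi>) * f x \<partial>lborel) \<partial>lborel)"
  proof (rule nn_integral_cong)
    fix t
    show "(\<integral>\<^sup>+x. indicator ?S x * f (x + t *\<^sub>R \<xi>) \<partial>lborel) = (\<integral>\<^sup>+x. indicator ?S (x - t *\<^sub>R \<xi>) * f x \<partial>lborel)"
      using nn_integral_lborel_shift[of "\<lambda>x. indicator ?S (x - t *\<^sub>R \<xi>) * f x" "t *\<^sub>R \<xi>"] by simp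
  qed
  also have "\<dots> = (\<integral>\<^sup>+x. (\<integral>\<^sup>+t. indicator ?S (x - t *\<^sub>R \<xi>) * f x \<partial>lborel) \<partial>lborel)"
    by (rule lborel_pair.Fubini') measurable
  also have "\<dots> = (\<integral>\<^sup>+x. f x \<partial>lborel)"
  proof (rule nn_integral_cong)
    fix x
    have "(\<integral>\<^sup>+t. indicator ?S (x - t *\<^sub>R \<xi>) * f x \<partial>lborel)
        = (\<integral>\<^sup>+t. indicator {x \<bullet> \<xi> - 1 .. x \<bullet> \<xi>} t * f x \<partial>lborel)"
      by (intro nn_integral_cong) (auto simp: indicator_def inner_diff_left \<xi>\<xi>)
    then show "(\<integral>\<^sup>+t. indicator ?S (x - t *\<^sub>R \<xi>) * f x \<partial>lborel) = f x"
      by (simp add: nn_integral_multc)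
  qed
  finally show ?thesis .
qed

definition crossing_time :: "'a::euclidean_space \<Rightarrow> 'a \<Rightarrow> real \<Rightarrow> 'a \<Rightarrow> real" where
  "crossing_time \<xi> n b x = (b - n \<bullet> x) / (n \<bullet> \<xi>)"

lemma crossing_point:
  assumes "n \<bullet> \<xi> \<noteq> 0" "n \<bullet> x = b"
  shows "x + t *\<^sub>R \<xi> + crossing_time \<xi> n b (x + t *\<^sub>R \<xi>) *\<^sub>R \<xi> = x"
  using assms by (simp add: crossing_time_def inner_add_right)

text \<open>A quantity that is read off at the point where the line crosses a hyperplane integrates, over the
  space of lines, to \<open>\<bar>n \<bullet> \<xi>\<bar> \<le> 1\<close> times its integral over the hyperplane.\<close>

lemma nn_integral_slab_crossing:
  fixes \<xi> n :: "'a::euclidean_space" and g :: "'a \<Rightarrow> ennreal"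
  assumes \<xi>: "norm \<xi> = 1" and n: "norm n = 1" and n\<xi>: "n \<bullet> \<xi> \<noteq> 0"
    and [measurable]: "g \<in> borel_measurable borel"
  shows "(\<integral>\<^sup>+x. indicator (slab \<xi>) x * g (x + crossing_time \<xi> n b x *\<^sub>R \<xi>) \<partial>lborel)
     \<le> (\<integral>\<^sup>+x. g x \<partial>affine_lborel (plane n b))"
proof -
  let ?S = "slab \<xi>"
  have \<xi>\<xi>: "\<xi> \<bullet> \<xi> = 1" using \<xi> by (simp add: norm_eq_1)
  have [measurable]: "?S \<in> sets borel" by measurable
  have "(\<integral>\<^sup>+x. indicator ?S x * g (x + crossing_time \<xi> n b x *\<^sub>R \<xi>) \<partial>lborel)
     = ennreal \<bar>\<xi> \<bullet> n\<bar> * (\<integral>\<^sup>+x. (\<integral>\<^sup>+t. indicator ?S (x + t *\<^sub>R \<xi>) *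
        g (x + t *\<^sub>R \<xi> + crossing_time \<xi> n b (x + t *\<^sub>R \<xi>) *\<^sub>R \<xi>) \<partial>lborel) \<partial>affine_lborel (plane n b))"
    by (rule nn_integral_along_hyperplane) (use n\<xi> n in \<open>auto simp: inner_commute crossing_time_def\<close>)
  also have "(\<integral>\<^sup>+x. (\<integral>\<^sup>+t. indicator ?S (x + t *\<^sub>R \<xi>) *
        g (x + t *\<^sub>R \<xi> + crossing_time \<xi> n b (x + t *\<^sub>R \<xi>) *\<^sub>R \<xi>) \<partial>lborel) \<partial>affine_lborel (plane n b))
     = (\<integral>\<^sup>+x. g x \<partial>affine_lborel (plane n b))"
  proof (rule nn_integral_cong_AE, rule AE_mp[OF AE_affine_lborel_hyperplane[OF n]], rule AE_I2, rule impI)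
    fix x assume x: "n \<bullet> x = b"
    have "(\<integral>\<^sup>+t. indicator ?S (x + t *\<^sub>R \<xi>) *
        g (x + t *\<^sub>R \<xi> + crossing_time \<xi> n b (x + t *\<^sub>R \<xi>) *\<^sub>R \<xi>) \<partial>lborel)
        = (\<integral>\<^sup>+t. indicator {- (x \<bullet> \<xi>) .. 1 - x \<bullet> \<xi>} t * g x \<partial>lborel)"
      unfolding crossing_point[OF n\<xi> x]
      by (intro nn_integral_cong) (auto simp: indicator_def inner_add_left \<xi>\<xi>)
    then show "(\<integral>\<^sup>+t. indicator ?S (x + t *\<^sub>R \<xi>) *
        g (x + t *\<^sub>R \<xi> + crossing_time \<xi> n b (x + t *\<^sub>R \<xi>) *\<^sub>R \<xi>) \<partial>lborel) = g x"
      by (simp add: nn_integral_multc)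
  qed
  also have "ennreal \<bar>\<xi> \<bullet> n\<bar> * \<dots> \<le> 1 * (\<integral>\<^sup>+x. g x \<partial>affine_lborel (plane n b))"
    using Cauchy_Schwarz_ineq2[of \<xi> n] \<xi> n by (intro mult_right_mono) auto
  finally show ?thesis by simp
qed

text \<open>Thickening a bounded part of the hyperplane in the normal direction gives a bounded set whose
  volume is a positive multiple of the measure in question.\<close>

lemma emeasure_affine_lborel_bounded:
  fixes n :: "'a::euclidean_space"
  assumes n: "norm n = 1" and X: "bounded X" and [measurable]: "X \<in> sets borel"
  shows "emeasure (affine_lborel (plane n b)) X < \<infinity>"
proof -
  have nn: "n \<bullet> n = 1" using n by (simp add: norm_eq_1)
  then have n0: "n \<bullet> n \<noteq> 0" by simp
  let ?h = "\<lambda>x. indicator {x. \<bar>n \<bullet> x - b\<bar> \<le> 1} x * indicator X (x + crossing_time n n b x *\<^sub>R n) :: ennreal"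
  obtain R where R: "\<And>x. x \<in> X \<Longrightarrow> norm x \<le> R" using X by (auto simp: bounded_iff)
  have "{x. \<bar>n \<bullet> x - b\<bar> \<le> 1} \<in> sets borel" by measurable
  then have [measurable]: "?h \<in> borel_measurable borel" unfolding crossing_time_def by measurable
  have "(\<integral>\<^sup>+x. ?h x \<partial>lborel) = ennreal \<bar>n \<bullet> n\<bar> *
     (\<integral>\<^sup>+x. (\<integral>\<^sup>+t. ?h (x + t *\<^sub>R n) \<partial>lborel) \<partial>affine_lborel (plane n b))"
    by (rule nn_integral_along_hyperplane) (use n nn in auto)
  also have "(\<integral>\<^sup>+x. (\<integral>\<^sup>+t. ?h (x + t *\<^sub>R n) \<partial>lborel) \<partial>affine_lborel (plane n b))
    = (\<integral>\<^sup>+x. 2 * indicator X x \<partial>affine_lborel (plane n b))"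
  proof (rule nn_integral_cong_AE, rule AE_mp[OF AE_affine_lborel_hyperplane[OF n]], rule AE_I2, rule impI)
    fix x assume x: "n \<bullet> x = b"
    have "(\<integral>\<^sup>+t. ?h (x + t *\<^sub>R n) \<partial>lborel) = (\<integral>\<^sup>+t. indicator {-1..1::real} t * indicator X x \<partial>lborel)"
      unfolding crossing_point[OF n0 x]
      by (intro nn_integral_cong) (auto simp: indicator_def inner_add_right nn x)
    then show "(\<integral>\<^sup>+t. ?h (x + t *\<^sub>R n) \<partial>lborel) = 2 * indicator X x"
      by (simp add: nn_integral_multc)
  qed
  also have "\<dots> = 2 * emeasure (affine_lborel (plane n b)) X"
    by (simp add: nn_integral_cmult)
  finally have 1: "2 * emeasure (affine_lborel (plane n b)) X = (\<integral>\<^sup>+x. ?h x \<partial>lborel)"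
    by (simp add: nn)
  have "?h x \<le> indicator (cball 0 (R + 1)) x" for x
  proof (cases "\<bar>n \<bullet> x - b\<bar> \<le> 1 \<and> x + crossing_time n n b x *\<^sub>R n \<in> X")
    case True
    have "norm x \<le> norm (x + crossing_time n n b x *\<^sub>R n) + norm (crossing_time n n b x *\<^sub>R n)"
      by (metis add_diff_cancel_right' norm_triangle_ineq4)
    also have "\<dots> \<le> R + 1"
      using True R n by (intro add_mono) (auto simp: crossing_time_def nn abs_minus_commute)
    finally show ?thesis by (simp add: indicator_def)
  qed (auto simp: indicator_def)
  then have "(\<integral>\<^sup>+x. ?h x \<partial>lborel) \<le> (\<integral>\<^sup>+x. indicator (cball (0::'a) (R + 1)) x \<partial>lborel)"
    by (intro nn_integral_mono) auto
  also have "\<dots> < \<infinity>"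
    using emeasure_lborel_cball_finite[of "0::'a" "R+1"] by simp
  finally have "2 * emeasure (affine_lborel (plane n b)) X < \<infinity>" using 1 by simp
  then show ?thesis by (auto simp: ennreal_mult_less_top)
qed

section \<open>One-dimensional estimates along lines\<close>

text \<open>All that the argument needs to know of a field \<open>p\<close> with \<open>N = \<bar>\<nabla>\<^sub>s p\<bar>\<close>: along each line of direction \<open>\<eta>\<close>, the
  component in the direction \<open>\<eta>\<close> is continuously differentiable with a derivative bounded by
  \<open>\<bar>\<eta>\<bar>\<^sup>2 N\<close>.\<close>

definition strain_bounded :: "('a::euclidean_space \<Rightarrow> 'a) \<Rightarrow> ('a \<Rightarrow> real) \<Rightarrow> bool" where
  "strain_bounded p N \<longleftrightarrow> continuous_on UNIV p \<and> continuous_on UNIV N \<and> (\<forall>x. 0 \<le> N x) \<and>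
     (\<forall>x \<eta>. \<exists>w'. continuous_on UNIV w' \<and>
        (\<forall>t. ((\<lambda>t. p (x + t *\<^sub>R \<eta>) \<bullet> \<eta>) has_real_derivative w' t) (at t) \<and>
             \<bar>w' t\<bar> \<le> (norm \<eta>)\<^sup>2 * N (x + t *\<^sub>R \<eta>)))"

lemma strain_boundedE:
  assumes "strain_bounded p N"
  obtains w' where "continuous_on UNIV w'"
    "\<And>t. ((\<lambda>t. p (x + t *\<^sub>R \<eta>) \<bullet> \<eta>) has_real_derivative w' t) (at t)"
    "\<And>t. \<bar>w' t\<bar> \<le> (norm \<eta>)\<^sup>2 * N (x + t *\<^sub>R \<eta>)"
  using assms unfolding strain_bounded_def by metis

lemma strain_bounded_continuous:
  assumes "strain_bounded p N"
  shows "continuous_on X p" "continuous_on X N" "0 \<le> N x"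
    "p \<in> borel_measurable borel" "N \<in> borel_measurable borel"
  using assms unfolding strain_bounded_def
  by (auto intro: continuous_on_subset borel_measurable_continuous_onI)

lemma nn_integral_Icc_continuous:
  fixes h :: "real \<Rightarrow> real"
  assumes "continuous_on {a..b} h" "\<And>t. t \<in> {a..b} \<Longrightarrow> 0 \<le> h t"
  shows "(\<integral>\<^sup>+t. indicator {a..b} t * ennreal (h t) \<partial>lborel) = ennreal (integral {a..b} h)"
proof -
  have int: "set_integrable lborel {a..b} h"
    by (rule borel_integrable_atLeastAtMost'[OF assms(1)])
  have "(\<integral>\<^sup>+t. indicator {a..b} t * ennreal (h t) \<partial>lborel) = (\<integral>\<^sup>+t. ennreal (indicator {a..b} t *\<^sub>R h t) \<partial>lborel)"
    by (intro nn_integral_cong) (auto simp: indicator_def)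
  also have "\<dots> = ennreal (LINT t:{a..b}|lborel. h t)"
    unfolding set_lebesgue_integral_def
    by (rule nn_integral_eq_integral)
       (use int assms(2) in \<open>auto simp: set_integrable_def indicator_def\<close>)
  also have "\<dots> = ennreal (integral {a..b} h)"
    using set_borel_integral_eq_integral(2)[OF int] by simp
  finally show ?thesis .
qed

text \<open>With \<open>w(t) = p(x + t \<eta>) \<bullet> \<eta>\<close>, integrate the derivative of \<open>-(1 - t / \<tau>) w\<^sup>2\<close>, a function which is \<open>-w(0)\<^sup>2\<close> at
  the start of the segment and vanishes at its end.\<close>

lemma pointwise_le_segment_integral:
  assumes p: "strain_bounded p N" and \<tau>: "0 < \<tau>"
  shows "ennreal ((p x \<bullet> \<eta>)\<^sup>2) \<le> (\<integral>\<^sup>+t. indicator {0..\<tau>} t *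
     ennreal (2 / \<tau> * (p (x + t *\<^sub>R \<eta>) \<bullet> \<eta>)\<^sup>2 + \<tau> * (norm \<eta>)^4 * (N (x + t *\<^sub>R \<eta>))\<^sup>2) \<partial>lborel)"
proof -
  obtain w' where w': "continuous_on UNIV w'"
    "\<And>t. ((\<lambda>t. p (x + t *\<^sub>R \<eta>) \<bullet> \<eta>) has_real_derivative w' t) (at t)"
    "\<And>t. \<bar>w' t\<bar> \<le> (norm \<eta>)\<^sup>2 * N (x + t *\<^sub>R \<eta>)"
    using strain_boundedE[OF p] by metis
  define w where "w t = p (x + t *\<^sub>R \<eta>) \<bullet> \<eta>" for t
  define h where "h t = 2 / \<tau> * (w t)\<^sup>2 + \<tau> * (norm \<eta>)^4 * (N (x + t *\<^sub>R \<eta>))\<^sup>2" for t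
  have cont: "continuous_on {0..\<tau>} h" unfolding h_def w_def
    by (intro continuous_intros continuous_on_compose2[OF strain_bounded_continuous(1)[OF p, of UNIV]]
        continuous_on_compose2[OF strain_bounded_continuous(2)[OF p, of UNIV]]) auto
  have dw: "(w has_real_derivative w' t) (at t)" for t
    using w'(2) unfolding w_def .
  define G' where "G' t = (w t)\<^sup>2 / \<tau> - (1 - t / \<tau>) * (2 * w t * w' t)" for t
  have "((\<lambda>t. - (1 - t / \<tau>) * (w t)\<^sup>2) has_real_derivative G' t) (at t)" for t
    unfolding G'_def using \<tau> by (auto intro!: derivative_eq_intros dw simp: field_simps)
  then have "(G' has_integral (- (1 - \<tau> / \<tau>) * (w \<tau>)\<^sup>2) - (- (1 - 0 / \<tau>) * (w 0)\<^sup>2)) {0..\<tau>}"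
    using \<tau> by (intro fundamental_theorem_of_calculus)
      (auto simp: has_real_derivative_iff_has_vector_derivative[symmetric] intro: has_field_derivative_at_within)
  then have G: "(G' has_integral (w 0)\<^sup>2) {0..\<tau>}" using \<tau> by simp
  have "(w 0)\<^sup>2 \<le> integral {0..\<tau>} h"
  proof (rule has_integral_le[OF G integrable_integral])
    show "h integrable_on {0..\<tau>}" using cont by (rule integrable_continuous_real)
    fix t assume t: "t \<in> {0..\<tau>}"
    define s where "s = 1 - t / \<tau>"
    have s: "0 \<le> s" "s \<le> 1" using t \<tau> by (auto simp: s_def)
    have "- (s * (2 * w t * w' t)) \<le> (w t)\<^sup>2 / \<tau> + \<tau> * (w' t)\<^sup>2"
    proof -
      have "0 \<le> (w t + s * \<tau> * w' t)\<^sup>2 / \<tau>" using \<tau> by simp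
      also have "\<dots> = (w t)\<^sup>2 / \<tau> + s\<^sup>2 * (\<tau> * (w' t)\<^sup>2) + s * (2 * w t * w' t)"
        using \<tau> by (simp add: field_simps power2_eq_square)
      also have "s\<^sup>2 * (\<tau> * (w' t)\<^sup>2) \<le> 1 * (\<tau> * (w' t)\<^sup>2)"
        using s \<tau> by (intro mult_right_mono) (auto simp: power_le_one)
      finally show ?thesis by simp
    qed
    moreover have "(w' t)\<^sup>2 \<le> ((norm \<eta>)\<^sup>2 * N (x + t *\<^sub>R \<eta>))\<^sup>2"
      using w'(3)[of t] by (metis abs_ge_zero power2_abs power_mono)
    then have "\<tau> * (w' t)\<^sup>2 \<le> \<tau> * ((norm \<eta>)\<^sup>2 * N (x + t *\<^sub>R \<eta>))\<^sup>2"
      using \<tau> by simp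
    moreover have "((norm \<eta>)\<^sup>2 * N (x + t *\<^sub>R \<eta>))\<^sup>2 = (norm \<eta>)^4 * (N (x + t *\<^sub>R \<eta>))\<^sup>2"
      by (simp add: power_mult_distrib)
    ultimately show "G' t \<le> h t"
      unfolding G'_def h_def s_def by simp
  qed
  then have "ennreal ((p x \<bullet> \<eta>)\<^sup>2) \<le> ennreal (integral {0..\<tau>} h)"
    by (simp add: w_def ennreal_leI)
  also have "\<dots> = (\<integral>\<^sup>+t. indicator {0..\<tau>} t * ennreal (h t) \<partial>lborel)"
    using \<tau> by (intro nn_integral_Icc_continuous[symmetric] cont) (auto simp: h_def)
  finally show ?thesis by (simp add: h_def w_def)
qed

text \<open>With \<open>w(t) = p(x + t \<xi>) \<bullet> \<xi>\<close>, integrate the derivative \<open>w\<^sup>2 + 2 (t - t0) w w'\<close> of \<open>(t - t0) w\<^sup>2\<close> and absorb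
  half of \<open>w\<^sup>2\<close>. The boundary terms keep their signs, for they have to cancel between neighbouring
  intervals.\<close>

lemma interval_energy_estimate:
  assumes p: "strain_bounded p N" and "norm \<xi> = 1" "\<alpha> \<le> \<beta>"
    and m: "\<And>t. t \<in> {\<alpha>..\<beta>} \<Longrightarrow> \<bar>t - t0\<bar> \<le> 1"
  shows "integral {\<alpha>..\<beta>} (\<lambda>t. (p (x + t *\<^sub>R \<xi>) \<bullet> \<xi>)\<^sup>2) \<le>
     2 * ((\<beta> - t0) * (p (x + \<beta> *\<^sub>R \<xi>) \<bullet> \<xi>)\<^sup>2 - (\<alpha> - t0) * (p (x + \<alpha> *\<^sub>R \<xi>) \<bullet> \<xi>)\<^sup>2)
     + 4 * integral {\<alpha>..\<beta>} (\<lambda>t. (N (x + t *\<^sub>R \<xi>))\<^sup>2)"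
proof -
  obtain w' where w': "continuous_on UNIV w'"
    "\<And>t. ((\<lambda>t. p (x + t *\<^sub>R \<xi>) \<bullet> \<xi>) has_real_derivative w' t) (at t)"
    "\<And>t. \<bar>w' t\<bar> \<le> (norm \<xi>)\<^sup>2 * N (x + t *\<^sub>R \<xi>)"
    using strain_boundedE[OF p] by metis
  define w where "w t = p (x + t *\<^sub>R \<xi>) \<bullet> \<xi>" for t
  define M where "M t = N (x + t *\<^sub>R \<xi>)" for t
  have contw: "continuous_on {\<alpha>..\<beta>} w" unfolding w_def
    by (intro continuous_intros continuous_on_compose2[OF strain_bounded_continuous(1)[OF p, of UNIV]]) auto
  have contM: "continuous_on {\<alpha>..\<beta>} M" unfolding M_def
    by (intro continuous_intros continuous_on_compose2[OF strain_bounded_continuous(2)[OF p, of UNIV]]) auto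
  have dw: "(w has_real_derivative w' t) (at t)" for t
    using w'(2) unfolding w_def .
  have "((\<lambda>t. (t - t0) * (w t)\<^sup>2) has_real_derivative (w t)\<^sup>2 + (t - t0) * (2 * w t * w' t)) (at t)" for t
    by (auto intro!: derivative_eq_intros dw)
  then have G: "((\<lambda>t. (w t)\<^sup>2 + (t - t0) * (2 * w t * w' t)) has_integral
      (\<beta> - t0) * (w \<beta>)\<^sup>2 - (\<alpha> - t0) * (w \<alpha>)\<^sup>2) {\<alpha>..\<beta>}"
    using assms by (intro fundamental_theorem_of_calculus)
      (auto simp: has_real_derivative_iff_has_vector_derivative[symmetric] intro: has_field_derivative_at_within)
  have iw: "(\<lambda>t. (w t)\<^sup>2) integrable_on {\<alpha>..\<beta>}" and iM: "(\<lambda>t. (M t)\<^sup>2) integrable_on {\<alpha>..\<beta>}"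
    by (intro integrable_continuous_real continuous_intros contw contM)+
  have "integral {\<alpha>..\<beta>} (\<lambda>t. (w t)\<^sup>2) * (1/2) - integral {\<alpha>..\<beta>} (\<lambda>t. (M t)\<^sup>2) * 2
      \<le> (\<beta> - t0) * (w \<beta>)\<^sup>2 - (\<alpha> - t0) * (w \<alpha>)\<^sup>2"
  proof (rule has_integral_le[OF _ G])
    show "((\<lambda>t. (w t)\<^sup>2 * (1/2) - (M t)\<^sup>2 * 2) has_integral
        integral {\<alpha>..\<beta>} (\<lambda>t. (w t)\<^sup>2) * (1/2) - integral {\<alpha>..\<beta>} (\<lambda>t. (M t)\<^sup>2) * 2) {\<alpha>..\<beta>}"
      by (intro has_integral_diff has_integral_mult_left integrable_integral iw iM)
    fix t assume t: "t \<in> {\<alpha>..\<beta>}"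
    have "\<bar>w' t\<bar> \<le> M t" using w'(3)[of t] assms(2) by (simp add: M_def)
    then have "(w' t)\<^sup>2 \<le> (M t)\<^sup>2" by (metis abs_ge_zero power2_abs power_mono)
    moreover have "- ((t - t0) * (2 * w t * w' t)) \<le> (w t)\<^sup>2 * (1/2) + (w' t)\<^sup>2 * 2"
    proof -
      have "0 \<le> (w t + 2 * (t - t0) * w' t)\<^sup>2 / 2" by simp
      also have "\<dots> = (w t)\<^sup>2 * (1/2) + (t - t0)\<^sup>2 * ((w' t)\<^sup>2 * 2) + (t - t0) * (2 * w t * w' t)"
        by (simp add: field_simps power2_eq_square)
      also have "(t - t0)\<^sup>2 * ((w' t)\<^sup>2 * 2) \<le> 1 * ((w' t)\<^sup>2 * 2)"
        using m[OF t] by (intro mult_right_mono) (auto simp: abs_square_le_1)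
      finally show ?thesis by simp
    qed
    ultimately show "(w t)\<^sup>2 * (1/2) - (M t)\<^sup>2 * 2 \<le> (w t)\<^sup>2 + (t - t0) * (2 * w t * w' t)"
      by simp
  qed
  then show ?thesis unfolding w_def[symmetric] M_def[symmetric] by simp
qed

section \<open>A trace inequality on simplices for the symmetric gradient\<close>

lemma hyperplane_unit_normal:
  fixes X :: "'a::euclidean_space set"
  assumes "aff_dim X = int DIM('a) - 1"
  obtains n b where "norm n = 1" "affine hull X = plane n b"
proof -
  obtain a b where ab: "a \<noteq> 0" "affine hull X = {x. a \<bullet> x = b}"
  proof -
    have "\<exists>a b. a \<noteq> 0 \<and> affine hull X = {x. a \<bullet> x = b}"
      using assms by (subst aff_dim_eq_hyperplane[symmetric]) simp
    then show thesis using that by blast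
  qed
  have "norm (a /\<^sub>R norm a) = 1" using ab(1) by simp
  moreover have "affine hull X = {x. (a /\<^sub>R norm a) \<bullet> x = b / norm a}"
    using ab by (auto simp: field_simps)
  ultimately show thesis using that by blast
qed

lemma inradius_ball:
  assumes "0 < r" "r < inradius S" "S \<noteq> {}"
  obtains x where "cball x r \<subseteq> S"
proof -
  obtain y where "y \<in> S" using assms by blast
  then have "{r. 0 \<le> r \<and> (\<exists>x. cball x r \<subseteq> S)} \<noteq> {}"
    by (auto intro!: exI[of _ 0] exI[of _ y])
  from less_cSupD[OF this assms(2)[unfolded inradius_def]]
  obtain r' x where "r < r'" "cball x r' \<subseteq> S" by auto
  moreover have "cball x r \<subseteq> cball x r'" using \<open>r < r'\<close> by (intro subset_cball) simp
  ultimately show thesis using that[of x] by blast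
qed

text \<open>The width of the hull in the direction \<open>u\<close> is at least the diameter \<open>2 r\<close> of the ball. Hence the
  vertices cannot all be closer than \<open>r\<close> to the hyperplane through \<open>q\<close> orthogonal to \<open>u\<close>.\<close>

lemma vertex_far_in_direction:
  fixes C :: "'a::euclidean_space set"
  assumes "cball x0 r \<subseteq> convex hull C" "0 < r"
  obtains p where "p \<in> C" "r * norm u \<le> \<bar>(p - q) \<bullet> u\<bar>"
proof (cases "u = 0")
  case True
  have "C \<noteq> {}" using assms by auto
  then show thesis using that True by auto
next
  case False
  have "\<exists>p\<in>C. r * norm u \<le> \<bar>(p - q) \<bullet> u\<bar>"
  proof (rule ccontr)
    assume "\<not> ?thesis"
    then have far: "\<bar>(y - q) \<bullet> u\<bar> < r * norm u" if "y \<in> C" for y using that by force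
    have "u \<bullet> y < u \<bullet> q + r * norm u \<and> u \<bullet> y > u \<bullet> q - r * norm u" if "y \<in> C" for y
    proof -
      have "(y - q) \<bullet> u = u \<bullet> y - u \<bullet> q" by (simp add: inner_commute[of _ u] inner_diff_right)
      then show ?thesis using far[OF that] by linarith
    qed
    then have "C \<subseteq> {y. u \<bullet> y < u \<bullet> q + r * norm u} \<inter> {y. u \<bullet> y > u \<bullet> q - r * norm u}" by blast
    moreover have "convex ({y. u \<bullet> y < u \<bullet> q + r * norm u} \<inter> {y. u \<bullet> y > u \<bullet> q - r * norm u})"
      by (intro convex_Int convex_halfspace_lt convex_halfspace_gt)
    ultimately have hull: "convex hull C \<subseteq> {y. u \<bullet> y < u \<bullet> q + r * norm u} \<inter> {y. u \<bullet> y > u \<bullet> q - r * norm u}"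
      by (rule hull_minimal)
    have "x0 + (r / norm u) *\<^sub>R u \<in> cball x0 r" "x0 - (r / norm u) *\<^sub>R u \<in> cball x0 r"
      using False assms(2) by (auto simp: dist_norm)
    then have "x0 + (r / norm u) *\<^sub>R u \<in> convex hull C" "x0 - (r / norm u) *\<^sub>R u \<in> convex hull C"
      using assms(1) by auto
    then have "u \<bullet> (x0 + (r / norm u) *\<^sub>R u) < u \<bullet> q + r * norm u"
      "u \<bullet> (x0 - (r / norm u) *\<^sub>R u) > u \<bullet> q - r * norm u" using hull by auto
    moreover have "u \<bullet> ((r / norm u) *\<^sub>R u) = r * norm u"
      using False by (simp add: power2_norm_eq_inner[symmetric] power2_eq_square)
    ultimately show False by (simp add: inner_add_right inner_diff_right)
  qed
  then show thesis using that by blast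
qed

text \<open>A point of the facet opposite to \<open>q\<close> whose barycentric coordinate at \<open>j\<close> is at least \<open>2 \<tau>\<close> can pass
  \<open>\<tau>\<close> of it to \<open>q\<close> and \<open>\<tau>\<close> to \<open>i\<close>. The case \<open>i = j\<close> moves towards \<open>q\<close> only.\<close>

lemma prism_in_simplex:
  fixes C :: "'a::real_vector set"
  assumes C: "finite C" "q \<in> C" "j \<in> C - {q}" "i \<in> C - {q}"
    and u: "\<forall>x\<in>C - {q}. 0 \<le> u x" "sum u (C - {q}) = 1"
    and \<tau>: "2 * \<tau> \<le> u j" "0 \<le> \<tau>"
  shows "(\<Sum>x\<in>C - {q}. u x *\<^sub>R x) + \<tau> *\<^sub>R (q + i - 2 *\<^sub>R j) \<in> convex hull C"
proof -
  define v where "v x = (if x = q then \<tau> else u x + (if x = i then \<tau> else 0) - (if x = j then 2 * \<tau> else 0))" for x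
  have fin: "finite (C - {q})" using C by simp
  have sumv: "sum v C = 1"
  proof -
    have "sum v C = v q + sum v (C - {q})" using C by (simp add: sum.remove)
    also have "sum v (C - {q}) = (\<Sum>x\<in>C - {q}. u x + (if x = i then \<tau> else 0) - (if x = j then 2 * \<tau> else 0))"
      by (intro sum.cong) (auto simp: v_def)
    also have "\<dots> = 1 + \<tau> - 2 * \<tau>"
      using C u fin by (simp add: sum.distrib sum_subtractf)
    finally show ?thesis by (simp add: v_def)
  qed
  have sumv': "(\<Sum>x\<in>C. v x *\<^sub>R x) = (\<Sum>x\<in>C - {q}. u x *\<^sub>R x) + \<tau> *\<^sub>R (q + i - 2 *\<^sub>R j)"
  proof -
    have "(\<Sum>x\<in>C. v x *\<^sub>R x) = \<tau> *\<^sub>R q + (\<Sum>x\<in>C - {q}. v x *\<^sub>R x)" using C by (simp add: sum.remove v_def)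
    also have "(\<Sum>x\<in>C - {q}. v x *\<^sub>R x) = (\<Sum>x\<in>C - {q}. u x *\<^sub>R x + (if x = i then \<tau> *\<^sub>R i else 0) - (if x = j then (2 * \<tau>) *\<^sub>R j else 0))"
      by (intro sum.cong) (auto simp: v_def algebra_simps)
    also have "\<dots> = (\<Sum>x\<in>C - {q}. u x *\<^sub>R x) + \<tau> *\<^sub>R i - (2 * \<tau>) *\<^sub>R j"
      using C fin by (simp add: sum.distrib sum_subtractf)
    finally show ?thesis by (simp add: algebra_simps)
  qed
  have "\<forall>x\<in>C. 0 \<le> v x"
    using u \<tau> by (auto simp: v_def)
  then show ?thesis
    unfolding convex_hull_finite[OF C(1)] using sumv sumv' by blast
qed

text \<open>The segments of \<open>pointwise_le_segment_integral\<close> that start in \<open>X\<close> sweep out a prism inside \<open>S\<close>; the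
  volume element of the prism is \<open>\<bar>\<eta> \<bullet> n\<bar>\<close> times that of \<open>X\<close> and of the parameter.\<close>

lemma prism_trace:
  fixes n \<eta> :: "'a::euclidean_space"
  assumes p: "strain_bounded p N" and \<tau>: "0 < \<tau>" and n: "norm n = 1" 
    and E: "X \<in> sets borel" and S: "S \<in> sets borel"
    and sub: "\<And>x t. x \<in> X \<Longrightarrow> 0 \<le> t \<Longrightarrow> t \<le> \<tau> \<Longrightarrow> x + t *\<^sub>R \<eta> \<in> S"
    and r: "0 < r" "r \<le> \<bar>\<eta> \<bullet> n\<bar>" and h: "norm \<eta> \<le> 2 * h"
  shows "ennreal r * (\<integral>\<^sup>+x. indicator X x * ennreal ((p x \<bullet> \<eta>)\<^sup>2) \<partial>affine_lborel (plane n b))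
     \<le> ennreal (h\<^sup>2 * (8 / \<tau> + 16 * \<tau>)) * (nn_integral_on S (\<lambda>x. (norm (p x))\<^sup>2 + h\<^sup>2 * (N x)\<^sup>2))"
proof -
  note [measurable] = strain_bounded_continuous(4,5)[OF p] E S
  let ?\<mu> = "affine_lborel (plane n b)"
  let ?\<phi> = "\<lambda>x. 2 / \<tau> * (p x \<bullet> \<eta>)\<^sup>2 + \<tau> * (norm \<eta>)^4 * (N x)\<^sup>2"
  let ?f = "\<lambda>x. indicator S x * ennreal (?\<phi> x)"
  have h0: "0 \<le> h" using h norm_ge_zero[of \<eta>] by linarith
  have "ennreal r * (\<integral>\<^sup>+x. indicator X x * ennreal ((p x \<bullet> \<eta>)\<^sup>2) \<partial>?\<mu>)
    \<le> ennreal \<bar>\<eta> \<bullet> n\<bar> * (\<integral>\<^sup>+x. (\<integral>\<^sup>+t. ?f (x + t *\<^sub>R \<eta>) \<partial>lborel) \<partial>?\<mu>)"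
  proof (intro mult_mono nn_integral_mono)
    show "ennreal r \<le> ennreal \<bar>\<eta> \<bullet> n\<bar>" using r by (intro ennreal_leI) auto
    fix x
    show "indicator X x * ennreal ((p x \<bullet> \<eta>)\<^sup>2) \<le> (\<integral>\<^sup>+t. ?f (x + t *\<^sub>R \<eta>) \<partial>lborel)"
    proof (cases "x \<in> X")
      case True
      have "ennreal ((p x \<bullet> \<eta>)\<^sup>2) \<le> (\<integral>\<^sup>+t. indicator {0..\<tau>} t * ennreal (?\<phi> (x + t *\<^sub>R \<eta>)) \<partial>lborel)"
        by (rule pointwise_le_segment_integral[OF p \<tau>])
      also have "\<dots> \<le> (\<integral>\<^sup>+t. ?f (x + t *\<^sub>R \<eta>) \<partial>lborel)"
        using sub[OF True] by (intro nn_integral_mono) (auto simp: indicator_def)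
      finally show ?thesis using True by simp
    qed simp
  qed auto
  also have "\<dots> = (\<integral>\<^sup>+x. ?f x \<partial>lborel)"
    by (rule nn_integral_along_hyperplane[OF n, symmetric]) (use r in auto)
  also have "\<dots> \<le> (\<integral>\<^sup>+x. ennreal (h\<^sup>2 * (8 / \<tau> + 16 * \<tau>)) *
      (indicator S x * ennreal ((norm (p x))\<^sup>2 + h\<^sup>2 * (N x)\<^sup>2)) \<partial>lborel)"
  proof (rule nn_integral_mono)
    fix x
    have \<eta>2: "(norm \<eta>)\<^sup>2 \<le> 4 * h\<^sup>2"
      using power_mono[OF h, of 2] by (simp add: power_mult_distrib)
    have "(p x \<bullet> \<eta>)\<^sup>2 \<le> (norm (p x))\<^sup>2 * (norm \<eta>)\<^sup>2"
      using Cauchy_Schwarz_ineq[of "p x" \<eta>] by (simp add: power2_norm_eq_inner)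
    also have "\<dots> \<le> (norm (p x))\<^sup>2 * (4 * h\<^sup>2)" by (intro mult_left_mono \<eta>2) auto
    finally have 1: "2 / \<tau> * (p x \<bullet> \<eta>)\<^sup>2 \<le> 2 / \<tau> * ((norm (p x))\<^sup>2 * (4 * h\<^sup>2))"
      using \<tau> by (intro mult_left_mono) auto
    have "(norm \<eta>)^4 \<le> (4 * h\<^sup>2)\<^sup>2" using power_mono[OF \<eta>2, of 2] by simp
    then have 2: "\<tau> * (norm \<eta>)^4 * (N x)\<^sup>2 \<le> \<tau> * (4 * h\<^sup>2)\<^sup>2 * (N x)\<^sup>2"
      using \<tau> by (intro mult_right_mono mult_left_mono) auto
    have 3: "0 \<le> \<tau> * (h\<^sup>2 * (norm (p x))\<^sup>2)" "0 \<le> 1 / \<tau> * (h\<^sup>2 * (h\<^sup>2 * (N x)\<^sup>2))" using \<tau> by auto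
    have "?\<phi> x \<le> h\<^sup>2 * (8 / \<tau> + 16 * \<tau>) * ((norm (p x))\<^sup>2 + h\<^sup>2 * (N x)\<^sup>2)"
      using 1 2 3 by (simp add: algebra_simps power_mult_distrib)
    moreover have "0 \<le> h\<^sup>2 * (8 / \<tau> + 16 * \<tau>)" using \<tau> by simp
    ultimately show "?f x \<le> ennreal (h\<^sup>2 * (8 / \<tau> + 16 * \<tau>)) *
      (indicator S x * ennreal ((norm (p x))\<^sup>2 + h\<^sup>2 * (N x)\<^sup>2))"
      by (auto simp: indicator_def ennreal_mult[symmetric] simp del: ennreal_plus intro!: ennreal_leI)
  qed
  also have "\<dots> = ennreal (h\<^sup>2 * (8 / \<tau> + 16 * \<tau>)) * (nn_integral_on S (\<lambda>x. (norm (p x))\<^sup>2 + h\<^sup>2 * (N x)\<^sup>2))"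
    by (rule nn_integral_cmult) measurable
  finally show ?thesis .
qed

text \<open>The constant collects \<open>d\<^sup>2\<close> prisms of relative length \<open>\<tau> = 1 / (2 d)\<close>, for which
  \<open>8 / \<tau> + 16 \<tau> = 16 d + 8 / d\<close>, and a power \<open>(h / r)\<^sup>3\<close> with a ball of radius \<open>r = \<rho> h / 2\<close> in the simplex.\<close>

definition trace_constant :: "nat \<Rightarrow> real \<Rightarrow> real" where
  "trace_constant d \<rho> = 32 * (real d)\<^sup>2 * (16 * real d + 8 / real d) / \<rho> ^ 3"

lemma simplex_vertices:
  assumes "int DIM('a) simplex (S :: 'a::euclidean_space set)"
  obtains C where "finite C" "\<not> affine_dependent C" "card C = DIM('a) + 1" "S = convex hull C"
proof -
  obtain C where C: "finite C" "\<not> affine_dependent C" "int (card C) = int DIM('a) + 1" "S = convex hull C"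
    using assms unfolding simplex by blast
  from C(3) have "card C = DIM('a) + 1" by linarith
  with C show thesis using that by blast
qed

lemma simplex_diameter_pos:
  fixes S :: "'a::euclidean_space set"
  assumes S: "int DIM('a) simplex S"
  shows "0 < diameter S"
proof -
  have "\<not> (\<exists>a. S \<subseteq> {a})"
  proof
    assume "\<exists>a. S \<subseteq> {a}"
    then have "aff_dim S \<le> 0" by (metis aff_dim_sing aff_dim_subset)
    then show False using aff_dim_simplex[OF S] by (metis DIM_positive of_nat_0_less_iff not_less)
  qed
  then obtain x y where xy: "x \<in> S" "y \<in> S" "x \<noteq> y" by blast
  have "dist x y \<le> diameter S"
    using xy S by (intro diameter_bounded_bound compact_imp_bounded[OF compact_simplex])
  then show ?thesis using xy by (smt (verit) zero_less_dist_iff)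
qed

text \<open>Some barycentric coordinate of a point of \<open>E\<close> is at least \<open>1 / d\<close>, hence \<open>E\<close> is covered by the pieces
  \<open>X j\<close> below, which can be translated into \<open>S\<close> along the vectors \<open>\<eta> i j = q + i - 2 j\<close>, where \<open>q\<close> is the
  vertex opposite to \<open>E\<close> and \<open>i\<close> ranges over the vertices of \<open>E\<close>. By shape regularity these vectors are
  uniformly transversal to \<open>E\<close> and uniformly independent, so that the components \<open>p \<bullet> \<eta> i j\<close> recover \<open>p\<close>.\<close>

theorem simplex_trace_inequality:
  fixes S E :: "'a::euclidean_space set"
  assumes S: "int DIM('a) simplex S" and E: "E facet_of S"
    and \<rho>: "0 < \<rho>" "\<rho> * diameter S \<le> inradius S"
    and n: "norm n = 1" and aff: "affine hull E = plane n b"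
    and p: "strain_bounded p N"
  shows "ennreal (diameter S) * (\<integral>\<^sup>+x. indicator E x * ennreal ((norm (p x))\<^sup>2) \<partial>affine_lborel (plane n b))
    \<le> ennreal (trace_constant DIM('a) \<rho>) *
       (nn_integral_on S (\<lambda>x. (norm (p x))\<^sup>2 + (diameter S)\<^sup>2 * (N x)\<^sup>2))"
proof -
  let ?\<mu> = "affine_lborel (plane n b)" and ?d = "DIM('a)"
  define h where "h = diameter S"
  define r where "r = \<rho> * h / 2"
  define \<tau> :: real where "\<tau> = 1 / (2 * ?d)"
  have \<tau>: "0 < \<tau>" by (simp add: \<tau>_def)
  have h: "0 < h" unfolding h_def by (rule simplex_diameter_pos[OF S])
  have "0 < \<rho> * h" "\<rho> * h \<le> inradius S" using \<rho> h by (auto simp: h_def)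
  then have r: "0 < r" "r < inradius S" unfolding r_def by linarith+
  obtain C where C: "finite C" "\<not> affine_dependent C" "card C = ?d + 1" "S = convex hull C"
    by (rule simplex_vertices[OF S])
  have "S \<noteq> {}" using C by auto
  then obtain x0 where x0: "cball x0 r \<subseteq> convex hull C"
    using inradius_ball[OF r] C(4) by blast
  obtain q where q: "q \<in> C" "E = convex hull (C - {q})"
    using E facet_of_convex_hull_affine_independent[OF C(2)] unfolding C(4) by auto
  let ?B = "C - {q}"
  have finB: "finite ?B" and cardB: "card ?B = ?d" using C q by auto
  have diam: "norm (x - y) \<le> h" if "x \<in> C" "y \<in> C" for x y
    using diameter_bounded_bound[of S x y] that C(4) compact_imp_bounded[OF compact_simplex[OF S]]
    by (auto simp: h_def dist_norm hull_inc)
  have Bn: "n \<bullet> x = b" if "x \<in> ?B" for x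
  proof -
    have "x \<in> affine hull E" using that unfolding q(2) by (intro hull_inc) auto
    then show ?thesis unfolding aff by simp
  qed
  define \<eta> where "\<eta> i j = q + i - 2 *\<^sub>R j" for i j :: 'a
  have \<eta>n: "r \<le> \<bar>\<eta> i j \<bullet> n\<bar>" if "i \<in> ?B" "j \<in> ?B" for i j
  proof -
    obtain k where k: "k \<in> C" "r * norm n \<le> \<bar>(k - j) \<bullet> n\<bar>"
      by (rule vertex_far_in_direction[OF x0 r(1)])
    have "k \<notin> ?B"
    proof
      assume "k \<in> ?B"
      then have "(k - j) \<bullet> n = 0"
        using Bn[of k] Bn[OF that(2)] by (simp add: inner_commute[of _ n] inner_diff_right)
      then show False using k(2) r(1) n by simp
    qed
    then have "k = q" using k(1) by blast
    moreover have "\<eta> i j \<bullet> n = (q - j) \<bullet> n"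
      using Bn[OF that(1)] Bn[OF that(2)] by (simp add: \<eta>_def inner_commute[of _ n] inner_diff_right inner_add_right)
    ultimately show ?thesis using k n by simp
  qed
  have \<eta>norm: "norm (\<eta> i j) \<le> 2 * h" if "i \<in> ?B" "j \<in> ?B" for i j
  proof -
    have "\<eta> i j = (q - j) + (i - j)" by (simp add: \<eta>_def scaleR_2)
    then show ?thesis using diam[of q j] diam[of i j] that q norm_triangle_ineq[of "q - j" "i - j"] by auto
  qed
  \<comment> \<open>For a vertex \<open>k\<close> of \<open>E\<close>, \<open>k - j\<close> is the difference of \<open>\<eta> k j\<close> and \<open>\<eta> j j\<close>, and \<open>q - j = \<eta> j j\<close>:
    the products with the \<open>\<eta> i j\<close> control those with all edges at \<open>j\<close>.\<close>
  have recover: "(norm y)\<^sup>2 \<le> 4 / r\<^sup>2 * (\<Sum>i\<in>?B. (y \<bullet> \<eta> i j)\<^sup>2)" if j: "j \<in> ?B" for j y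
  proof -
    have "\<exists>i\<in>?B. r * norm y / 2 \<le> \<bar>y \<bullet> \<eta> i j\<bar>"
    proof -
      obtain k where k: "k \<in> C" "r * norm y \<le> \<bar>(k - j) \<bullet> y\<bar>"
        by (rule vertex_far_in_direction[OF x0 r(1)])
      show ?thesis
      proof (cases "k = q")
        case True
        have "y \<bullet> \<eta> j j = (q - j) \<bullet> y" by (simp add: \<eta>_def inner_diff_right inner_add_right inner_commute[of _ y])
        moreover have "r * norm y / 2 \<le> r * norm y" using r by simp
        ultimately have "r * norm y / 2 \<le> \<bar>y \<bullet> \<eta> j j\<bar>"
          using k(2) unfolding True by linarith
        then show ?thesis using j by blast
      next
        case False
        have diff: "y \<bullet> \<eta> k j - y \<bullet> \<eta> j j = (k - j) \<bullet> y"
          by (simp add: \<eta>_def inner_diff_right inner_add_right inner_commute[of _ y])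
        have "r * norm y / 2 \<le> \<bar>y \<bullet> \<eta> k j\<bar> \<or> r * norm y / 2 \<le> \<bar>y \<bullet> \<eta> j j\<bar>"
        proof -
          have "\<bar>(k - j) \<bullet> y\<bar> \<le> \<bar>y \<bullet> \<eta> k j\<bar> + \<bar>y \<bullet> \<eta> j j\<bar>"
            unfolding diff[symmetric] by (rule abs_triangle_ineq4)
          then show ?thesis using k(2) by linarith
        qed
        then show ?thesis using j k False by blast
      qed
    qed
    then obtain i where i: "i \<in> ?B" "r * norm y / 2 \<le> \<bar>y \<bullet> \<eta> i j\<bar>" by blast
    have "(r * norm y / 2)\<^sup>2 \<le> (y \<bullet> \<eta> i j)\<^sup>2"
      using power_mono[OF i(2), of 2] r by simp
    also have "\<dots> \<le> (\<Sum>i\<in>?B. (y \<bullet> \<eta> i j)\<^sup>2)"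
      using i finB by (intro member_le_sum) auto
    finally show ?thesis using r by (simp add: field_simps power2_eq_square)
  qed
  define X where "X j = E \<inter> (\<Inter>i\<in>?B. {x. x + \<tau> *\<^sub>R \<eta> i j \<in> S})" for j
  have clS: "closed S" and convS: "convex S" using S by (auto intro: closed_simplex convex_simplex)
  have clE: "closed E"
    using E S by (meson facet_of_imp_face_of face_of_imp_closed convS clS)
  have [measurable]: "S \<in> sets borel" "E \<in> sets borel" using clS clE by auto
  have Xb[measurable]: "X j \<in> sets borel" for j
  proof -
    have "closed {x. x + \<tau> *\<^sub>R \<eta> i j \<in> S}" for i
      using continuous_closed_vimage[OF clS, of "\<lambda>x. x + \<tau> *\<^sub>R \<eta> i j"]
      by (simp add: vimage_def continuous_intros)
    then have "closed (X j)" unfolding X_def by (intro closed_Int clE closed_INT) auto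
    then show ?thesis by auto
  qed
  have ES: "E \<subseteq> S" using E facet_of_imp_subset by blast
  have Xsub: "x + t *\<^sub>R \<eta> i j \<in> S" if "x \<in> X j" "i \<in> ?B" "0 \<le> t" "t \<le> \<tau>" for x t i j
  proof -
    have "x \<in> S" "x + \<tau> *\<^sub>R \<eta> i j \<in> S" using that ES by (auto simp: X_def)
    moreover have "x + t *\<^sub>R \<eta> i j = (1 - t / \<tau>) *\<^sub>R x + (t / \<tau>) *\<^sub>R (x + \<tau> *\<^sub>R \<eta> i j)"
      using \<tau> by (simp add: algebra_simps)
    ultimately show ?thesis
      using convexD_alt[OF convS, of x "x + \<tau> *\<^sub>R \<eta> i j" "t / \<tau>"] that \<tau> by (simp add: add.commute)
  qed
  have cover: "\<exists>j\<in>?B. x \<in> X j" if x: "x \<in> E" for x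
  proof -
    obtain u where u: "\<forall>x\<in>?B. 0 \<le> u x" "sum u ?B = 1" "(\<Sum>x\<in>?B. u x *\<^sub>R x) = x"
      using x unfolding q(2) convex_hull_finite[OF finB] by blast
    have "\<exists>j\<in>?B. 2 * \<tau> \<le> u j"
    proof (rule ccontr)
      assume "\<not> ?thesis"
      moreover have "?B \<noteq> {}" using u(2) by (metis sum.empty zero_neq_one)
      ultimately have "sum u ?B < (\<Sum>j\<in>?B. 2 * \<tau>)"
        using finB by (intro sum_strict_mono) (auto simp: not_le)
      also have "\<dots> = 1" using cardB by (simp add: \<tau>_def)
      finally show False using u by simp
    qed
    then obtain j where j: "j \<in> ?B" "2 * \<tau> \<le> u j" by blast
    have "x + \<tau> *\<^sub>R \<eta> i j \<in> S" if "i \<in> ?B" for i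
      using prism_in_simplex[OF C(1) q(1) j(1) that u(1,2) j(2)] \<tau> by (simp add: u(3) C(4) \<eta>_def)
    then show ?thesis using j x by (auto simp: X_def)
  qed
  note [measurable] = strain_bounded_continuous(4,5)[OF p]
  define I where "I = (nn_integral_on S (\<lambda>x. (norm (p x))\<^sup>2 + h\<^sup>2 * (N x)\<^sup>2))"
  define K where "K = h\<^sup>2 * (8 / \<tau> + 16 * \<tau>)"
  have K: "0 \<le> K" using \<tau> by (simp add: K_def)
  have part: "(\<integral>\<^sup>+x. indicator (X j) x * ennreal ((p x \<bullet> \<eta> i j)\<^sup>2) \<partial>?\<mu>) \<le> ennreal (K / r) * I"
    if "i \<in> ?B" "j \<in> ?B" for i j
  proof -
    let ?J = "\<integral>\<^sup>+x. indicator (X j) x * ennreal ((p x \<bullet> \<eta> i j)\<^sup>2) \<partial>?\<mu>"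
    have "ennreal r * ?J \<le> ennreal K * I"
      unfolding K_def I_def
      by (rule prism_trace[OF p \<tau> n Xb _ Xsub r(1) \<eta>n \<eta>norm]) (use that in auto)
    then have "ennreal (1 / r) * (ennreal r * ?J) \<le> ennreal (1 / r) * (ennreal K * I)"
      by (intro mult_left_mono) auto
    then show ?thesis using r(1) K
      by (simp add: mult.assoc[symmetric] ennreal_mult[symmetric])
  qed
  have "(\<integral>\<^sup>+x. indicator E x * ennreal ((norm (p x))\<^sup>2) \<partial>?\<mu>) \<le>
      (\<integral>\<^sup>+x. (\<Sum>j\<in>?B. \<Sum>i\<in>?B. ennreal (4 / r\<^sup>2) * (indicator (X j) x * ennreal ((p x \<bullet> \<eta> i j)\<^sup>2))) \<partial>?\<mu>)"
  proof (rule nn_integral_mono)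
    fix x
    show "indicator E x * ennreal ((norm (p x))\<^sup>2) \<le>
      (\<Sum>j\<in>?B. \<Sum>i\<in>?B. ennreal (4 / r\<^sup>2) * (indicator (X j) x * ennreal ((p x \<bullet> \<eta> i j)\<^sup>2)))"
    proof (cases "x \<in> E")
      case True
      then obtain j where j: "j \<in> ?B" "x \<in> X j" using cover by blast
      have "ennreal ((norm (p x))\<^sup>2) \<le> ennreal (\<Sum>i\<in>?B. 4 / r\<^sup>2 * (p x \<bullet> \<eta> i j)\<^sup>2)"
        using recover[OF j(1), of "p x"] by (intro ennreal_leI) (simp add: sum_distrib_left)
      also have "\<dots> = (\<Sum>i\<in>?B. ennreal (4 / r\<^sup>2) * (indicator (X j) x * ennreal ((p x \<bullet> \<eta> i j)\<^sup>2)))"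
      proof -
        have "(\<Sum>i\<in>?B. ennreal (4 / r\<^sup>2) * (indicator (X j) x * ennreal ((p x \<bullet> \<eta> i j)\<^sup>2)))
            = (\<Sum>i\<in>?B. ennreal (4 / r\<^sup>2 * (p x \<bullet> \<eta> i j)\<^sup>2))"
          using j by (intro sum.cong refl, subst ennreal_mult) auto
        then show ?thesis by (simp only: sum_ennreal zero_le_power2 zero_le_mult_iff zero_le_divide_iff) simp
      qed
      also have "\<dots> \<le> (\<Sum>j\<in>?B. \<Sum>i\<in>?B. ennreal (4 / r\<^sup>2) * (indicator (X j) x * ennreal ((p x \<bullet> \<eta> i j)\<^sup>2)))"
        using j finB by (intro member_le_sum) auto
      finally show ?thesis using True by simp
    qed simp
  qed
  also have "\<dots> = (\<Sum>j\<in>?B. \<Sum>i\<in>?B. ennreal (4 / r\<^sup>2) * (\<integral>\<^sup>+x. indicator (X j) x * ennreal ((p x \<bullet> \<eta> i j)\<^sup>2) \<partial>?\<mu>))"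
    by (simp add: nn_integral_sum nn_integral_cmult)
  also have "\<dots> \<le> (\<Sum>j\<in>?B. \<Sum>i\<in>?B. ennreal (4 / r\<^sup>2) * (ennreal (K / r) * I))"
    by (intro sum_mono mult_left_mono part) auto
  also have "\<dots> = ennreal ((real ?d)\<^sup>2 * (4 / r\<^sup>2 * (K / r))) * I"
  proof -
    have "ennreal (real ?d) * (ennreal (real ?d) * (ennreal (4 / r\<^sup>2) * ennreal (K / r)))
        = ennreal ((real ?d)\<^sup>2 * (4 / r\<^sup>2 * (K / r)))"
    proof -
      have "ennreal a * (ennreal a * (ennreal b * ennreal c)) = ennreal (a\<^sup>2 * (b * c))"
        if "0 \<le> a" "0 \<le> b" "0 \<le> c" for a b c
        using that by (simp add: ennreal_mult power2_eq_square mult.assoc)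
      then show ?thesis using r(1) K by simp
    qed
    then show ?thesis
      by (simp add: cardB ennreal_of_nat_eq_real_of_nat mult.assoc[symmetric])
  qed
  finally have "ennreal h * (\<integral>\<^sup>+x. indicator E x * ennreal ((norm (p x))\<^sup>2) \<partial>?\<mu>)
      \<le> ennreal h * (ennreal ((real ?d)\<^sup>2 * (4 / r\<^sup>2 * (K / r))) * I)"
    by (intro mult_left_mono) auto
  also have "\<dots> = ennreal (h * ((real ?d)\<^sup>2 * (4 / r\<^sup>2 * (K / r)))) * I"
    using h r K by (subst ennreal_mult) (auto simp: mult.assoc)
  also have "h * ((real ?d)\<^sup>2 * (4 / r\<^sup>2 * (K / r))) = trace_constant ?d \<rho>"
  proof -
    define K0 where "K0 = 8 / \<tau> + 16 * \<tau>"
    have "K0 = 16 * real ?d + 8 / real ?d" by (simp add: K0_def \<tau>_def)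
    moreover have "h * ((real ?d)\<^sup>2 * (4 / r\<^sup>2 * (K / r))) = 32 * (real ?d)\<^sup>2 * K0 / \<rho> ^ 3"
      using h \<rho>(1) unfolding K_def K0_def[symmetric] r_def
      by (simp add: divide_simps power2_eq_square power3_eq_cube)
    ultimately show ?thesis by (simp add: trace_constant_def)
  qed
  finally show ?thesis unfolding I_def h_def .
qed

section \<open>Lines in general position with respect to simplices\<close>

lemma negligible_AE_lborel:
  assumes "negligible S"
  shows "AE x in lborel. x \<notin> S"
proof -
  have "S \<in> null_sets lebesgue" using assms by (simp add: negligible_iff_null_sets)
  then have "AE x in lebesgue. x \<notin> S" by (rule AE_not_in)
  then show ?thesis by (simp add: AE_completion_iff)
qed

lemma negligible_lines_through_lowdim:
  fixes A :: "'a::euclidean_space set"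
  assumes "aff_dim A \<le> int DIM('a) - 2"
  shows "negligible {x. \<exists>t. x + t *\<^sub>R \<xi> \<in> A}"
proof (cases "A = {}")
  case False
  then obtain p where p: "p \<in> A" by blast
  define B where "B = (+) (- p) ` A"
  have "aff_dim A = int (dim B)"
    unfolding B_def using aff_dim_eq_dim[of p A] p by (simp add: hull_inc)
  then have "dim (insert \<xi> B) < DIM('a)"
    using assms dim_insert[of \<xi> B] by (auto split: if_splits)
  then have "negligible (span (insert \<xi> B))" by (intro negligible_lowdim) simp
  then have "negligible ((+) p ` span (insert \<xi> B))" by (rule negligible_translation)
  moreover have "{x. \<exists>t. x + t *\<^sub>R \<xi> \<in> A} \<subseteq> (+) p ` span (insert \<xi> B)"
  proof clarify
    fix x t assume "x + t *\<^sub>R \<xi> \<in> A"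
    then have "- p + (x + t *\<^sub>R \<xi>) \<in> B" unfolding B_def by blast
    then have "- p + (x + t *\<^sub>R \<xi>) \<in> span (insert \<xi> B)" by (simp add: span_base)
    moreover have "t *\<^sub>R \<xi> \<in> span (insert \<xi> B)" by (simp add: span_base span_scale)
    ultimately have "- p + (x + t *\<^sub>R \<xi>) - t *\<^sub>R \<xi> \<in> span (insert \<xi> B)" by (rule span_diff)
    then show "x \<in> (+) p ` span (insert \<xi> B)"
      by (intro image_eqI[of _ _ "- p + x"]) (auto simp: algebra_simps)
  qed
  ultimately show ?thesis by (rule negligible_subset)
qed simp

lemma negligible_lines_in_hyperplane:
  fixes n :: "'a::euclidean_space"
  assumes "norm n = 1" "n \<bullet> \<xi> = 0" "A \<subseteq> (plane n b)"
  shows "negligible {x. \<exists>t. x + t *\<^sub>R \<xi> \<in> A}"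
proof (rule negligible_subset)
  show "negligible (plane n b)" using assms(1) by (intro negligible_hyperplane) auto
  show "{x. \<exists>t. x + t *\<^sub>R \<xi> \<in> A} \<subseteq> (plane n b)"
    using assms by (force simp: inner_add_right)
qed

lemma simplex_interior_nonempty:
  fixes S :: "'a::euclidean_space set"
  assumes S: "int DIM('a) simplex S"
  shows "interior S \<noteq> {}"
proof -
  have ad: "aff_dim S = int DIM('a)" by (rule aff_dim_simplex[OF S])
  then have "affine hull S = UNIV" by (simp add: aff_dim_eq_full)
  then have "rel_interior S = interior S" by (rule rel_interior_interior)
  moreover have "S \<noteq> {}" using ad by auto
  ultimately show ?thesis using convex_simplex[OF S] rel_interior_eq_empty by metis
qed

lemma simplex_closure_interior:
  fixes S :: "'a::euclidean_space set"
  assumes S: "int DIM('a) simplex S"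
  shows "closure (interior S) = S"
  using convex_closure_interior[OF convex_simplex[OF S] simplex_interior_nonempty[OF S]] closed_simplex[OF S]
  by simp

lemma facet_aff_dim:
  fixes S :: "'a::euclidean_space set"
  assumes "int DIM('a) simplex S" "E facet_of S"
  shows "aff_dim E = int DIM('a) - 1"
  using assms by (simp add: facet_of_def aff_dim_simplex)

text \<open>Normal and offset of the hyperplane spanned by a set; the normal and the offset have to come from
  the same choice because of the sign.\<close>

definition unit_normal :: "'a::euclidean_space set \<Rightarrow> 'a" where
  "unit_normal X = fst (SOME (n, b). norm n = 1 \<and> affine hull X = plane n b)"

definition plane_offset :: "'a::euclidean_space set \<Rightarrow> real" where
  "plane_offset X = snd (SOME (n, b). norm n = 1 \<and> affine hull X = plane n b)"

lemma unit_normal: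
  fixes X :: "'a::euclidean_space set"
  assumes "aff_dim X = int DIM('a) - 1"
  shows "norm (unit_normal X) = 1" "affine hull X = {z. unit_normal X \<bullet> z = plane_offset X}"
proof -
  let ?P = "\<lambda>(n, b). norm n = 1 \<and> affine hull X = plane n b"
  obtain n b where "norm n = 1" "affine hull X = plane n b"
    using hyperplane_unit_normal[OF assms] .
  then have "?P (n, b)" by simp
  then have "?P (SOME nb. ?P nb)" by (rule someI)
  then show "norm (unit_normal X) = 1" "affine hull X = {z. unit_normal X \<bullet> z = plane_offset X}"
    unfolding unit_normal_def plane_offset_def by (simp_all only: case_prod_beta')
qed

definition transversal :: "'a::euclidean_space \<Rightarrow> 'a set \<Rightarrow> bool" where
  "transversal \<xi> X \<longleftrightarrow> unit_normal X \<bullet> \<xi> \<noteq> 0"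

text \<open>The line through \<open>x\<close> avoids the faces of codimension two or more and the facets parallel to it: it
  meets the boundary only in relative interiors of facets which it crosses transversally.\<close>

definition in_general_position :: "'a::euclidean_space \<Rightarrow> 'a \<Rightarrow> 'a set \<Rightarrow> bool" where
  "in_general_position \<xi> x S \<longleftrightarrow>
     (\<forall>G t. G face_of S \<and> aff_dim G \<le> int DIM('a) - 2 \<longrightarrow> x + t *\<^sub>R \<xi> \<notin> G) \<and>
     (\<forall>E t. E facet_of S \<and> \<not> transversal \<xi> E \<longrightarrow> x + t *\<^sub>R \<xi> \<notin> E)"

lemma AE_in_general_position:
  fixes S :: "'a::euclidean_space set"
  assumes S: "int DIM('a) simplex S"
  shows "AE x in lborel. in_general_position \<xi> x S"
proof -
  define Bad where "Bad = {G. G face_of S \<and> aff_dim G \<le> int DIM('a) - 2} \<union>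
    {E. E facet_of S \<and> \<not> transversal \<xi> E}"
  have "Bad \<subseteq> {G. G face_of S}" by (auto simp: Bad_def facet_of_imp_face_of)
  then have "finite Bad"
    using finite_polytope_faces[OF simplex_imp_polytope[OF S]] by (rule finite_subset)
  moreover have "negligible {x. \<exists>t. x + t *\<^sub>R \<xi> \<in> G}" if "G \<in> Bad" for G
    using that unfolding Bad_def
  proof (elim UnE CollectE conjE)
    assume "aff_dim G \<le> int DIM('a) - 2"
    then show ?thesis by (rule negligible_lines_through_lowdim)
  next
    assume G: "G facet_of S" "\<not> transversal \<xi> G"
    note n = unit_normal[OF facet_aff_dim[OF S G(1)]]
    show ?thesis
      using G(2) n(2) hull_subset[of G affine]
      by (intro negligible_lines_in_hyperplane[OF n(1)]) (auto simp: transversal_def)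
  qed
  ultimately have "negligible (\<Union>G\<in>Bad. {x. \<exists>t. x + t *\<^sub>R \<xi> \<in> G})"
    by (intro negligible_Union) auto
  then have "AE x in lborel. x \<notin> (\<Union>G\<in>Bad. {x. \<exists>t. x + t *\<^sub>R \<xi> \<in> G})" by (rule negligible_AE_lborel)
  then show ?thesis
    by eventually_elim (unfold in_general_position_def Bad_def, blast)
qed

lemma hyperplane_subset_parallel:
  fixes n a \<xi> :: "'a::euclidean_space"
  assumes "(plane n b) \<subseteq> {z. a \<bullet> z = c}" "a \<bullet> \<xi> = 0" "a \<noteq> 0"
  shows "n \<bullet> \<xi> = 0"
proof (rule ccontr)
  assume n\<xi>: "n \<bullet> \<xi> \<noteq> 0"
  have all: "a \<bullet> z = c" for z
  proof -
    have "z + ((b - n \<bullet> z) / (n \<bullet> \<xi>)) *\<^sub>R \<xi> \<in> (plane n b)"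
      using n\<xi> by (simp add: inner_add_right)
    then have "a \<bullet> (z + ((b - n \<bullet> z) / (n \<bullet> \<xi>)) *\<^sub>R \<xi>) = c" using assms(1) by blast
    then show ?thesis using assms(2) by (simp add: inner_add_right)
  qed
  then have "a \<bullet> a = a \<bullet> 0" by metis
  then show False using assms(3) by simp
qed

lemma exit_point_in_facet:
  fixes S :: "'a::euclidean_space set"
  assumes S: "int DIM('a) simplex S" and gp: "in_general_position \<xi> x S"
    and y: "x + t *\<^sub>R \<xi> \<in> S" "x + t *\<^sub>R \<xi> \<notin> interior S"
  obtains E where "E facet_of S" "x + t *\<^sub>R \<xi> \<in> rel_interior E" "transversal \<xi> E"
proof -
  let ?y = "x + t *\<^sub>R \<xi>"
  have "?y \<in> frontier S" using y closed_simplex[OF S] by (simp add: frontier_def)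
  then have "?y \<in> \<Union>{F. F facet_of S}"
    using rel_frontier_nonempty_interior[OF simplex_interior_nonempty[OF S]]
      rel_frontier_of_polyhedron[OF simplex_imp_polyhedron[OF S]] by simp
  then obtain E where E: "E facet_of S" "?y \<in> E" by blast
  have polyE: "polyhedron E"
    using E(1) S by (meson facet_of_imp_face_of face_of_polyhedron_polyhedron simplex_imp_polyhedron)
  have "?y \<in> rel_interior E"
  proof (rule ccontr)
    assume "?y \<notin> rel_interior E"
    then have "?y \<in> rel_frontier E"
      using E(2) closure_subset by (auto simp: rel_frontier_def)
    then obtain G where G: "G facet_of E" "?y \<in> G"
      using rel_frontier_of_polyhedron[OF polyE] by blast
    have "G face_of S" using G(1) E(1) by (meson facet_of_imp_face_of face_of_trans)
    moreover have "aff_dim G = int DIM('a) - 2"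
      using G(1) facet_aff_dim[OF S E(1)] by (simp add: facet_of_def)
    ultimately show False using gp G(2) unfolding in_general_position_def by auto
  qed
  moreover have "transversal \<xi> E"
    using gp E unfolding in_general_position_def by blast
  ultimately show thesis using that E(1) by blast
qed

text \<open>If the line missed the interior, a hyperplane containing the line would support \<open>S\<close> at the given
  point. As this point lies in the relative interior of a facet, the supporting hyperplane would be
  that of the facet, which then would be parallel to the line.\<close>

lemma line_meets_interior:
  fixes S :: "'a::euclidean_space set"
  assumes S: "int DIM('a) simplex S" and gp: "in_general_position \<xi> x S"
    and y: "x + t *\<^sub>R \<xi> \<in> S"
  obtains s where "x + s *\<^sub>R \<xi> \<in> interior S"
proof (rule ccontr)
  assume "\<not> thesis"
  then have none: "x + s *\<^sub>R \<xi> \<notin> interior S" for s using that by blast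
  let ?y = "x + t *\<^sub>R \<xi>" and ?L = "range (\<lambda>s. x + s *\<^sub>R \<xi>)"
  obtain E where E: "E facet_of S" "?y \<in> rel_interior E" "transversal \<xi> E"
    by (rule exit_point_in_facet[OF S gp y none]) blast
  have "convex ?L"
  proof (rule convexI)
    fix a b u v assume "a \<in> ?L" "b \<in> ?L" "0 \<le> u" "0 \<le> v" "u + v = (1::real)"
    then obtain s r where "a = x + s *\<^sub>R \<xi>" "b = x + r *\<^sub>R \<xi>" by auto
    then have "u *\<^sub>R a + v *\<^sub>R b = (u + v) *\<^sub>R x + (u * s + v * r) *\<^sub>R \<xi>" by (simp add: algebra_simps)
    then have "u *\<^sub>R a + v *\<^sub>R b = x + (u * s + v * r) *\<^sub>R \<xi>" using \<open>u + v = 1\<close> by simp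
    then show "u *\<^sub>R a + v *\<^sub>R b \<in> ?L" by blast
  qed
  moreover have "?L \<inter> interior S = {}" using none by blast
  ultimately obtain a b where ab: "a \<noteq> 0" "\<forall>z\<in>?L. a \<bullet> z \<le> b" "\<forall>z\<in>interior S. a \<bullet> z \<ge> b"
    using separating_hyperplane_sets[of ?L "interior S"] simplex_interior_nonempty[OF S]
      convex_interior[OF convex_simplex[OF S]] by auto
  have a\<xi>: "a \<bullet> \<xi> = 0"
  proof (rule ccontr)
    assume ne: "a \<bullet> \<xi> \<noteq> 0"
    have "a \<bullet> (x + ((b + 1 - a \<bullet> x) / (a \<bullet> \<xi>)) *\<^sub>R \<xi>) \<le> b" using ab(2) by blast
    then show False using ne by (simp add: inner_add_right)
  qed
  have "closure (interior S) \<subseteq> {z. b \<le> a \<bullet> z}"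
    using ab(3) by (intro closure_minimal closed_halfspace_ge) blast
  then have Sge: "z \<in> S \<Longrightarrow> b \<le> a \<bullet> z" for z
    using simplex_closure_interior[OF S] by blast
  have face: "S \<inter> {z. a \<bullet> z = b} face_of S"
    by (rule face_of_Int_supporting_hyperplane_ge[OF convex_simplex[OF S] Sge])
  have "a \<bullet> ?y \<le> b" using ab(2) by blast
  then have "a \<bullet> ?y = b" using Sge[OF y] by (rule order_antisym)
  then have "E \<subseteq> S \<inter> {z. a \<bullet> z = b}"
    using E(2) y facet_of_imp_subset[OF E(1)] by (intro subset_of_face_of[OF face]) auto
  then have sub: "affine hull E \<subseteq> {z. a \<bullet> z = b}"
    by (intro hull_minimal affine_hyperplane) auto
  have "unit_normal E \<bullet> \<xi> = 0"
    by (rule hyperplane_subset_parallel[OF sub[unfolded unit_normal(2)[OF facet_aff_dim[OF S E(1)]]] a\<xi> ab(1)])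
  then show False using E(3) by (simp add: transversal_def)
qed

definition entry_time :: "'a::euclidean_space \<Rightarrow> 'a \<Rightarrow> 'a set \<Rightarrow> real" where
  "entry_time \<xi> x S = Inf {t. x + t *\<^sub>R \<xi> \<in> S}"

definition exit_time :: "'a::euclidean_space \<Rightarrow> 'a \<Rightarrow> 'a set \<Rightarrow> real" where
  "exit_time \<xi> x S = Sup {t. x + t *\<^sub>R \<xi> \<in> S}"

abbreviation chord_interval :: "'a::euclidean_space \<Rightarrow> 'a \<Rightarrow> 'a set \<Rightarrow> real set" where
  "chord_interval \<xi> x S \<equiv> {entry_time \<xi> x S..exit_time \<xi> x S}"

lemma chord:
  fixes S :: "'a::euclidean_space set"
  assumes S: "int DIM('a) simplex S" and gp: "in_general_position \<xi> x S" and \<xi>: "\<xi> \<noteq> 0"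
    and y: "x + t0 *\<^sub>R \<xi> \<in> S"
  shows "entry_time \<xi> x S < exit_time \<xi> x S"
    and "x + t *\<^sub>R \<xi> \<in> S \<longleftrightarrow> t \<in> (chord_interval \<xi> x S)"
    and "x + t *\<^sub>R \<xi> \<in> interior S \<longleftrightarrow> t \<in> {entry_time \<xi> x S<..<exit_time \<xi> x S}"
proof -
  let ?f = "\<lambda>t. x + t *\<^sub>R \<xi>" and ?L = "{t. x + t *\<^sub>R \<xi> \<in> S}"
  let ?a = "entry_time \<xi> x S" and ?b = "exit_time \<xi> x S"
  have vim: "?L = ?f -` S" by auto
  have "closed ?L" unfolding vim
    by (intro continuous_closed_vimage closed_simplex[OF S] continuous_intros)
  moreover have "bounded ?L"
  proof -
    obtain R where R: "\<And>z. z \<in> S \<Longrightarrow> norm z \<le> R"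
      using compact_imp_bounded[OF compact_simplex[OF S]] by (auto simp: bounded_iff)
    have "\<bar>t\<bar> \<le> (R + norm x) / norm \<xi>" if "t \<in> ?L" for t
    proof -
      have "norm (t *\<^sub>R \<xi>) \<le> norm (x + t *\<^sub>R \<xi>) + norm x"
        by (metis add_diff_cancel_left' add.commute norm_triangle_ineq4)
      also have "\<dots> \<le> R + norm x" using R that by auto
      finally show ?thesis using \<xi> by (simp add: field_simps)
    qed
    then show ?thesis by (auto simp: bounded_iff)
  qed
  ultimately have compact: "compact ?L" by (simp add: compact_eq_bounded_closed)
  have "convex ?L"
  proof (rule convexI)
    fix s r u v assume *: "s \<in> ?L" "r \<in> ?L" "0 \<le> u" "0 \<le> v" "u + v = (1::real)"
    have "x + (u *\<^sub>R s + v *\<^sub>R r) *\<^sub>R \<xi> = u *\<^sub>R (x + s *\<^sub>R \<xi>) + v *\<^sub>R (x + r *\<^sub>R \<xi>)"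
      using *(5) by (simp add: algebra_simps) (metis scaleR_add_left scaleR_one)
    also have "\<dots> \<in> S" using * by (intro convexD[OF convex_simplex[OF S]]) auto
    finally show "u *\<^sub>R s + v *\<^sub>R r \<in> ?L" by simp
  qed
  then have "connected ?L" by (rule convex_connected)
  then obtain a b where ab: "?L = {a..b}"
    using connected_compact_interval_1 compact by blast
  have "a \<le> b" using y ab by (metis (mono_tags, lifting) atLeastAtMost_iff mem_Collect_eq order_trans)
  then have eqs: "?a = a" "?b = b" unfolding entry_time_def exit_time_def ab by auto
  have op: "open (?f -` interior S)"
    by (intro continuous_open_vimage continuous_intros) auto
  have sub: "?f -` interior S \<subseteq> {a..b}" using interior_subset ab by blast
  then have sub': "?f -` interior S \<subseteq> {a<..<b}"
    using interior_maximal[OF sub op] by simp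
  obtain s where s: "?f s \<in> interior S" by (rule line_meets_interior[OF S gp y])
  then have sab: "a < s" "s < b" using sub' by auto
  show "?a < ?b" using sab eqs by simp
  show "x + t *\<^sub>R \<xi> \<in> S \<longleftrightarrow> t \<in> {?a..?b}"
    using ab eqs by blast
  show "x + t *\<^sub>R \<xi> \<in> interior S \<longleftrightarrow> t \<in> {?a<..<?b}"
  proof
    assume "x + t *\<^sub>R \<xi> \<in> interior S"
    then show "t \<in> {?a<..<?b}" using sub' eqs by auto
  next
    assume t: "t \<in> {?a<..<?b}"
    have seg: "?f r \<in> interior S" if e: "e \<in> {a..b}" and r: "r \<in> open_segment s e" for r e
    proof -
      have "?f e \<in> closure S" using e ab closure_subset by blast
      then have "open_segment (?f s) (?f e) \<subseteq> interior S"
        by (rule in_interior_closure_convex_segment[OF convex_simplex[OF S] s])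
      moreover obtain u where u: "0 < u" "u < 1" "r = (1 - u) *\<^sub>R s + u *\<^sub>R e" "s \<noteq> e"
        using r by (auto simp: in_segment)
      have "?f r = (1 - u) *\<^sub>R ?f s + u *\<^sub>R ?f e" unfolding u(3) by (simp add: algebra_simps)
      then have "?f r \<in> open_segment (?f s) (?f e)"
        using \<xi> u unfolding in_segment by auto
      ultimately show ?thesis by blast
    qed
    consider "t = s" | "t < s" | "s < t" by linarith
    then show "x + t *\<^sub>R \<xi> \<in> interior S"
    proof cases
      case 2
      then show ?thesis using t eqs sab seg[of a t] by (simp add: open_segment_eq_real_ivl)
    next
      case 3
      then show ?thesis using t eqs sab seg[of b t] by (simp add: open_segment_eq_real_ivl)
    qed (use s in simp)
  qed
qed

lemma chord_ends_inj:
  fixes lo hi :: "'s \<Rightarrow> real"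
  assumes lh: "\<And>S. S \<in> A \<Longrightarrow> lo S < hi S"
    and disj: "\<And>S S'. S \<in> A \<Longrightarrow> S' \<in> A \<Longrightarrow> S \<noteq> S' \<Longrightarrow> {lo S<..<hi S} \<inter> {lo S'<..<hi S'} = {}"
  shows "inj_on hi A" "inj_on lo A"
proof -
  show "inj_on hi A"
  proof (rule inj_onI, rule ccontr)
    fix S S' assume *: "S \<in> A" "S' \<in> A" "hi S = hi S'" "S \<noteq> S'"
    have "(max (lo S) (lo S') + hi S) / 2 \<in> {lo S<..<hi S} \<inter> {lo S'<..<hi S'}"
      using lh[OF *(1)] lh[OF *(2)] *(3) by (auto simp: max_def)
    then show False using disj[OF *(1,2,4)] by blast
  qed
  show "inj_on lo A"
  proof (rule inj_onI, rule ccontr)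
    fix S S' assume *: "S \<in> A" "S' \<in> A" "lo S = lo S'" "S \<noteq> S'"
    have "(min (hi S) (hi S') + lo S) / 2 \<in> {lo S<..<hi S} \<inter> {lo S'<..<hi S'}"
      using lh[OF *(1)] lh[OF *(2)] *(3) by (auto simp: min_def)
    then show False using disj[OF *(1,2,4)] by blast
  qed
qed

text \<open>Consecutive intervals share an end point, at which the contributions of \<open>g\<close> cancel; at an end point
  that belongs to one interval only, \<open>g\<close> vanishes.\<close>

lemma chords_telescope:
  fixes lo hi :: "'s \<Rightarrow> real" and g :: "real \<Rightarrow> real"
  assumes fin: "finite A" and lh: "\<And>S. S \<in> A \<Longrightarrow> lo S < hi S"
    and disj: "\<And>S S'. S \<in> A \<Longrightarrow> S' \<in> A \<Longrightarrow> S \<noteq> S' \<Longrightarrow> {lo S<..<hi S} \<inter> {lo S'<..<hi S'} = {}"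
    and unshared: "\<And>S e. S \<in> A \<Longrightarrow> e \<in> {lo S, hi S} \<Longrightarrow>
       (\<And>S'. S' \<in> A \<Longrightarrow> e \<in> {lo S'..hi S'} \<Longrightarrow> S' = S) \<Longrightarrow> g e = 0"
  shows "(\<Sum>S\<in>A. g (hi S) - g (lo S)) = 0"
proof -
  have inj: "inj_on hi A" "inj_on lo A"     using chord_ends_inj[of A lo hi, OF lh disj] by simp_all
  have g_hi: "g t = 0" if t: "t \<in> hi ` A - lo ` A" for t
  proof -
    obtain S where S: "S \<in> A" "t = hi S" using t by blast
    have "S' = S" if S': "S' \<in> A" "t \<in> {lo S'..hi S'}" for S'
    proof (rule ccontr)
      assume "S' \<noteq> S"
      have "lo S' < t" using S' t by (metis DiffE atLeastAtMost_iff imageI order_le_less)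
      then have "(max (lo S) (lo S') + t) / 2 \<in> {lo S<..<hi S} \<inter> {lo S'<..<hi S'}"
        using lh[OF S(1)] S(2) S' by (auto simp: max_def)
      then show False using disj[OF S(1) S'(1)] \<open>S' \<noteq> S\<close> by blast
    qed
    then show ?thesis using unshared[OF S(1), of t] S(2) by blast
  qed
  have g_lo: "g t = 0" if t: "t \<in> lo ` A - hi ` A" for t
  proof -
    obtain S where S: "S \<in> A" "t = lo S" using t by blast
    have "S' = S" if S': "S' \<in> A" "t \<in> {lo S'..hi S'}" for S'
    proof (rule ccontr)
      assume "S' \<noteq> S"
      have "t < hi S'" using S' t by (metis DiffE atLeastAtMost_iff imageI order_le_less)
      then have "(min (hi S) (hi S') + t) / 2 \<in> {lo S<..<hi S} \<inter> {lo S'<..<hi S'}"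
        using lh[OF S(1)] S(2) S' by (auto simp: min_def)
      then show False using disj[OF S(1) S'(1)] \<open>S' \<noteq> S\<close> by blast
    qed
    then show ?thesis using unshared[OF S(1), of t] S(2) by blast
  qed
  have "(\<Sum>S\<in>A. g (hi S)) = sum g (hi ` A)" using inj by (simp add: sum.reindex)
  also have "\<dots> = sum g (hi ` A \<inter> lo ` A)"
    using fin g_hi by (intro sum.mono_neutral_right) auto
  also have "\<dots> = sum g (lo ` A)"
    using fin g_lo by (intro sum.mono_neutral_left) auto
  also have "\<dots> = (\<Sum>S\<in>A. g (lo S))" using inj by (simp add: sum.reindex)
  finally show ?thesis by (simp add: sum_subtractf)
qed

section \<open>Geometry of a mesh with a simplicial submesh\<close>

locale submeshed_domain =
  fixes \<Omega> :: "(real^'n) set" and M :: "'n::finite mesh" and \<S> :: "(real^'n) set set" and \<rho> :: real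
  assumes bounded_domain: "bounded \<Omega>" and diameter_domain: "diameter \<Omega> = 1"
    and mesh: "polyhedral_mesh \<Omega> M" and submesh: "matching_simplicial_submesh \<Omega> M \<S>"
    and regular: "submesh_regular \<rho> M \<S>" and \<rho>_pos: "0 < \<rho>"
    and dimension: "2 \<le> CARD('n)"
begin

definition element_of :: "(real^'n) set \<Rightarrow> (real^'n) set" where
  "element_of S = (THE T. T \<in> elements M \<and> interior S \<subseteq> T)"

lemma finite_submesh: "finite \<S>"
  using submesh[unfolded matching_simplicial_submesh_def triangulation_def] by (elim conjE)

lemma submesh_face: "\<forall>S S'. S \<in> \<S> \<and> S' \<in> \<S> \<longrightarrow> (S \<inter> S') face_of S"
  using submesh[unfolded matching_simplicial_submesh_def triangulation_def] by (elim conjE)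

lemma submesh_simplex: "\<forall>S\<in>\<S>. int CARD('n) simplex S"
  using submesh[unfolded matching_simplicial_submesh_def triangulation_def] by (elim conjE)

lemma Union_submesh: "\<Union>\<S> = closure \<Omega>"
  using submesh[unfolded matching_simplicial_submesh_def triangulation_def] by (elim conjE)

lemma submesh_element: "\<forall>S\<in>\<S>. \<exists>!T. T \<in> elements M \<and> interior S \<subseteq> T"
  using submesh[unfolded matching_simplicial_submesh_def triangulation_def] by (elim conjE)

lemma submesh_facet: "\<forall>S\<in>\<S>. \<forall>E. E facet_of S \<longrightarrow>
        (\<forall>F\<in>faces M. rel_interior E \<inter> F = {} \<or> rel_interior E \<subseteq> F)"
  using submesh[unfolded matching_simplicial_submesh_def triangulation_def] by (elim conjE)

lemma finite_elements: "finite (elements M)"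
  using mesh[unfolded polyhedral_mesh_def] by (elim conjE)

lemma pairwise_elements: "pairwise disjnt (elements M)"
  using mesh[unfolded polyhedral_mesh_def] by (elim conjE)

lemma open_elements: "\<forall>T\<in>elements M. T \<noteq> {} \<and> open T \<and> polyhedral T"
  using mesh[unfolded polyhedral_mesh_def] by (elim conjE)

lemma Union_elements: "closure \<Omega> = (\<Union>T\<in>elements M. closure T)"
  using mesh[unfolded polyhedral_mesh_def] by (elim conjE)

lemma finite_faces: "finite (faces M)"
  using mesh[unfolded polyhedral_mesh_def] by (elim conjE)

lemma pairwise_faces: "pairwise disjnt (faces M)"
  using mesh[unfolded polyhedral_mesh_def] by (elim conjE)

lemma faces: "\<forall>F\<in>faces M. hyperplanar_face F \<and> (internal_face M F \<or> F \<in> boundary_faces \<Omega> M)"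
  using mesh[unfolded polyhedral_mesh_def] by (elim conjE)

lemma frontier_elements: "\<forall>T\<in>elements M. frontier T = (\<Union>F\<in>faces_of_element M T. closure F)"
  using mesh[unfolded polyhedral_mesh_def] by (elim conjE)

lemma simplex: "S \<in> \<S> \<Longrightarrow> int DIM(real^'n) simplex S"
  using submesh_simplex by simp

lemma finite_faces_of_element: "finite (faces_of_element M T)"
  using finite_faces by (simp add: faces_of_element_def)

lemma elements_disjoint: "T \<in> elements M \<Longrightarrow> T' \<in> elements M \<Longrightarrow> x \<in> T \<Longrightarrow> x \<in> T' \<Longrightarrow> T = T'"
  using pairwise_elements unfolding pairwise_def disjnt_def by blast

lemma open_element: "T \<in> elements M \<Longrightarrow> open T"
  using open_elements by blast

lemma element_subset: "T \<in> elements M \<Longrightarrow> closure T \<subseteq> closure \<Omega>"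
  using Union_elements by blast

lemma faces_disjoint: "F \<in> faces M \<Longrightarrow> F' \<in> faces M \<Longrightarrow> x \<in> F \<Longrightarrow> x \<in> F' \<Longrightarrow> F = F'"
  using pairwise_faces unfolding pairwise_def disjnt_def by blast

lemma element_of: "S \<in> \<S> \<Longrightarrow> element_of S \<in> elements M" "S \<in> \<S> \<Longrightarrow> interior S \<subseteq> element_of S"
proof -
  assume "S \<in> \<S>"
  then have "\<exists>!T. T \<in> elements M \<and> interior S \<subseteq> T"
    using submesh_element by blast
  then have "element_of S \<in> elements M \<and> interior S \<subseteq> element_of S"
    unfolding element_of_def by (rule theI')
  then show "element_of S \<in> elements M" "interior S \<subseteq> element_of S" by auto
qed

lemma simplex_subset_closure_element: "S \<in> \<S> \<Longrightarrow> S \<subseteq> closure (element_of S)"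
  using closure_mono[OF element_of(2)] simplex_closure_interior[OF simplex] by simp

lemma element_of_unique:
  assumes "S \<in> \<S>" "T \<in> elements M" "y \<in> S" "y \<in> T"
  shows "T = element_of S"
proof -
  have "T \<inter> closure (interior S) \<noteq> {}"
    using assms simplex_closure_interior[OF simplex] by auto
  then have "T \<inter> interior S \<noteq> {}"
    using open_Int_closure_eq_empty[OF open_element[OF assms(2)]] by blast
  then show ?thesis using element_of[OF assms(1)] elements_disjoint assms(2) by blast
qed

lemma closure_element_covered:
  assumes T: "T \<in> elements M" and y: "y \<in> closure T"
  obtains S where "S \<in> \<S>" "element_of S = T" "y \<in> S"
proof -
  let ?U = "\<Union>{S \<in> \<S>. element_of S = T}"
  have "closed ?U"
    using finite_submesh closed_simplex[OF simplex] by (intro closed_Union) auto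
  moreover have "T \<subseteq> ?U"
  proof
    fix z assume z: "z \<in> T"
    then have "z \<in> \<Union>\<S>" using element_subset[OF T] closure_subset Union_submesh by blast
    then obtain S where "S \<in> \<S>" "z \<in> S" by blast
    then show "z \<in> ?U" using element_of_unique[OF _ T _ z] by blast
  qed
  ultimately have "closure T \<subseteq> ?U" by (rule closure_minimal[rotated])
  then show thesis using that y by blast
qed

lemma interior_disjoint:
  assumes S: "S \<in> \<S>" "S' \<in> \<S>" "S \<noteq> S'"
  shows "interior S \<inter> S' = {}"
proof (rule ccontr)
  assume "interior S \<inter> S' \<noteq> {}"
  moreover have "rel_interior S = interior S"
    by (rule rel_interior_nonempty_interior[OF simplex_interior_nonempty[OF simplex[OF S(1)]]])
  ultimately have meets: "(S \<inter> S') \<inter> rel_interior S \<noteq> {}" using interior_subset by auto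
  have face: "X \<in> \<S> \<Longrightarrow> Y \<in> \<S> \<Longrightarrow> (X \<inter> Y) face_of X" for X Y
    using submesh_face by blast
  have "S \<subseteq> S \<inter> S'"
    by (rule subset_of_face_of[OF face[OF S(1,2)] order_refl meets])
  then have "S face_of S'" using face[OF S(2,1)] by (simp add: Int_absorb1 Int_commute inf.absorb1)
  then have "aff_dim S < aff_dim S'"
    using face_of_aff_dim_lt[OF convex_simplex[OF simplex[OF S(2)]]] S(3) by blast
  then show False using aff_dim_simplex[OF simplex[OF S(1)]] aff_dim_simplex[OF simplex[OF S(2)]] by simp
qed

lemma face_disjoint_element:
  assumes "F \<in> faces M" "T \<in> elements M"
  shows "F \<inter> T = {}"
proof -
  obtain T' where T': "T' \<in> elements M" "F \<subseteq> frontier T'"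
  proof -
    have "internal_face M F \<or> F \<in> boundary_faces \<Omega> M" using faces assms(1) by blast
    then show thesis
      unfolding internal_face_def boundary_faces_def by (auto intro: that)
  qed
  show ?thesis
  proof (rule ccontr)
    assume "F \<inter> T \<noteq> {}"
    then obtain y where y: "y \<in> F" "y \<in> T" by blast
    then have "y \<in> closure T'" "y \<notin> T'"
      using T' open_element[OF T'(1)] by (auto simp: frontier_def interior_open)
    then have "T \<inter> T' \<noteq> {}"
      using open_Int_closure_eq_empty[OF open_element[OF assms(2)], of T'] y by blast
    then have "T = T'" using elements_disjoint assms(2) T'(1) by blast
    then show False using y \<open>y \<notin> T'\<close> by blast
  qed
qed

lemma face_nonempty: "F \<in> faces M \<Longrightarrow> F \<noteq> {}"
  using faces unfolding hyperplanar_face_def by blast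

lemma face_aff_dim:
  assumes "F \<in> faces M"
  shows "aff_dim F = int DIM(real^'n) - 1"
proof -
  obtain a b where ab: "a \<noteq> 0" "openin (top_of_set {x. a \<bullet> x = b}) F"
    using faces assms unfolding hyperplanar_face_def by blast
  then have "aff_dim F = aff_dim {x. a \<bullet> x = b}"
    by (intro aff_dim_openin affine_hyperplane face_nonempty[OF assms])
  then show ?thesis using ab(1) by simp
qed

lemma face_openin_affine_hull:
  assumes "F \<in> faces M"
  shows "openin (top_of_set (affine hull F)) F"
proof -
  obtain a b where ab: "a \<noteq> 0" "openin (top_of_set {x. a \<bullet> x = b}) F"
    using faces assms unfolding hyperplanar_face_def by blast
  have "affine hull {x. a \<bullet> x = b} = {x. a \<bullet> x = b}"
    unfolding affine_hull_eq by (rule affine_hyperplane)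
  then have "affine hull F = {x. a \<bullet> x = b}"
    using affine_hull_openin[of "{x. a \<bullet> x = b}" F] ab(2) face_nonempty[OF assms] by (simp only: simp_thms)
  then show ?thesis using ab(2) by simp
qed

lemma face_borel: "F \<in> faces M \<Longrightarrow> F \<in> sets borel"
proof -
  assume "F \<in> faces M"
  then obtain U where "open U" "F = affine hull F \<inter> U"
    using face_openin_affine_hull unfolding openin_open by blast
  moreover have "closed (affine hull F)" by simp
  ultimately show ?thesis by (metis borel_closed borel_open sets.Int)
qed

lemma face_diameter:
  assumes T: "T \<in> elements M" and F: "F \<in> faces_of_element M T"
  shows "0 < diameter F" "diameter F \<le> diameter T" "diameter F \<le> 1" "bounded F"
proof -
  have bT: "bounded T" using bounded_domain element_subset[OF T]
    by (meson bounded_closure bounded_subset closure_subset)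
  have FT: "F \<subseteq> closure T" and F': "F \<in> faces M" using F by (auto simp: faces_of_element_def frontier_def)
  show bF: "bounded F" using bT FT bounded_closure bounded_subset by blast
  have "\<not> (\<exists>a. F \<subseteq> {a})"
  proof
    assume "\<exists>a. F \<subseteq> {a}"
    then have "aff_dim F \<le> 0" by (metis aff_dim_sing aff_dim_subset)
    then show False using face_aff_dim[OF F'] dimension by simp
  qed
  then obtain x y where xy: "x \<in> F" "y \<in> F" "x \<noteq> y" using face_nonempty[OF F'] by blast
  then show "0 < diameter F"
    using diameter_bounded_bound[OF bF xy(1,2)] by (smt (verit) zero_less_dist_iff)
  have "diameter F \<le> diameter (closure T)" using FT bT by (intro diameter_subset) auto
  then show "diameter F \<le> diameter T" using diameter_closure[OF bT] by simp
  have "diameter F \<le> diameter (closure \<Omega>)"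
    using FT element_subset[OF T] bounded_domain by (intro diameter_subset) auto
  then show "diameter F \<le> 1" using diameter_closure[OF bounded_domain] diameter_domain by simp
qed

lemma simplex_diameter_le_1: "S \<in> \<S> \<Longrightarrow> diameter S \<le> 1"
proof -
  assume "S \<in> \<S>"
  then have "diameter S \<le> diameter (closure \<Omega>)"
    using Union_submesh bounded_domain by (intro diameter_subset) auto
  then show ?thesis using diameter_closure[OF bounded_domain] diameter_domain by simp
qed

lemma simplex_diameter_ge: "S \<in> \<S> \<Longrightarrow> \<rho> * diameter (element_of S) \<le> diameter S"
  using regular element_of[of S] unfolding submesh_regular_def by auto

lemma simplex_inradius: "S \<in> \<S> \<Longrightarrow> \<rho> * diameter S \<le> inradius S"
  using regular unfolding submesh_regular_def by auto

text \<open>Besides general position with respect to each simplex, the line must avoid the intersections of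
  the hyperplane of a facet with a different hyperplane of a mesh face, which have codimension two.\<close>

definition generic_point :: "real^'n \<Rightarrow> real^'n \<Rightarrow> bool" where
  "generic_point \<xi> x \<longleftrightarrow>
     (\<forall>S\<in>\<S>. in_general_position \<xi> x S) \<and>
     (\<forall>S\<in>\<S>. \<forall>E. E facet_of S \<longrightarrow> (\<forall>F\<in>faces M. affine hull E \<noteq> affine hull F \<longrightarrow>
        (\<forall>t. x + t *\<^sub>R \<xi> \<notin> affine hull E \<inter> affine hull F)))"

lemma aff_dim_Int_hyperplanes:
  fixes X Y :: "(real^'n) set"
  assumes "aff_dim X = int DIM(real^'n) - 1" "aff_dim Y = int DIM(real^'n) - 1" "affine hull X \<noteq> affine hull Y"
  shows "aff_dim (affine hull X \<inter> affine hull Y) \<le> int DIM(real^'n) - 2"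
proof -
  have "affine hull X \<inter> affine hull Y \<subset> affine hull X"
  proof (rule ccontr)
    assume "\<not> ?thesis"
    then have "affine hull X \<subseteq> affine hull Y" by blast
    then have "affine hull X \<subset> affine hull Y" using assms(3) by blast
    then have "aff_dim X < aff_dim Y" by (metis aff_dim_psubset hull_hull aff_dim_affine_hull)
    then show False using assms by simp
  qed
  moreover have "affine hull (affine hull X \<inter> affine hull Y) = affine hull X \<inter> affine hull Y"
    unfolding affine_hull_eq by (intro affine_Int affine_affine_hull)
  ultimately have "aff_dim (affine hull X \<inter> affine hull Y) < aff_dim (affine hull X)"
    by (intro aff_dim_psubset) (simp only: hull_hull)
  then show ?thesis using assms by simp
qed

lemma AE_generic_point: "AE x in lborel. generic_point \<xi> x"
proof -
  have "AE x in lborel. \<forall>S\<in>\<S>. in_general_position \<xi> x S"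
    using finite_submesh AE_in_general_position[OF simplex] by (intro AE_finite_allI) auto
  moreover have "AE x in lborel. \<forall>S\<in>\<S>. \<forall>E\<in>{E. E facet_of S}. \<forall>F\<in>faces M.
      affine hull E \<noteq> affine hull F \<longrightarrow> (\<forall>t. x + t *\<^sub>R \<xi> \<notin> affine hull E \<inter> affine hull F)"
  proof (intro AE_finite_allI finite_submesh finite_faces)
    fix S E F assume *: "S \<in> \<S>" "E \<in> {E. E facet_of S}" "F \<in> faces M"
    show "AE x in lborel. affine hull E \<noteq> affine hull F \<longrightarrow> (\<forall>t. x + t *\<^sub>R \<xi> \<notin> affine hull E \<inter> affine hull F)"
    proof (cases "affine hull E = affine hull F")
      case False
      have "negligible {x. \<exists>t. x + t *\<^sub>R \<xi> \<in> affine hull E \<inter> affine hull F}"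
        by (intro negligible_lines_through_lowdim aff_dim_Int_hyperplanes face_aff_dim
            facet_aff_dim[OF simplex[OF *(1)]] False) (use * in auto)
      then have "AE x in lborel. x \<notin> {x. \<exists>t. x + t *\<^sub>R \<xi> \<in> affine hull E \<inter> affine hull F}"
        by (rule negligible_AE_lborel)
      then show ?thesis by eventually_elim blast
    qed simp
  next
    fix S assume "S \<in> \<S>"
    then show "finite {E. E facet_of S}"
      using finite_polytope_facets[OF simplex_imp_polytope[OF simplex]] by blast
  qed
  ultimately show ?thesis
    by eventually_elim (simp add: generic_point_def)
qed

text \<open>The point lies in the closure of some face \<open>F\<close> of the element and in the relative interior of a facet
  \<open>E\<close> of \<open>S\<close>. On a generic line this is possible only if \<open>E\<close> and \<open>F\<close> span the same hyperplane; then \<open>F\<close>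
  meets the relative interior of \<open>E\<close> and contains it, since the submesh is matching.\<close>

lemma exit_point_in_face:
  assumes gp: "generic_point \<xi> x" and S: "S \<in> \<S>" and y: "x + t *\<^sub>R \<xi> \<in> S" "x + t *\<^sub>R \<xi> \<notin> element_of S"
  obtains F where "F \<in> faces_of_element M (element_of S)" "x + t *\<^sub>R \<xi> \<in> F" "transversal \<xi> F"
proof -
  let ?y = "x + t *\<^sub>R \<xi>" and ?T = "element_of S"
  have T: "?T \<in> elements M" using element_of(1)[OF S] .
  have gpS: "in_general_position \<xi> x S" using gp S by (simp add: generic_point_def)
  have "?y \<notin> interior S" using y element_of(2)[OF S] by blast
  then obtain E where E: "E facet_of S" "?y \<in> rel_interior E" "transversal \<xi> E"
    using exit_point_in_facet[OF simplex[OF S] gpS y(1)] by metis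
  have "?y \<in> frontier ?T"
    using y simplex_subset_closure_element[OF S] open_element[OF T] by (auto simp: frontier_def interior_open)
  moreover have "frontier ?T = (\<Union>F\<in>faces_of_element M ?T. closure F)"
    using frontier_elements T by blast
  ultimately obtain F where F: "F \<in> faces_of_element M ?T" "?y \<in> closure F" by auto
  have F': "F \<in> faces M" using F(1) by (simp add: faces_of_element_def)
  have "closure F \<subseteq> affine hull F" by (intro closure_minimal hull_subset) simp
  moreover have "?y \<in> affine hull E"
    using E(2) rel_interior_subset hull_subset[of E affine] by blast
  ultimately have "?y \<in> affine hull E \<inter> affine hull F" using F(2) by blast
  then have eq: "affine hull E = affine hull F"
    using gp S E(1) F' unfolding generic_point_def by blast
  have "openin (top_of_set (affine hull F)) (rel_interior E)"
    using openin_rel_interior[of E] eq by simp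
  then obtain U where U: "open U" "rel_interior E = affine hull F \<inter> U" unfolding openin_open by blast
  have "U \<inter> F \<noteq> {}"
    using open_Int_closure_eq_empty[OF U(1), of F] F(2) E(2) U(2) by blast
  then have "rel_interior E \<inter> F \<noteq> {}" using U(2) hull_subset[of F affine] by blast
  then have "rel_interior E \<subseteq> F"
    using submesh_facet S E(1) F' by blast
  moreover have "transversal \<xi> F"
    using E(3) unfolding transversal_def unit_normal_def eq .
  ultimately show thesis using that[OF F(1)] E(2) by auto
qed

end

section \<open>The energy estimate on one line\<close>

definition crossing :: "'a::euclidean_space \<Rightarrow> 'a set \<Rightarrow> 'a \<Rightarrow> 'a" where
  "crossing \<xi> X x = x + crossing_time \<xi> (unit_normal X) (plane_offset X) x *\<^sub>R \<xi>"

lemma crossing_time_unique: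
  assumes "transversal \<xi> X" "unit_normal X \<bullet> (x + t *\<^sub>R \<xi>) = plane_offset X"
  shows "t = crossing_time \<xi> (unit_normal X) (plane_offset X) x"
  using assms by (auto simp: transversal_def crossing_time_def inner_add_right field_simps)

lemma crossing_unique:
  fixes X :: "'a::euclidean_space set"
  assumes "aff_dim X = int DIM('a) - 1" "transversal \<xi> X" "x + t *\<^sub>R \<xi> \<in> X"
  shows "t = crossing_time \<xi> (unit_normal X) (plane_offset X) x" "crossing \<xi> X x = x + t *\<^sub>R \<xi>"
proof -
  have "x + t *\<^sub>R \<xi> \<in> affine hull X" using assms(3) by (rule hull_inc)
  then have "unit_normal X \<bullet> (x + t *\<^sub>R \<xi>) = plane_offset X"
    using unit_normal(2)[OF assms(1)] by blast
  then show "t = crossing_time \<xi> (unit_normal X) (plane_offset X) x"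
    by (rule crossing_time_unique[OF assms(2)])
  then show "crossing \<xi> X x = x + t *\<^sub>R \<xi>" by (simp add: crossing_def)
qed

lemma weighted_young:
  fixes k w \<delta> :: real
  assumes "0 < k"
  shows "\<bar>2 * w * \<delta>\<bar> \<le> k * w\<^sup>2 + \<delta>\<^sup>2 / k"
proof -
  have "0 \<le> (k * w + \<delta>)\<^sup>2 / k" "0 \<le> (k * w - \<delta>)\<^sup>2 / k" using assms by simp_all
  moreover have "(k * w + \<delta>)\<^sup>2 / k = k * w\<^sup>2 + \<delta>\<^sup>2 / k + 2 * w * \<delta>"
    "(k * w - \<delta>)\<^sup>2 / k = k * w\<^sup>2 + \<delta>\<^sup>2 / k - 2 * w * \<delta>"
    using assms by (simp_all add: field_simps power2_eq_square)
  ultimately show ?thesis by linarith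
qed

text \<open>A hyperplane is crossed at one parameter \<open>c\<close> only, and at most one chord ends there.\<close>

lemma sum_le_single:
  fixes f :: "'s \<Rightarrow> real"
  assumes "finite B" "inj_on e B" "\<And>S. S \<in> B \<Longrightarrow> f S \<noteq> 0 \<Longrightarrow> e S = c \<and> f S \<le> K" "0 \<le> K"
  shows "sum f B \<le> K"
proof (cases "\<exists>S\<in>B. f S \<noteq> 0")
  case True
  then obtain S where S: "S \<in> B" "f S \<noteq> 0" by blast
  have "f S' = 0" if "S' \<in> B" "S' \<noteq> S" for S'
    using assms(3)[OF S] assms(3)[OF that(1)] that assms(2) S(1) unfolding inj_on_def by metis
  then have "sum f (B - {S}) = 0" by (intro sum.neutral) auto
  then have "sum f B = f S" using S assms(1) by (simp add: sum.remove)
  then show ?thesis using assms(3)[OF S] by simp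
next
  case False
  then show ?thesis using assms(4) by (simp add: sum.neutral)
qed

text \<open>The element fields \<open>P\<close> and face fields \<open>Q\<close> are total functions that extend the discrete unknowns.\<close>

locale hybrid_field = submeshed_domain \<Omega> M \<S> \<rho>
  for \<Omega> :: "(real^'n) set" and M :: "'n::finite mesh" and \<S> \<rho> +
  fixes P :: "(real^'n) set \<Rightarrow> real^'n \<Rightarrow> real^'n" and strain :: "(real^'n) set \<Rightarrow> real^'n \<Rightarrow> real"
    and Q :: "(real^'n) set \<Rightarrow> real^'n \<Rightarrow> real^'n"
  assumes strain_bounded: "T \<in> elements M \<Longrightarrow> strain_bounded (P T) (strain T)"
    and continuous_face_field: "F \<in> faces M \<Longrightarrow> continuous_on UNIV (Q F)"
    and boundary_condition: "F \<in> boundary_faces \<Omega> M \<Longrightarrow> x \<in> F \<Longrightarrow> Q F x = 0"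
begin

text \<open>Elements and faces are pairwise disjoint, so that at most one term of the two sums is nonzero.\<close>

definition single_valued :: "real^'n \<Rightarrow> real^'n" where
  "single_valued y = (\<Sum>T\<in>elements M. indicator T y *\<^sub>R P T y) + (\<Sum>F\<in>faces M. indicator F y *\<^sub>R Q F y)"

lemma single_valued_element:
  assumes "T \<in> elements M" "y \<in> T"
  shows "single_valued y = P T y"
proof -
  have "(\<Sum>T'\<in>elements M. indicator T' y *\<^sub>R P T' y) = (\<Sum>T'\<in>elements M. if T' = T then P T y else 0)"
    using assms elements_disjoint by (intro sum.cong) (auto simp: indicator_def)
  moreover have "(\<Sum>F\<in>faces M. indicator F y *\<^sub>R Q F y) = 0"
    using assms face_disjoint_element by (intro sum.neutral) (auto simp: indicator_def)
  ultimately show ?thesis using assms(1) finite_elements by (simp add: single_valued_def)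
qed

lemma single_valued_face:
  assumes "F \<in> faces M" "y \<in> F"
  shows "single_valued y = Q F y"
proof -
  have "(\<Sum>F'\<in>faces M. indicator F' y *\<^sub>R Q F' y) = (\<Sum>F'\<in>faces M. if F' = F then Q F y else 0)"
    using assms faces_disjoint by (intro sum.cong) (auto simp: indicator_def)
  moreover have "(\<Sum>T\<in>elements M. indicator T y *\<^sub>R P T y) = 0"
    using assms face_disjoint_element by (intro sum.neutral) (auto simp: indicator_def)
  ultimately show ?thesis using assms(1) finite_faces by (simp add: single_valued_def)
qed

text \<open>A point which belongs to \<open>S\<close> only, among all simplices, is not interior to an element, since it would
  then be interior to \<open>S\<close>. It lies on a face that is not internal, for the two elements of an internal
  face have two different simplices at this point. Hence the face is a boundary face.\<close>

lemma single_valued_unshared: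
  assumes gp: "generic_point \<xi> x" and S: "S \<in> \<S>" and y: "x + t *\<^sub>R \<xi> \<in> S" "x + t *\<^sub>R \<xi> \<notin> interior S"
    and only: "\<And>S'. S' \<in> \<S> \<Longrightarrow> x + t *\<^sub>R \<xi> \<in> S' \<Longrightarrow> S' = S"
  shows "single_valued (x + t *\<^sub>R \<xi>) = 0"
proof -
  let ?y = "x + t *\<^sub>R \<xi>"
  have notin: "?y \<notin> element_of S"
  proof
    assume y_el: "?y \<in> element_of S"
    let ?U = "element_of S - \<Union>(\<S> - {S})"
    have "closed (\<Union>(\<S> - {S}))"
      using finite_submesh closed_simplex[OF simplex] by (intro closed_Union) auto
    then have "open ?U" using open_element[OF element_of(1)[OF S]] by (rule open_Diff[rotated])
    moreover have "?y \<in> ?U" using y_el only by blast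
    moreover have "?U \<subseteq> S"
      using element_subset[OF element_of(1)[OF S]] closure_subset Union_submesh by blast
    ultimately show False using y(2) interior_maximal by blast
  qed
  obtain F where F: "F \<in> faces_of_element M (element_of S)" "?y \<in> F"
    using exit_point_in_face[OF gp S y(1) notin] by metis
  have F': "F \<in> faces M" using F(1) by (simp add: faces_of_element_def)
  have "\<not> internal_face M F"
  proof
    assume "internal_face M F"
    then obtain T1 T2 where T: "T1 \<in> elements M" "T2 \<in> elements M" "T1 \<noteq> T2"
        "F \<subseteq> closure T1" "F \<subseteq> closure T2"
      unfolding internal_face_def by (auto simp: frontier_def)
    obtain S1 where S1: "S1 \<in> \<S>" "element_of S1 = T1" "?y \<in> S1"
      by (rule closure_element_covered[OF T(1), of ?y]) (use T F in auto)
    obtain S2 where S2: "S2 \<in> \<S>" "element_of S2 = T2" "?y \<in> S2"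
      by (rule closure_element_covered[OF T(2), of ?y]) (use T F in auto)
    show False using only[OF S1(1,3)] only[OF S2(1,3)] S1(2) S2(2) T(3) by simp
  qed
  then have "F \<in> boundary_faces \<Omega> M" using faces F' by blast
  then show ?thesis
    using boundary_condition F(2) single_valued_face[OF F' F(2)] by simp
qed

definition jump_density :: "(real^'n) set \<Rightarrow> (real^'n) set \<Rightarrow> real^'n \<Rightarrow> real" where
  "jump_density T F y = indicator F y * (inverse (diameter F) * (norm (Q F y - P T y))\<^sup>2)"

lemma jump_density_nonneg: "F \<in> faces_of_element M T \<Longrightarrow> T \<in> elements M \<Longrightarrow> 0 \<le> jump_density T F y"
  using face_diameter(1)[of T F] by (simp add: jump_density_def)

text \<open>Inside the element there is no defect. On a face, with \<open>w\<close> and \<open>w + \<delta>\<close> the values of the element field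
  and of the single-valued field, the defect is at most \<open>\<bar>2 w \<delta>\<bar> + \<delta>\<^sup>2\<close>, and Young's inequality with the weight
  \<open>\<epsilon> h\<^sub>F\<close> applies. The bounds \<open>h\<^sub>F \<le> h\<^sub>T \<le> h\<^sub>S / \<rho>\<close> and \<open>h\<^sub>F \<le> 1\<close> give the stated weights.\<close>

lemma endpoint_defect:
  assumes gp: "generic_point \<xi> x" and \<xi>: "norm \<xi> = 1" and S: "S \<in> \<S>" and y: "y = x + t *\<^sub>R \<xi>" "y \<in> S"
    and \<epsilon>: "0 < \<epsilon>"
  shows "\<bar>(P (element_of S) y \<bullet> \<xi>)\<^sup>2 - (single_valued y \<bullet> \<xi>)\<^sup>2\<bar> \<le>
     \<epsilon> / \<rho> * (diameter S * (norm (P (element_of S) y))\<^sup>2)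
     + (1 + 1 / \<epsilon>) * (\<Sum>F\<in>faces_of_element M (element_of S). jump_density (element_of S) F y)"
proof -
  let ?T = "element_of S"
  have T: "?T \<in> elements M" by (rule element_of(1)[OF S])
  have pos1: "0 \<le> \<epsilon> / \<rho> * (diameter S * (norm (P ?T y))\<^sup>2)"
    using \<epsilon> \<rho>_pos simplex_diameter_pos[OF simplex[OF S]] by simp
  have pos2: "0 \<le> (\<Sum>F\<in>faces_of_element M ?T. jump_density ?T F y)"
    by (intro sum_nonneg jump_density_nonneg T)
  show ?thesis
  proof (cases "y \<in> ?T")
    case True
    then show ?thesis using single_valued_element[OF T True] pos1 pos2 \<epsilon> by simp
  next
    case False
    obtain F where F: "F \<in> faces_of_element M ?T" "y \<in> F"
      using exit_point_in_face[OF gp S, of t] y False by metis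
    have F': "F \<in> faces M" using F(1) by (simp add: faces_of_element_def)
    define w where "w = P ?T y \<bullet> \<xi>"
    define \<delta> where "\<delta> = (Q F y - P ?T y) \<bullet> \<xi>"
    define D where "D = (norm (Q F y - P ?T y))\<^sup>2"
    define h where "h = diameter F"
    have h: "0 < h" "h \<le> 1" "h \<le> diameter ?T" using face_diameter[OF T F(1)] by (auto simp: h_def)
    have hS: "h \<le> diameter S / \<rho>"
      using simplex_diameter_ge[OF S] h(3) \<rho>_pos by (simp add: field_simps) (smt (verit) mult_left_mono)
    have sv: "single_valued y \<bullet> \<xi> = w + \<delta>"
      by (simp add: single_valued_face[OF F' F(2)] w_def \<delta>_def inner_diff_left)
    have \<delta>D: "\<delta>\<^sup>2 \<le> D"
      using Cauchy_Schwarz_ineq[of "Q F y - P ?T y" \<xi>] \<xi> by (simp add: \<delta>_def D_def power2_norm_eq_inner[symmetric])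
    have wP: "w\<^sup>2 \<le> (norm (P ?T y))\<^sup>2"
      using Cauchy_Schwarz_ineq[of "P ?T y" \<xi>] \<xi> by (simp add: w_def power2_norm_eq_inner[symmetric])
    have D0: "0 \<le> D" by (simp add: D_def)
    have "\<bar>2 * w * \<delta>\<bar> \<le> \<epsilon> * h * w\<^sup>2 + \<delta>\<^sup>2 / (\<epsilon> * h)"
      by (rule weighted_young) (use \<epsilon> h in simp)
    moreover have "w\<^sup>2 - (w + \<delta>)\<^sup>2 = - (2 * w * \<delta>) - \<delta>\<^sup>2" by (simp add: power2_eq_square algebra_simps)
    ultimately have 1: "\<bar>w\<^sup>2 - (w + \<delta>)\<^sup>2\<bar> \<le> \<epsilon> * h * w\<^sup>2 + \<delta>\<^sup>2 / (\<epsilon> * h) + \<delta>\<^sup>2"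
      using zero_le_power2[of \<delta>] by linarith
    have 2: "\<epsilon> * h * w\<^sup>2 \<le> \<epsilon> / \<rho> * (diameter S * (norm (P ?T y))\<^sup>2)"
    proof -
      have "\<epsilon> * h * w\<^sup>2 \<le> \<epsilon> * (diameter S / \<rho>) * (norm (P ?T y))\<^sup>2"
        using hS wP \<epsilon> h \<rho>_pos simplex_diameter_pos[OF simplex[OF S]] by (intro mult_mono) auto
      then show ?thesis by simp
    qed
    have 3: "\<delta>\<^sup>2 / (\<epsilon> * h) \<le> 1 / \<epsilon> * (D / h)"
      using \<delta>D \<epsilon> h by (simp add: divide_simps)
    have 4: "\<delta>\<^sup>2 \<le> D / h"
    proof -
      have "D \<le> D / h" using D0 h by (simp add: field_simps mult_left_le)
      then show ?thesis using \<delta>D by linarith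
    qed
    have "D / h = jump_density ?T F y"
      using F(2) by (simp add: jump_density_def D_def h_def field_simps)
    also have "\<dots> \<le> (\<Sum>F\<in>faces_of_element M ?T. jump_density ?T F y)"
      using F(1) T by (intro member_le_sum jump_density_nonneg finite_faces_of_element) auto
    finally have "(1 + 1 / \<epsilon>) * (D / h) \<le> (1 + 1 / \<epsilon>) * (\<Sum>F\<in>faces_of_element M ?T. jump_density ?T F y)"
      using \<epsilon> by (intro mult_left_mono) auto
    then show ?thesis unfolding sv w_def[symmetric] using 1 2 3 4 by (simp add: algebra_simps)
  qed
qed

definition line_jumps :: "real^'n \<Rightarrow> real^'n \<Rightarrow> real" where
  "line_jumps \<xi> x = (\<Sum>T\<in>elements M. \<Sum>F\<in>{F \<in> faces_of_element M T. transversal \<xi> F}. jump_density T F (crossing \<xi> F x))"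

definition line_traces :: "real^'n \<Rightarrow> real^'n \<Rightarrow> real" where
  "line_traces \<xi> x = (\<Sum>S\<in>\<S>. \<Sum>E\<in>{E. E facet_of S \<and> transversal \<xi> E}.
     diameter S * (indicator E (crossing \<xi> E x) * (norm (P (element_of S) (crossing \<xi> E x)))\<^sup>2))"

text \<open>For a fixed element and a fixed face the sum over chords has at most one nonzero term: the line
  crosses the hyperplane of the face once, and each point is the \<open>e\<close>-end of at most one chord. This is
  what keeps the constant independent of the number of faces on the line.\<close>

lemma sum_endpoint_jumps:
  assumes gp: "generic_point \<xi> x" and A: "A \<subseteq> \<S>" and e: "inj_on e A"
    and y: "\<And>S. S \<in> A \<Longrightarrow> x + e S *\<^sub>R \<xi> \<in> S"
  shows "(\<Sum>S\<in>A. \<Sum>F\<in>faces_of_element M (element_of S). jump_density (element_of S) F (x + e S *\<^sub>R \<xi>))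
     \<le> line_jumps \<xi> x"
proof -
  let ?F = "\<lambda>T. {F \<in> faces_of_element M T. transversal \<xi> F}"
  let ?j = "\<lambda>T F S. jump_density T F (x + e S *\<^sub>R \<xi>)"
  have finA: "finite A" using A finite_submesh finite_subset by blast
  have "(\<Sum>S\<in>A. \<Sum>F\<in>faces_of_element M (element_of S). ?j (element_of S) F S)
      = (\<Sum>S\<in>A. \<Sum>F\<in>?F (element_of S). ?j (element_of S) F S)"
  proof (rule sum.cong[OF refl], rule sum.mono_neutral_right[OF finite_faces_of_element], blast, rule ballI)
    fix S F assume S: "S \<in> A" and F: "F \<in> faces_of_element M (element_of S) - ?F (element_of S)"
    let ?y = "x + e S *\<^sub>R \<xi>"
    have SS: "S \<in> \<S>" using S A by blast
    have F': "F \<in> faces M" "\<not> transversal \<xi> F" using F by (auto simp: faces_of_element_def)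
    have "?y \<notin> F"
    proof
      assume "?y \<in> F"
      then have "?y \<notin> element_of S" using face_disjoint_element[OF F'(1) element_of(1)[OF SS]] by blast
      then obtain F0 where F0: "F0 \<in> faces_of_element M (element_of S)" "?y \<in> F0" "transversal \<xi> F0"
        using exit_point_in_face[OF gp SS y[OF S]] by metis
      have "F0 = F"
        using F0(1,2) F'(1) \<open>?y \<in> F\<close> faces_disjoint by (auto simp: faces_of_element_def)
      then show False using F0(3) F'(2) by blast
    qed
    then show "?j (element_of S) F S = 0" by (simp add: jump_density_def)
  qed
  also have "\<dots> = (\<Sum>T\<in>elements M. \<Sum>S\<in>{S \<in> A. element_of S = T}. \<Sum>F\<in>?F (element_of S). ?j (element_of S) F S)"
    using A element_of(1) by (intro sum.group[symmetric] finA finite_elements) auto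
  also have "\<dots> = (\<Sum>T\<in>elements M. \<Sum>S\<in>{S \<in> A. element_of S = T}. \<Sum>F\<in>?F T. ?j T F S)"
    by (intro sum.cong) auto
  also have "\<dots> = (\<Sum>T\<in>elements M. \<Sum>F\<in>?F T. \<Sum>S\<in>{S \<in> A. element_of S = T}. ?j T F S)"
    by (intro sum.cong refl sum.swap)
  also have "\<dots> \<le> line_jumps \<xi> x"
    unfolding line_jumps_def
  proof (intro sum_mono)
    fix T F assume T: "T \<in> elements M" and F: "F \<in> ?F T"
    have F': "F \<in> faces M" "transversal \<xi> F" using F by (auto simp: faces_of_element_def)
    show "(\<Sum>S\<in>{S \<in> A. element_of S = T}. ?j T F S) \<le> jump_density T F (crossing \<xi> F x)"
    proof (rule sum_le_single[where e = e and c = "crossing_time \<xi> (unit_normal F) (plane_offset F) x"])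
      show "finite {S \<in> A. element_of S = T}" using finA by simp
      show "inj_on e {S \<in> A. element_of S = T}" using e by (rule inj_on_subset) auto
      show "0 \<le> jump_density T F (crossing \<xi> F x)" using jump_density_nonneg T F by blast
      fix S assume "S \<in> {S \<in> A. element_of S = T}" "?j T F S \<noteq> 0"
      then have "x + e S *\<^sub>R \<xi> \<in> F" by (auto simp: jump_density_def indicator_def split: if_splits)
      then show "e S = crossing_time \<xi> (unit_normal F) (plane_offset F) x \<and> ?j T F S \<le> jump_density T F (crossing \<xi> F x)"
        using crossing_unique[OF face_aff_dim[OF F'(1)] F'(2)] by simp
    qed
  qed
  finally show ?thesis .
qed

lemma finite_facets: "S \<in> \<S> \<Longrightarrow> finite {E. E facet_of S}"
  using finite_polytope_facets[OF simplex_imp_polytope[OF simplex]] by blast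

lemma sum_endpoint_traces:
  assumes gp: "generic_point \<xi> x" and A: "A \<subseteq> \<S>"
    and y: "\<And>S. S \<in> A \<Longrightarrow> x + e S *\<^sub>R \<xi> \<in> S" "\<And>S. S \<in> A \<Longrightarrow> x + e S *\<^sub>R \<xi> \<notin> interior S"
  shows "(\<Sum>S\<in>A. diameter S * (norm (P (element_of S) (x + e S *\<^sub>R \<xi>)))\<^sup>2) \<le> line_traces \<xi> x"
proof -
  let ?f = "\<lambda>S. \<Sum>E\<in>{E. E facet_of S \<and> transversal \<xi> E}.
     diameter S * (indicator E (crossing \<xi> E x) * (norm (P (element_of S) (crossing \<xi> E x)))\<^sup>2)"
  have nonneg: "0 \<le> diameter S * (indicator E (crossing \<xi> E x) * (norm (P (element_of S) (crossing \<xi> E x)))\<^sup>2)"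
    if "S \<in> \<S>" for S E
    using simplex_diameter_pos[OF simplex[OF that]] by simp
  have "(\<Sum>S\<in>A. diameter S * (norm (P (element_of S) (x + e S *\<^sub>R \<xi>)))\<^sup>2) \<le> (\<Sum>S\<in>A. ?f S)"
  proof (rule sum_mono)
    fix S assume S: "S \<in> A"
    then have SS: "S \<in> \<S>" using A by blast
    obtain E where E: "E facet_of S" "x + e S *\<^sub>R \<xi> \<in> rel_interior E" "transversal \<xi> E"
      using exit_point_in_facet[OF simplex[OF SS] _ y(1)[OF S] y(2)[OF S]] gp SS
      unfolding generic_point_def by metis
    have ad: "aff_dim E = int DIM(real^'n) - 1" by (rule facet_aff_dim[OF simplex[OF SS] E(1)])
    have yE: "x + e S *\<^sub>R \<xi> \<in> E" using E(2) rel_interior_subset by blast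
    have "diameter S * (norm (P (element_of S) (x + e S *\<^sub>R \<xi>)))\<^sup>2 =
        diameter S * (indicator E (crossing \<xi> E x) * (norm (P (element_of S) (crossing \<xi> E x)))\<^sup>2)"
      using crossing_unique(2)[OF ad E(3) yE] yE by simp
    also have "\<dots> \<le> ?f S"
      using E(1,3) by (intro member_le_sum nonneg SS)
        (auto intro: finite_subset[OF _ finite_facets[OF SS]])
    finally show "diameter S * (norm (P (element_of S) (x + e S *\<^sub>R \<xi>)))\<^sup>2 \<le> ?f S" .
  qed
  also have "\<dots> \<le> (\<Sum>S\<in>\<S>. ?f S)"
    using A finite_submesh by (intro sum_mono2 sum_nonneg nonneg) auto
  finally show ?thesis unfolding line_traces_def .
qed

text \<open>Sum \<open>interval_energy_estimate\<close> over the chords of the line. Subtracting the telescoping sum of the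
  single-valued field leaves the defects at the two ends of each chord.\<close>

lemma line_energy_estimate:
  assumes gp: "generic_point \<xi> x" and \<xi>: "norm \<xi> = 1" and \<epsilon>: "0 < \<epsilon>"
  defines "A \<equiv> {S \<in> \<S>. \<exists>t. x + t *\<^sub>R \<xi> \<in> S}"
  shows "(\<Sum>S\<in>A. integral (chord_interval \<xi> x S) (\<lambda>t. (P (element_of S) (x + t *\<^sub>R \<xi>) \<bullet> \<xi>)\<^sup>2))
    \<le> 4 * (\<Sum>S\<in>A. integral (chord_interval \<xi> x S) (\<lambda>t. (strain (element_of S) (x + t *\<^sub>R \<xi>))\<^sup>2))
      + 4 * (\<epsilon> / \<rho>) * line_traces \<xi> x + 4 * (1 + 1 / \<epsilon>) * line_jumps \<xi> x"
proof (cases "A = {}")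
  case True
  have "0 \<le> line_traces \<xi> x" unfolding line_traces_def
    using simplex_diameter_pos[OF simplex] by (intro sum_nonneg) (auto simp: less_imp_le)
  moreover have "0 \<le> line_jumps \<xi> x" unfolding line_jumps_def
    by (intro sum_nonneg jump_density_nonneg) auto
  ultimately show ?thesis using True \<epsilon> \<rho>_pos by simp
next
  case False
  let ?lo = "entry_time \<xi> x" and ?hi = "exit_time \<xi> x"
  let ?w = "\<lambda>S t. P (element_of S) (x + t *\<^sub>R \<xi>) \<bullet> \<xi>" and ?s = "\<lambda>t. single_valued (x + t *\<^sub>R \<xi>) \<bullet> \<xi>"
  have \<xi>0: "\<xi> \<noteq> 0" using \<xi> by auto
  have AS: "A \<subseteq> \<S>" by (auto simp: A_def)
  have finA: "finite A" using AS finite_submesh finite_subset by blast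
  have chordA: "?lo S < ?hi S"
    "x + t *\<^sub>R \<xi> \<in> S \<longleftrightarrow> t \<in> {?lo S..?hi S}" "x + t *\<^sub>R \<xi> \<in> interior S \<longleftrightarrow> t \<in> {?lo S<..<?hi S}"
    if S: "S \<in> A" for S t
  proof -
    obtain t0 where t0: "x + t0 *\<^sub>R \<xi> \<in> S" using S by (auto simp: A_def)
    have "in_general_position \<xi> x S" using gp S AS by (auto simp: generic_point_def)
    note ch = chord[OF simplex[of S] this \<xi>0 t0]
    show "?lo S < ?hi S" "x + t *\<^sub>R \<xi> \<in> S \<longleftrightarrow> t \<in> {?lo S..?hi S}"
      "x + t *\<^sub>R \<xi> \<in> interior S \<longleftrightarrow> t \<in> {?lo S<..<?hi S}"
      using S AS ch by blast+
  qed
  have disj: "{?lo S<..<?hi S} \<inter> {?lo S'<..<?hi S'} = {}" if "S \<in> A" "S' \<in> A" "S \<noteq> S'" for S S'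
  proof (rule ccontr)
    assume "\<not> ?thesis"
    then obtain t where "t \<in> {?lo S<..<?hi S}" "t \<in> {?lo S'<..<?hi S'}" by blast
    then have "x + t *\<^sub>R \<xi> \<in> interior S \<inter> S'"
      using chordA(3)[OF that(1), of t] chordA(3)[OF that(2), of t] interior_subset by blast
    then show False using interior_disjoint that AS by blast
  qed
  obtain c where c: "c \<in> closure \<Omega>"
  proof -
    obtain S where "S \<in> A" using False by blast
    then obtain t where "x + t *\<^sub>R \<xi> \<in> S" "S \<in> \<S>" by (auto simp: A_def)
    then show thesis using that Union_submesh by blast
  qed
  \<comment> \<open>The weight \<open>t - t0\<close> is the component along \<open>\<xi>\<close> of the position relative to \<open>c\<close>.\<close>
  define t0 where "t0 = (c - x) \<bullet> \<xi>"
  have \<xi>\<xi>: "\<xi> \<bullet> \<xi> = 1" using \<xi> by (simp add: norm_eq_1)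
  have m: "\<bar>t - t0\<bar> \<le> 1" if "S \<in> A" "t \<in> {?lo S..?hi S}" for S t
  proof -
    have "x + t *\<^sub>R \<xi> \<in> closure \<Omega>" using chordA(2)[OF that(1)] that AS Union_submesh by blast
    then have "dist (x + t *\<^sub>R \<xi>) c \<le> diameter (closure \<Omega>)"
      using c bounded_domain by (intro diameter_bounded_bound) auto
    then have d: "norm (x + t *\<^sub>R \<xi> - c) \<le> 1"
      using diameter_closure[OF bounded_domain] diameter_domain by (simp add: dist_norm)
    have "t - t0 = (x + t *\<^sub>R \<xi> - c) \<bullet> \<xi>" by (simp add: t0_def inner_diff_left inner_add_left \<xi>\<xi>)
    then show ?thesis using Cauchy_Schwarz_ineq2[of "x + t *\<^sub>R \<xi> - c" \<xi>] d \<xi> by simp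
  qed
  define g where "g t = (t - t0) * (?s t)\<^sup>2" for t
  have tele: "(\<Sum>S\<in>A. g (?hi S) - g (?lo S)) = 0"
  proof (rule chords_telescope[OF finA chordA(1) disj])
    fix S e assume S: "S \<in> A" and e: "e \<in> {?lo S, ?hi S}"
      and only: "\<And>S'. S' \<in> A \<Longrightarrow> e \<in> {?lo S'..?hi S'} \<Longrightarrow> S' = S"
    have "single_valued (x + e *\<^sub>R \<xi>) = 0"
    proof (rule single_valued_unshared[OF gp])
      show "S \<in> \<S>" using S AS by blast
      show "x + e *\<^sub>R \<xi> \<in> S" "x + e *\<^sub>R \<xi> \<notin> interior S"
        using e chordA[OF S] by (auto simp: less_imp_le)
      fix S' assume S': "S' \<in> \<S>" "x + e *\<^sub>R \<xi> \<in> S'"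
      then have "S' \<in> A" by (auto simp: A_def)
      then show "S' = S" using only chordA(2)[of S' e] S'(2) by blast
    qed
    then show "g e = 0" by (simp add: g_def)
  qed auto
  let ?D = "\<lambda>S e. \<epsilon> / \<rho> * (diameter S * (norm (P (element_of S) (x + e *\<^sub>R \<xi>)))\<^sup>2)
     + (1 + 1 / \<epsilon>) * (\<Sum>F\<in>faces_of_element M (element_of S). jump_density (element_of S) F (x + e *\<^sub>R \<xi>))"
  have defect: "\<bar>(e - t0) * (?w S e)\<^sup>2 - g e\<bar> \<le> ?D S e" if S: "S \<in> A" and e: "e \<in> {?lo S..?hi S}" for S e
  proof -
    have "x + e *\<^sub>R \<xi> \<in> S" "S \<in> \<S>" using chordA(2)[OF S] e S AS by auto
    note d = endpoint_defect[OF gp \<xi> this(2) refl this(1) \<epsilon>]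
    have "\<bar>(e - t0) * (?w S e)\<^sup>2 - g e\<bar> = \<bar>e - t0\<bar> * \<bar>(?w S e)\<^sup>2 - (?s e)\<^sup>2\<bar>"
      by (simp add: g_def abs_mult[symmetric] right_diff_distrib)
    also have "\<dots> \<le> 1 * \<bar>(?w S e)\<^sup>2 - (?s e)\<^sup>2\<bar>" using m[OF S e] by (intro mult_right_mono) auto
    also have "\<dots> \<le> ?D S e" using d by simp
    finally show ?thesis .
  qed
  have ends: "x + ?hi S *\<^sub>R \<xi> \<in> S" "x + ?lo S *\<^sub>R \<xi> \<in> S"
    "x + ?hi S *\<^sub>R \<xi> \<notin> interior S" "x + ?lo S *\<^sub>R \<xi> \<notin> interior S" if "S \<in> A" for S
    using chordA[OF that] by (auto simp: less_imp_le)
  have inj: "inj_on ?hi A" "inj_on ?lo A" using chord_ends_inj[of A ?lo ?hi, OF chordA(1) disj] by simp_all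
  have Dsum: "(\<Sum>S\<in>A. ?D S (e S)) \<le> \<epsilon> / \<rho> * line_traces \<xi> x + (1 + 1 / \<epsilon>) * line_jumps \<xi> x"
    if "inj_on e A" "\<And>S. S \<in> A \<Longrightarrow> x + e S *\<^sub>R \<xi> \<in> S" "\<And>S. S \<in> A \<Longrightarrow> x + e S *\<^sub>R \<xi> \<notin> interior S" for e
    unfolding sum.distrib sum_distrib_left[symmetric]
    using sum_endpoint_jumps[OF gp AS that(1,2)] sum_endpoint_traces[OF gp AS that(2,3)] \<epsilon> \<rho>_pos
    by (intro add_mono mult_left_mono) auto
  have "(\<Sum>S\<in>A. integral {?lo S..?hi S} (\<lambda>t. (?w S t)\<^sup>2)) \<le>
     (\<Sum>S\<in>A. 2 * ((?hi S - t0) * (?w S (?hi S))\<^sup>2 - (?lo S - t0) * (?w S (?lo S))\<^sup>2)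
       + 4 * integral {?lo S..?hi S} (\<lambda>t. (strain (element_of S) (x + t *\<^sub>R \<xi>))\<^sup>2))"
  proof (rule sum_mono)
    fix S assume S: "S \<in> A"
    then have "element_of S \<in> elements M" using AS element_of(1) by blast
    then show "integral {?lo S..?hi S} (\<lambda>t. (?w S t)\<^sup>2) \<le> 2 * ((?hi S - t0) * (?w S (?hi S))\<^sup>2 - (?lo S - t0) * (?w S (?lo S))\<^sup>2)
       + 4 * integral {?lo S..?hi S} (\<lambda>t. (strain (element_of S) (x + t *\<^sub>R \<xi>))\<^sup>2)"
      using chordA(1)[OF S] m[OF S] by (intro interval_energy_estimate[OF strain_bounded \<xi>]) auto
  qed
  also have "\<dots> = 2 * (\<Sum>S\<in>A. (?hi S - t0) * (?w S (?hi S))\<^sup>2 - (?lo S - t0) * (?w S (?lo S))\<^sup>2)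
      + 4 * (\<Sum>S\<in>A. integral {?lo S..?hi S} (\<lambda>t. (strain (element_of S) (x + t *\<^sub>R \<xi>))\<^sup>2))"
    by (simp add: sum.distrib sum_distrib_left)
  also have "(\<Sum>S\<in>A. (?hi S - t0) * (?w S (?hi S))\<^sup>2 - (?lo S - t0) * (?w S (?lo S))\<^sup>2)
      = (\<Sum>S\<in>A. (?hi S - t0) * (?w S (?hi S))\<^sup>2 - (?lo S - t0) * (?w S (?lo S))\<^sup>2) - (\<Sum>S\<in>A. g (?hi S) - g (?lo S))"
    using tele by simp
  also have "\<dots> = (\<Sum>S\<in>A. ((?hi S - t0) * (?w S (?hi S))\<^sup>2 - g (?hi S)) - ((?lo S - t0) * (?w S (?lo S))\<^sup>2 - g (?lo S)))"
    by (simp add: sum_subtractf[symmetric] algebra_simps)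
  also have "\<dots> \<le> (\<Sum>S\<in>A. ?D S (?hi S) + ?D S (?lo S))"
  proof (rule sum_mono)
    fix S assume S: "S \<in> A"
    have "\<bar>(?hi S - t0) * (?w S (?hi S))\<^sup>2 - g (?hi S)\<bar> \<le> ?D S (?hi S)"
      "\<bar>(?lo S - t0) * (?w S (?lo S))\<^sup>2 - g (?lo S)\<bar> \<le> ?D S (?lo S)"
      by (rule defect[OF S]; use chordA(1)[OF S] in simp)+
    then show "((?hi S - t0) * (?w S (?hi S))\<^sup>2 - g (?hi S)) - ((?lo S - t0) * (?w S (?lo S))\<^sup>2 - g (?lo S))
        \<le> ?D S (?hi S) + ?D S (?lo S)" by linarith
  qed
  also have "\<dots> = (\<Sum>S\<in>A. ?D S (?hi S)) + (\<Sum>S\<in>A. ?D S (?lo S))" by (rule sum.distrib)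
  also have "\<dots> \<le> 2 * (\<epsilon> / \<rho> * line_traces \<xi> x + (1 + 1 / \<epsilon>) * line_jumps \<xi> x)"
  proof -
    have "(\<Sum>S\<in>A. ?D S (?hi S)) \<le> \<epsilon> / \<rho> * line_traces \<xi> x + (1 + 1 / \<epsilon>) * line_jumps \<xi> x"
      by (rule Dsum[OF inj(1) ends(1,3)])
    moreover have "(\<Sum>S\<in>A. ?D S (?lo S)) \<le> \<epsilon> / \<rho> * line_traces \<xi> x + (1 + 1 / \<epsilon>) * line_jumps \<xi> x"
      by (rule Dsum[OF inj(2) ends(2,4)])
    ultimately show ?thesis unfolding mult_2 by (rule add_mono)
  qed
  finally show ?thesis by (simp add: algebra_simps)
qed

end

section \<open>Integration over all lines\<close>

lemma card_facets_simplex: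
  fixes S :: "'a::euclidean_space set"
  assumes "int DIM('a) simplex S"
  shows "card {E. E facet_of S} \<le> DIM('a) + 1"
proof -
  obtain C where C: "finite C" "\<not> affine_dependent C" "card C = DIM('a) + 1" "S = convex hull C"
    by (rule simplex_vertices[OF assms])
  have sub: "{E. E facet_of S} \<subseteq> (\<lambda>u. convex hull (C - {u})) ` C"
    unfolding C(4) facet_of_convex_hull_affine_independent[OF C(2)] by blast
  have "card {E. E facet_of S} \<le> card ((\<lambda>u. convex hull (C - {u})) ` C)"
    using sub C(1) by (intro card_mono) auto
  also have "\<dots> \<le> card C" by (rule card_image_le[OF C(1)])
  finally show "card {E. E facet_of S} \<le> DIM('a) + 1" using C(3) by simp
qed

lemma nn_integral_bounded_continuous_finite:
  fixes f :: "'a::euclidean_space \<Rightarrow> real"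
  assumes "compact S" "continuous_on S f" "\<And>x. 0 \<le> f x"
  shows "(nn_integral_on S (\<lambda>x. f x)) < \<infinity>"
proof -
  have "bounded (f ` S)" by (intro compact_imp_bounded compact_continuous_image assms)
  then obtain B where B: "\<And>x. x \<in> S \<Longrightarrow> \<bar>f x\<bar> \<le> B" by (auto simp: bounded_iff)
  have "(nn_integral_on S (\<lambda>x. f x)) \<le> (\<integral>\<^sup>+x. ennreal B * indicator S x \<partial>lborel)"
    using B by (intro nn_integral_mono) (force simp: indicator_def intro!: ennreal_leI)
  also have "\<dots> = ennreal B * emeasure lborel S"
    using assms(1) by (intro nn_integral_cmult_indicator) (simp add: borel_compact)
  also have "\<dots> < \<infinity>" using emeasure_compact_finite[OF assms(1)] by (simp add: ennreal_mult_less_top)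
  finally show ?thesis .
qed

lemma ennreal_double_sum:
  assumes "\<And>i j. i \<in> A \<Longrightarrow> j \<in> B i \<Longrightarrow> 0 \<le> f i j"
  shows "ennreal (\<Sum>i\<in>A. \<Sum>j\<in>B i. f i j) = (\<Sum>i\<in>A. \<Sum>j\<in>B i. ennreal (f i j))"
proof -
  have "ennreal (\<Sum>i\<in>A. \<Sum>j\<in>B i. f i j) = (\<Sum>i\<in>A. ennreal (\<Sum>j\<in>B i. f i j))"
    by (rule sum_ennreal[symmetric]) (auto intro!: sum_nonneg assms)
  also have "\<dots> = (\<Sum>i\<in>A. \<Sum>j\<in>B i. ennreal (f i j))"
    by (intro sum.cong refl sum_ennreal[symmetric] assms)
  finally show ?thesis .
qed

text \<open>The value of \<open>\<epsilon>\<close> for which the trace term, summed over \<open>d\<close> directions and at most \<open>d + 1\<close> facets of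
  each simplex, takes up one half of the energy.\<close>

definition absorption_parameter :: "nat \<Rightarrow> real \<Rightarrow> real" where
  "absorption_parameter d \<rho> = \<rho> / (8 * real d * (real d + 1) * trace_constant d \<rho>)"

definition korn_constant :: "nat \<Rightarrow> real \<Rightarrow> real" where
  "korn_constant d \<rho> = 8 * real d + 1 + 8 * real d * (1 + 1 / absorption_parameter d \<rho>)"

context hybrid_field
begin

definition field_energy :: ennreal where
  "field_energy = (\<Sum>S\<in>\<S>. nn_integral_on S (\<lambda>x. (norm (P (element_of S) x))\<^sup>2))"

definition strain_energy :: ennreal where
  "strain_energy = (\<Sum>S\<in>\<S>. nn_integral_on S (\<lambda>x. (strain (element_of S) x)\<^sup>2))"

definition jump_energy :: ennreal where
  "jump_energy = (\<Sum>T\<in>elements M. \<Sum>F\<in>faces_of_element M T. \<integral>\<^sup>+x. ennreal (jump_density T F x) \<partial>face_measure F)"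

lemma simplex_borel [measurable]: "S \<in> \<S> \<Longrightarrow> S \<in> sets borel"
  by (intro borel_closed closed_simplex[OF simplex])

lemma facet_borel [measurable]: "S \<in> \<S> \<Longrightarrow> E facet_of S \<Longrightarrow> E \<in> sets borel"
  using closed_simplex[OF simplex] convex_simplex[OF simplex]
  by (meson facet_of_imp_face_of face_of_imp_closed borel_closed)

lemma P_borel [measurable]: "T \<in> elements M \<Longrightarrow> P T \<in> borel_measurable borel"
  and strain_borel [measurable]: "T \<in> elements M \<Longrightarrow> strain T \<in> borel_measurable borel"
  using strain_bounded_continuous(4,5)[OF strain_bounded] by auto

lemma Q_borel [measurable]: "F \<in> faces M \<Longrightarrow> Q F \<in> borel_measurable borel"
  using continuous_face_field by (rule borel_measurable_continuous_onI)

lemma jump_density_borel [measurable]: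
  assumes "T \<in> elements M" "F \<in> faces M"
  shows "jump_density T F \<in> borel_measurable borel"
proof -
  note [measurable] = face_borel[OF assms(2)] P_borel[OF assms(1)] Q_borel[OF assms(2)]
  show ?thesis unfolding jump_density_def by measurable
qed

lemma slab_crossing_le:
  fixes X :: "(real^'n) set"
  assumes X: "aff_dim X = int DIM(real^'n) - 1" and tr: "transversal \<xi> X" and \<xi>: "norm \<xi> = 1"
    and g: "g \<in> borel_measurable borel"
  shows "(\<integral>\<^sup>+x. indicator (slab \<xi>) x * g (crossing \<xi> X x) \<partial>lborel) \<le> (\<integral>\<^sup>+x. g x \<partial>face_measure X)"
  unfolding unit_normal(2)[OF X] crossing_def
  using nn_integral_slab_crossing[OF \<xi> unit_normal(1)[OF X] _ g] tr by (simp add: transversal_def)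

lemma crossing_borel [measurable]: "crossing \<xi> X \<in> borel_measurable borel"
  unfolding crossing_def crossing_time_def by measurable

lemma line_integral_chords:
  assumes gp: "generic_point \<xi> x" and \<xi>: "\<xi> \<noteq> 0"
    and cont: "\<And>S. S \<in> \<S> \<Longrightarrow> continuous_on UNIV (h S)" and nonneg: "\<And>S y. S \<in> \<S> \<Longrightarrow> 0 \<le> h S y"
  shows "(\<integral>\<^sup>+t. (\<Sum>S\<in>\<S>. indicator S (x + t *\<^sub>R \<xi>) * ennreal (h S (x + t *\<^sub>R \<xi>))) \<partial>lborel)
    = ennreal (\<Sum>S\<in>{S \<in> \<S>. \<exists>t. x + t *\<^sub>R \<xi> \<in> S}. integral (chord_interval \<xi> x S) (\<lambda>t. h S (x + t *\<^sub>R \<xi>)))"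
proof -
  let ?A = "{S \<in> \<S>. \<exists>t. x + t *\<^sub>R \<xi> \<in> S}"
  note [measurable] = borel_measurable_continuous_onI[OF cont]
  have cont': "continuous_on X (\<lambda>t. h S (x + t *\<^sub>R \<xi>))" if "S \<in> \<S>" for X S
    by (rule continuous_on_compose2[OF cont[OF that]]) (auto intro!: continuous_intros)
  have "(\<integral>\<^sup>+t. (\<Sum>S\<in>\<S>. indicator S (x + t *\<^sub>R \<xi>) * ennreal (h S (x + t *\<^sub>R \<xi>))) \<partial>lborel)
    = (\<Sum>S\<in>\<S>. \<integral>\<^sup>+t. indicator S (x + t *\<^sub>R \<xi>) * ennreal (h S (x + t *\<^sub>R \<xi>)) \<partial>lborel)"
    by (rule nn_integral_sum) measurable
  also have "\<dots> = (\<Sum>S\<in>?A. \<integral>\<^sup>+t. indicator S (x + t *\<^sub>R \<xi>) * ennreal (h S (x + t *\<^sub>R \<xi>)) \<partial>lborel)"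
  proof (rule sum.mono_neutral_right[OF finite_submesh], blast, rule ballI)
    fix S assume "S \<in> \<S> - ?A"
    then have "x + t *\<^sub>R \<xi> \<notin> S" for t by blast
    then show "(\<integral>\<^sup>+t. indicator S (x + t *\<^sub>R \<xi>) * ennreal (h S (x + t *\<^sub>R \<xi>)) \<partial>lborel) = 0" by simp
  qed
  also have "\<dots> = (\<Sum>S\<in>?A. ennreal (integral (chord_interval \<xi> x S) (\<lambda>t. h S (x + t *\<^sub>R \<xi>))))"
  proof (rule sum.cong[OF refl])
    fix S assume S: "S \<in> ?A"
    then obtain t0 where t0: "x + t0 *\<^sub>R \<xi> \<in> S" and SS: "S \<in> \<S>" by blast
    have "in_general_position \<xi> x S" using gp SS by (simp add: generic_point_def)
    note ch = chord(2)[OF simplex[OF SS] this \<xi> t0]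
    have "(\<integral>\<^sup>+t. indicator S (x + t *\<^sub>R \<xi>) * ennreal (h S (x + t *\<^sub>R \<xi>)) \<partial>lborel)
       = (\<integral>\<^sup>+t. indicator (chord_interval \<xi> x S) t * ennreal (h S (x + t *\<^sub>R \<xi>)) \<partial>lborel)"
      using ch by (intro nn_integral_cong arg_cong2[where f="(*)"] refl) (simp only: indicator_def)
    also have "\<dots> = ennreal (integral (chord_interval \<xi> x S) (\<lambda>t. h S (x + t *\<^sub>R \<xi>)))"
      by (rule nn_integral_Icc_continuous[OF cont'[OF SS] nonneg[OF SS]])
    finally show "(\<integral>\<^sup>+t. indicator S (x + t *\<^sub>R \<xi>) * ennreal (h S (x + t *\<^sub>R \<xi>)) \<partial>lborel)
       = ennreal (integral (chord_interval \<xi> x S) (\<lambda>t. h S (x + t *\<^sub>R \<xi>)))" .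
  qed
  also have "\<dots> = ennreal (\<Sum>S\<in>?A. integral (chord_interval \<xi> x S) (\<lambda>t. h S (x + t *\<^sub>R \<xi>)))"
    using nonneg cont' by (intro sum_ennreal integral_nonneg integrable_continuous_real) auto
  finally show ?thesis .
qed

lemma slab_line_jumps:
  assumes \<xi>: "norm \<xi> = 1"
  shows "(\<integral>\<^sup>+x. indicator (slab \<xi>) x * ennreal (line_jumps \<xi> x) \<partial>lborel) \<le> jump_energy"
proof -
  let ?I = "\<lambda>x. indicator (slab \<xi>) x :: ennreal"
  let ?F = "\<lambda>T. {F \<in> faces_of_element M T. transversal \<xi> F}"
  have [measurable]: "slab (\<xi>::real^'n) \<in> sets borel" by measurable
  have [measurable]: "jump_density T F \<in> borel_measurable borel" if "T \<in> elements M" "F \<in> ?F T" for T F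
    using that by (intro jump_density_borel) (auto simp: faces_of_element_def)
  have "(\<integral>\<^sup>+x. ?I x * ennreal (line_jumps \<xi> x) \<partial>lborel)
     = (\<integral>\<^sup>+x. (\<Sum>T\<in>elements M. \<Sum>F\<in>?F T. ?I x * ennreal (jump_density T F (crossing \<xi> F x))) \<partial>lborel)"
  proof (rule nn_integral_cong)
    fix x
    have "ennreal (line_jumps \<xi> x) = (\<Sum>T\<in>elements M. \<Sum>F\<in>?F T. ennreal (jump_density T F (crossing \<xi> F x)))"
      unfolding line_jumps_def by (rule ennreal_double_sum) (auto intro: jump_density_nonneg)
    then show "?I x * ennreal (line_jumps \<xi> x)
        = (\<Sum>T\<in>elements M. \<Sum>F\<in>?F T. ?I x * ennreal (jump_density T F (crossing \<xi> F x)))"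
      by (simp only: sum_distrib_left)
  qed
  also have "\<dots> = (\<Sum>T\<in>elements M. \<Sum>F\<in>?F T. \<integral>\<^sup>+x. ?I x * ennreal (jump_density T F (crossing \<xi> F x)) \<partial>lborel)"
    by (subst nn_integral_sum, measurable, intro sum.cong refl nn_integral_sum) measurable
  also have "\<dots> \<le> (\<Sum>T\<in>elements M. \<Sum>F\<in>?F T. \<integral>\<^sup>+x. ennreal (jump_density T F x) \<partial>face_measure F)"
  proof (intro sum_mono)
    fix T F assume T: "T \<in> elements M" and F: "F \<in> ?F T"
    then have F': "F \<in> faces M" "transversal \<xi> F" by (auto simp: faces_of_element_def)
    note [measurable] = jump_density_borel[OF T F'(1)]
    show "(\<integral>\<^sup>+x. ?I x * ennreal (jump_density T F (crossing \<xi> F x)) \<partial>lborel)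
       \<le> (\<integral>\<^sup>+x. ennreal (jump_density T F x) \<partial>face_measure F)"
      by (rule slab_crossing_le[OF face_aff_dim[OF F'(1)] F'(2) \<xi>, of "\<lambda>x. ennreal (jump_density T F x)"]) measurable
  qed
  also have "\<dots> \<le> jump_energy"
    unfolding jump_energy_def by (intro sum_mono sum_mono2 finite_faces_of_element) auto
  finally show ?thesis .
qed

text \<open>The facet carries the measure of its affine hull, and \<open>diameter S \<le> 1\<close> removes the factor in front of
  the strain in the trace inequality.\<close>

lemma facet_trace_le:
  assumes S: "S \<in> \<S>" and E: "E facet_of S"
  shows "(\<integral>\<^sup>+x. ennreal (diameter S * (indicator E x * (norm (P (element_of S) x))\<^sup>2)) \<partial>face_measure E)
     \<le> ennreal (trace_constant CARD('n) \<rho>) *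
       ((nn_integral_on S (\<lambda>x. (norm (P (element_of S) x))\<^sup>2))
        + (nn_integral_on S (\<lambda>x. (strain (element_of S) x)\<^sup>2)))"
proof -
  let ?T = "element_of S" and ?h = "diameter S"
  have T: "?T \<in> elements M" by (rule element_of(1)[OF S])
  note [measurable] = P_borel[OF T] strain_borel[OF T] facet_borel[OF S E] simplex_borel[OF S]
  have h: "0 < ?h" "?h \<le> 1" using simplex_diameter_pos[OF simplex[OF S]] simplex_diameter_le_1[OF S] by auto
  have ad: "aff_dim E = int DIM(real^'n) - 1" by (rule facet_aff_dim[OF simplex[OF S] E])
  have "(\<integral>\<^sup>+x. ennreal (?h * (indicator E x * (norm (P ?T x))\<^sup>2)) \<partial>face_measure E)
     = (\<integral>\<^sup>+x. ennreal ?h * (indicator E x * ennreal ((norm (P ?T x))\<^sup>2)) \<partial>face_measure E)"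
    using h by (intro nn_integral_cong) (auto simp: indicator_def ennreal_mult)
  also have "\<dots> = ennreal ?h * (\<integral>\<^sup>+x. indicator E x * ennreal ((norm (P ?T x))\<^sup>2) \<partial>face_measure E)"
    by (rule nn_integral_cmult) measurable
  also have "\<dots> \<le> ennreal (trace_constant DIM(real^'n) \<rho>) *
       (nn_integral_on S (\<lambda>x. (norm (P ?T x))\<^sup>2 + ?h\<^sup>2 * (strain ?T x)\<^sup>2))"
    unfolding unit_normal(2)[OF ad]
    by (rule simplex_trace_inequality[OF simplex[OF S] E \<rho>_pos simplex_inradius[OF S] unit_normal[OF ad] strain_bounded[OF T]])
  also have "(nn_integral_on S (\<lambda>x. (norm (P ?T x))\<^sup>2 + ?h\<^sup>2 * (strain ?T x)\<^sup>2))
    \<le> (\<integral>\<^sup>+x. indicator S x * ennreal ((norm (P ?T x))\<^sup>2) + indicator S x * ennreal ((strain ?T x)\<^sup>2) \<partial>lborel)"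
  proof (rule nn_integral_mono)
    fix x
    have "?h\<^sup>2 * (strain ?T x)\<^sup>2 \<le> 1 * (strain ?T x)\<^sup>2"
      using h by (intro mult_right_mono) (auto simp: power_le_one)
    then have "ennreal ((norm (P ?T x))\<^sup>2 + ?h\<^sup>2 * (strain ?T x)\<^sup>2) \<le> ennreal ((norm (P ?T x))\<^sup>2) + ennreal ((strain ?T x)\<^sup>2)"
      by (subst ennreal_plus[symmetric]) (auto intro!: ennreal_leI)
    then show "indicator S x * ennreal ((norm (P ?T x))\<^sup>2 + ?h\<^sup>2 * (strain ?T x)\<^sup>2)
       \<le> indicator S x * ennreal ((norm (P ?T x))\<^sup>2) + indicator S x * ennreal ((strain ?T x)\<^sup>2)"
      by (auto simp: indicator_def)
  qed
  also have "\<dots> = (nn_integral_on S (\<lambda>x. (norm (P ?T x))\<^sup>2))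
     + (nn_integral_on S (\<lambda>x. (strain ?T x)\<^sup>2))"
    by (rule nn_integral_add) measurable
  finally show ?thesis by (simp add: mult_left_mono)
qed

lemma slab_line_traces:
  assumes \<xi>: "norm \<xi> = 1"
  shows "(\<integral>\<^sup>+x. indicator (slab \<xi>) x * ennreal (line_traces \<xi> x) \<partial>lborel)
    \<le> ennreal ((real CARD('n) + 1) * trace_constant CARD('n) \<rho>) * (field_energy + strain_energy)"
proof -
  let ?I = "\<lambda>x. indicator (slab \<xi>) x :: ennreal"
  let ?E = "\<lambda>S. {E. E facet_of S \<and> transversal \<xi> E}"
  let ?g = "\<lambda>S E x. diameter S * (indicator E x * (norm (P (element_of S) x))\<^sup>2)"
  let ?c = "ennreal (trace_constant CARD('n) \<rho>)"
  let ?V = "\<lambda>S. (nn_integral_on S (\<lambda>x. (norm (P (element_of S) x))\<^sup>2))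
        + (nn_integral_on S (\<lambda>x. (strain (element_of S) x)\<^sup>2))"
  have [measurable]: "slab (\<xi>::real^'n) \<in> sets borel" by measurable
  have g_meas [measurable]: "?g S E \<in> borel_measurable borel" if "S \<in> \<S>" "E \<in> ?E S" for S E
  proof -
    note [measurable] = P_borel[OF element_of(1)[OF that(1)]]
    have [measurable]: "E \<in> sets borel" using facet_borel that by blast
    show ?thesis by measurable
  qed
  have g_nonneg: "0 \<le> ?g S E x" if "S \<in> \<S>" for S E x
    using simplex_diameter_pos[OF simplex[OF that]] by simp
  have "(\<integral>\<^sup>+x. ?I x * ennreal (line_traces \<xi> x) \<partial>lborel)
     = (\<integral>\<^sup>+x. (\<Sum>S\<in>\<S>. \<Sum>E\<in>?E S. ?I x * ennreal (?g S E (crossing \<xi> E x))) \<partial>lborel)"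
  proof (rule nn_integral_cong)
    fix x
    have "ennreal (line_traces \<xi> x) = (\<Sum>S\<in>\<S>. \<Sum>E\<in>?E S. ennreal (?g S E (crossing \<xi> E x)))"
      unfolding line_traces_def by (rule ennreal_double_sum) (rule g_nonneg)
    then show "?I x * ennreal (line_traces \<xi> x) = (\<Sum>S\<in>\<S>. \<Sum>E\<in>?E S. ?I x * ennreal (?g S E (crossing \<xi> E x)))"
      by (simp only: sum_distrib_left)
  qed
  also have "\<dots> = (\<Sum>S\<in>\<S>. \<Sum>E\<in>?E S. \<integral>\<^sup>+x. ?I x * ennreal (?g S E (crossing \<xi> E x)) \<partial>lborel)"
  proof -
    have m: "(\<lambda>x. ?I x * ennreal (?g S E (crossing \<xi> E x))) \<in> borel_measurable lborel" if "S \<in> \<S>" "E \<in> ?E S" for S E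
      using measurable_compose[OF crossing_borel g_meas[OF that]] by measurable
    show ?thesis
      by (subst nn_integral_sum) (auto intro!: borel_measurable_sum m sum.cong nn_integral_sum)
  qed
  also have "\<dots> \<le> (\<Sum>S\<in>\<S>. \<Sum>E\<in>?E S. ?c * ?V S)"
  proof (intro sum_mono)
    fix S E assume S: "S \<in> \<S>" and E: "E \<in> ?E S"
    note [measurable] = g_meas[OF S E]
    have "(\<integral>\<^sup>+x. ?I x * ennreal (?g S E (crossing \<xi> E x)) \<partial>lborel) \<le> (\<integral>\<^sup>+x. ennreal (?g S E x) \<partial>face_measure E)"
      using E by (intro slab_crossing_le[OF facet_aff_dim[OF simplex[OF S]] _ \<xi>, of E "\<lambda>x. ennreal (?g S E x)"]
          measurable_compose[OF g_meas[OF S E] measurable_ennreal]) auto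
    also have "\<dots> \<le> ?c * ?V S" using facet_trace_le[OF S] E by blast
    finally show "(\<integral>\<^sup>+x. ?I x * ennreal (?g S E (crossing \<xi> E x)) \<partial>lborel) \<le> ?c * ?V S" .
  qed
  also have "\<dots> \<le> (\<Sum>S\<in>\<S>. ennreal (real CARD('n) + 1) * (?c * ?V S))"
  proof (rule sum_mono)
    fix S assume S: "S \<in> \<S>"
    have "card (?E S) \<le> card {E. E facet_of S}"
      using finite_facets[OF S] by (intro card_mono) auto
    also have "\<dots> \<le> CARD('n) + 1" using card_facets_simplex[OF simplex[OF S]] by simp
    finally have "real (card (?E S)) \<le> real CARD('n) + 1" by linarith
    then have "ennreal (real (card (?E S))) * (?c * ?V S) \<le> ennreal (real CARD('n) + 1) * (?c * ?V S)"
      by (intro mult_right_mono ennreal_leI) auto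
    then show "(\<Sum>E\<in>?E S. ?c * ?V S) \<le> ennreal (real CARD('n) + 1) * (?c * ?V S)"
      by (simp add: ennreal_of_nat_eq_real_of_nat)
  qed
  also have "\<dots> = ennreal (real CARD('n) + 1) * (?c * (\<Sum>S\<in>\<S>. ?V S))" by (simp only: sum_distrib_left)
  also have "\<dots> = ennreal ((real CARD('n) + 1) * trace_constant CARD('n) \<rho>) * (field_energy + strain_energy)"
    using \<rho>_pos
    by (subst ennreal_mult) (auto simp: field_energy_def strain_energy_def sum.distrib mult.assoc trace_constant_def)
  finally show ?thesis .
qed

text \<open>Almost every line is generic; integrate \<open>line_energy_estimate\<close> over the space of lines of direction
  \<open>\<xi>\<close>, represented by the slab.\<close>

lemma directional_energy_estimate:
  assumes \<xi>: "norm \<xi> = 1" and \<epsilon>: "0 < \<epsilon>"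
  shows "(\<Sum>S\<in>\<S>. nn_integral_on S (\<lambda>x. (P (element_of S) x \<bullet> \<xi>)\<^sup>2))
    \<le> 4 * strain_energy
      + ennreal (4 * (\<epsilon> / \<rho>)) * (ennreal ((real CARD('n) + 1) * trace_constant CARD('n) \<rho>) * (field_energy + strain_energy))
      + ennreal (4 * (1 + 1 / \<epsilon>)) * jump_energy"
proof -
  let ?I = "\<lambda>x. indicator (slab \<xi>) x :: ennreal"
  define f where "f x = (\<Sum>S\<in>\<S>. indicator S x * ennreal ((P (element_of S) x \<bullet> \<xi>)\<^sup>2))" for x
  define g where "g x = (\<Sum>S\<in>\<S>. indicator S x * ennreal ((strain (element_of S) x)\<^sup>2))" for x
  have \<xi>0: "\<xi> \<noteq> 0" using \<xi> by auto
  note [measurable] = P_borel[OF element_of(1)] strain_borel[OF element_of(1)] simplex_borel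
  have mI [measurable]: "slab (\<xi>::real^'n) \<in> sets borel" by measurable
  have fm [measurable]: "f \<in> borel_measurable borel" unfolding f_def by measurable
  have gm [measurable]: "g \<in> borel_measurable borel" unfolding g_def by measurable
  have jm [measurable]: "line_jumps \<xi> \<in> borel_measurable borel"
  proof -
    have "(\<lambda>x. jump_density T F (crossing \<xi> F x)) \<in> borel_measurable borel"
      if "T \<in> elements M" "F \<in> faces_of_element M T" for T F
      using that by (intro measurable_compose[OF crossing_borel jump_density_borel]) (auto simp: faces_of_element_def)
    then show ?thesis unfolding line_jumps_def[abs_def] by (intro borel_measurable_sum) auto
  qed
  have tm [measurable]: "line_traces \<xi> \<in> borel_measurable borel"
  proof -
    have "(\<lambda>x. diameter S * (indicator E (crossing \<xi> E x) * (norm (P (element_of S) (crossing \<xi> E x)))\<^sup>2)) \<in> borel_measurable borel"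
      if "S \<in> \<S>" "E facet_of S" for S E
    proof -
      note [measurable] = P_borel[OF element_of(1)[OF that(1)]] facet_borel[OF that]
      have "(\<lambda>y. diameter S * (indicator E y * (norm (P (element_of S) y))\<^sup>2)) \<in> borel_measurable borel" by measurable
      from measurable_compose[OF crossing_borel this] show ?thesis .
    qed
    then show ?thesis unfolding line_traces_def[abs_def] by (intro borel_measurable_sum) auto
  qed
  have line: "(\<integral>\<^sup>+t. f (x + t *\<^sub>R \<xi>) \<partial>lborel) \<le> 4 * (\<integral>\<^sup>+t. g (x + t *\<^sub>R \<xi>) \<partial>lborel)
      + ennreal (4 * (\<epsilon> / \<rho>)) * ennreal (line_traces \<xi> x) + ennreal (4 * (1 + 1 / \<epsilon>)) * ennreal (line_jumps \<xi> x)"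
    if gp: "generic_point \<xi> x" for x
  proof -
    let ?A = "{S \<in> \<S>. \<exists>t. x + t *\<^sub>R \<xi> \<in> S}"
    let ?int = "\<lambda>h. \<Sum>S\<in>?A. integral (chord_interval \<xi> x S) (\<lambda>t. h S (x + t *\<^sub>R \<xi>))"
    let ?fS = "\<lambda>S y. (P (element_of S) y \<bullet> \<xi>)\<^sup>2" and ?gS = "\<lambda>S y. (strain (element_of S) y)\<^sup>2"
    have cf: "continuous_on X (?fS S)" and cg: "continuous_on X (?gS S)" if "S \<in> \<S>" for S X
      using strain_bounded_continuous(1,2)[OF strain_bounded[OF element_of(1)[OF that]]]
      by (intro continuous_intros; blast)+
    have cg': "continuous_on X (\<lambda>t. ?gS S (x + t *\<^sub>R \<xi>))" if "S \<in> \<S>" for X S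
      by (rule continuous_on_compose2[OF cg[OF that, of UNIV]]) (auto intro!: continuous_intros)
    have int_nonneg: "0 \<le> ?int ?gS"
      using cg' by (intro sum_nonneg integral_nonneg integrable_continuous_real) auto
    have nonneg: "0 \<le> line_traces \<xi> x" "0 \<le> line_jumps \<xi> x"
      using simplex_diameter_pos[OF simplex] unfolding line_traces_def line_jumps_def
      by (auto intro!: sum_nonneg jump_density_nonneg simp: less_imp_le)
    have "(\<integral>\<^sup>+t. f (x + t *\<^sub>R \<xi>) \<partial>lborel) = ennreal (?int ?fS)"
      unfolding f_def by (rule line_integral_chords[OF gp \<xi>0]) (auto intro: cf)
    also have "\<dots> \<le> ennreal (4 * ?int ?gS + 4 * (\<epsilon> / \<rho>) * line_traces \<xi> x + 4 * (1 + 1 / \<epsilon>) * line_jumps \<xi> x)"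
      by (intro ennreal_leI line_energy_estimate gp \<xi> \<epsilon>)
    also have "\<dots> = 4 * ennreal (?int ?gS) + ennreal (4 * (\<epsilon> / \<rho>)) * ennreal (line_traces \<xi> x)
        + ennreal (4 * (1 + 1 / \<epsilon>)) * ennreal (line_jumps \<xi> x)"
    proof -
      have "ennreal (4 * a + b * c + d * e) = 4 * ennreal a + ennreal b * ennreal c + ennreal d * ennreal e"
        if "0 \<le> a" "0 \<le> b" "0 \<le> c" "0 \<le> d" "0 \<le> e" for a b c d e
        using that by (simp add: ennreal_mult)
      then show ?thesis by this (use int_nonneg nonneg \<epsilon> \<rho>_pos in auto)
    qed
    also have "ennreal (?int ?gS) = (\<integral>\<^sup>+t. g (x + t *\<^sub>R \<xi>) \<partial>lborel)"
      unfolding g_def by (rule line_integral_chords[OF gp \<xi>0, symmetric]) (auto intro: cg)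
    finally show ?thesis .
  qed
  have "(\<Sum>S\<in>\<S>. nn_integral_on S (\<lambda>x. (P (element_of S) x \<bullet> \<xi>)\<^sup>2)) = (\<integral>\<^sup>+x. f x \<partial>lborel)"
    unfolding f_def by (rule nn_integral_sum[symmetric]) measurable
  also have "\<dots> = (\<integral>\<^sup>+x. ?I x * (\<integral>\<^sup>+t. f (x + t *\<^sub>R \<xi>) \<partial>lborel) \<partial>lborel)"
    by (rule nn_integral_slab_lines[OF \<xi> fm, symmetric])
  also have "\<dots> \<le> (\<integral>\<^sup>+x. 4 * (?I x * (\<integral>\<^sup>+t. g (x + t *\<^sub>R \<xi>) \<partial>lborel))
      + ennreal (4 * (\<epsilon> / \<rho>)) * (?I x * ennreal (line_traces \<xi> x))
      + ennreal (4 * (1 + 1 / \<epsilon>)) * (?I x * ennreal (line_jumps \<xi> x)) \<partial>lborel)"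
    by (rule nn_integral_mono_AE, rule AE_mp[OF AE_generic_point[of \<xi>]], rule AE_I2, rule impI)
      (use line in \<open>auto simp: indicator_def\<close>)
  also have "\<dots> = 4 * (\<integral>\<^sup>+x. ?I x * (\<integral>\<^sup>+t. g (x + t *\<^sub>R \<xi>) \<partial>lborel) \<partial>lborel)
      + ennreal (4 * (\<epsilon> / \<rho>)) * (\<integral>\<^sup>+x. ?I x * ennreal (line_traces \<xi> x) \<partial>lborel)
      + ennreal (4 * (1 + 1 / \<epsilon>)) * (\<integral>\<^sup>+x. ?I x * ennreal (line_jumps \<xi> x) \<partial>lborel)"
    by (simp add: nn_integral_add nn_integral_cmult)
  also have "(\<integral>\<^sup>+x. ?I x * (\<integral>\<^sup>+t. g (x + t *\<^sub>R \<xi>) \<partial>lborel) \<partial>lborel) = (\<integral>\<^sup>+x. g x \<partial>lborel)"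
    by (rule nn_integral_slab_lines[OF \<xi> gm])
  also have "(\<integral>\<^sup>+x. g x \<partial>lborel) = strain_energy"
    unfolding g_def strain_energy_def by (rule nn_integral_sum) measurable
  finally show ?thesis
    using slab_line_traces[OF \<xi>] slab_line_jumps[OF \<xi>]
    by (elim order_trans) (intro add_mono mult_left_mono order_refl; simp)
qed

lemma field_energy_finite: "field_energy < \<infinity>"
proof -
  have "(nn_integral_on S (\<lambda>x. (norm (P (element_of S) x))\<^sup>2)) < \<infinity>"
    if S: "S \<in> \<S>" for S
    using strain_bounded_continuous(1)[OF strain_bounded[OF element_of(1)[OF S]]]
    by (intro nn_integral_bounded_continuous_finite compact_simplex[OF simplex[OF S]] continuous_intros) auto
  then show ?thesis unfolding field_energy_def using finite_submesh by simp
qed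

text \<open>Sum over an orthonormal basis of directions \<open>\<xi>\<close> and absorb; the absorption is legitimate because the
  energy of a continuous field on a bounded domain is finite.\<close>

theorem broken_korn_energy:
  "field_energy \<le> ennreal (korn_constant CARD('n) \<rho>) * (strain_energy + jump_energy)"
proof -
  let ?d = "real CARD('n)" and ?c = "trace_constant CARD('n) \<rho>"
  define \<epsilon> where "\<epsilon> = absorption_parameter CARD('n) \<rho>"
  have c: "0 < ?c" using \<rho>_pos by (simp add: trace_constant_def add_pos_pos)
  have \<epsilon>: "0 < \<epsilon>" using c \<rho>_pos by (simp add: \<epsilon>_def absorption_parameter_def)
  have absorb: "?d * (4 * (\<epsilon> / \<rho>) * ((?d + 1) * ?c)) = 1 / 2"
    using c \<rho>_pos by (simp add: \<epsilon>_def absorption_parameter_def divide_simps)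
  note [measurable] = P_borel[OF element_of(1)] simplex_borel
  have "field_energy = (\<Sum>S\<in>\<S>. \<Sum>\<xi>\<in>Basis. nn_integral_on S (\<lambda>x. (P (element_of S) x \<bullet> \<xi>)\<^sup>2))"
    unfolding field_energy_def
  proof (rule sum.cong[OF refl])
    fix S assume S: "S \<in> \<S>"
    have "(nn_integral_on S (\<lambda>x. (norm (P (element_of S) x))\<^sup>2))
      = (\<integral>\<^sup>+x. (\<Sum>\<xi>\<in>Basis. indicator S x * ennreal ((P (element_of S) x \<bullet> \<xi>)\<^sup>2)) \<partial>lborel)"
    proof (rule nn_integral_cong)
      fix x
      have "(norm (P (element_of S) x))\<^sup>2 = (\<Sum>\<xi>\<in>Basis. (P (element_of S) x \<bullet> \<xi>)\<^sup>2)"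
        unfolding power2_norm_eq_inner by (subst euclidean_inner) (simp add: power2_eq_square)
      then show "indicator S x * ennreal ((norm (P (element_of S) x))\<^sup>2)
          = (\<Sum>\<xi>\<in>Basis. indicator S x * ennreal ((P (element_of S) x \<bullet> \<xi>)\<^sup>2))"
        by (simp add: sum_distrib_left[symmetric])
    qed
    also have "\<dots> = (\<Sum>\<xi>\<in>Basis. nn_integral_on S (\<lambda>x. (P (element_of S) x \<bullet> \<xi>)\<^sup>2))"
      using S by (intro nn_integral_sum) measurable
    finally show "(nn_integral_on S (\<lambda>x. (norm (P (element_of S) x))\<^sup>2))
      = (\<Sum>\<xi>\<in>Basis. nn_integral_on S (\<lambda>x. (P (element_of S) x \<bullet> \<xi>)\<^sup>2))" .
  qed
  also have "\<dots> = (\<Sum>\<xi>\<in>Basis. \<Sum>S\<in>\<S>. nn_integral_on S (\<lambda>x. (P (element_of S) x \<bullet> \<xi>)\<^sup>2))"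
    by (rule sum.swap)
  also have "\<dots> \<le> (\<Sum>\<xi>\<in>(Basis :: (real^'n) set). 4 * strain_energy
      + ennreal (4 * (\<epsilon> / \<rho>)) * (ennreal ((?d + 1) * ?c) * (field_energy + strain_energy))
      + ennreal (4 * (1 + 1 / \<epsilon>)) * jump_energy)"
    by (intro sum_mono directional_energy_estimate \<epsilon>) auto
  also have "\<dots> = ennreal ?d * (4 * strain_energy
      + ennreal (4 * (\<epsilon> / \<rho>)) * (ennreal ((?d + 1) * ?c) * (field_energy + strain_energy))
      + ennreal (4 * (1 + 1 / \<epsilon>)) * jump_energy)"
    by (simp add: ennreal_of_nat_eq_real_of_nat)
  finally have main: "field_energy \<le> \<dots>" .
  show ?thesis
  proof (cases "strain_energy = \<infinity> \<or> jump_energy = \<infinity>")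
    case True
    have "0 < korn_constant CARD('n) \<rho>"
      unfolding korn_constant_def \<epsilon>_def[symmetric] using \<epsilon> by (intro add_nonneg_pos add_pos_nonneg) auto
    then have "ennreal (korn_constant CARD('n) \<rho>) * (strain_energy + jump_energy) = \<infinity>"
      using True by (auto simp: ennreal_mult_eq_top_iff)
    then show ?thesis by simp
  next
    case False
    obtain V where V: "field_energy = ennreal V" "0 \<le> V"
      using field_energy_finite by (cases field_energy) auto
    obtain N where N: "strain_energy = ennreal N" "0 \<le> N"
      using False by (cases strain_energy) auto
    obtain J where J: "jump_energy = ennreal J" "0 \<le> J"
      using False by (cases jump_energy) auto
    have pos: "0 \<le> 4 * (\<epsilon> / \<rho>)" "0 \<le> (?d + 1) * ?c" "0 \<le> 4 * (1 + 1 / \<epsilon>)"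
      using \<epsilon> \<rho>_pos c by auto
    have "ennreal ?d * (4 * strain_energy
      + ennreal (4 * (\<epsilon> / \<rho>)) * (ennreal ((?d + 1) * ?c) * (field_energy + strain_energy))
      + ennreal (4 * (1 + 1 / \<epsilon>)) * jump_energy)
      = ennreal (?d * (4 * N + 4 * (\<epsilon> / \<rho>) * ((?d + 1) * ?c * (V + N)) + 4 * (1 + 1 / \<epsilon>) * J))"
    proof -
      have "ennreal a * (4 * ennreal n + ennreal b * (ennreal e * (ennreal v + ennreal n)) + ennreal f * ennreal j)
        = ennreal (a * (4 * n + b * (e * (v + n)) + f * j))"
        if "0 \<le> a" "0 \<le> b" "0 \<le> e" "0 \<le> f" "0 \<le> n" "0 \<le> v" "0 \<le> j" for a b e f n v j
        using that by (simp add: ennreal_mult)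
      then show ?thesis unfolding V(1) N(1) J(1) using pos V N J by simp
    qed
    with main have "ennreal V \<le> \<dots>" using V(1) by simp
    moreover have "0 \<le> ?d * (4 * N + 4 * (\<epsilon> / \<rho>) * ((?d + 1) * ?c * (V + N)) + 4 * (1 + 1 / \<epsilon>) * J)"
      by (intro mult_nonneg_nonneg add_nonneg_nonneg) (use pos V N J c less_imp_le[OF \<epsilon>] \<rho>_pos in auto)
    ultimately have "V \<le> ?d * (4 * N + 4 * (\<epsilon> / \<rho>) * ((?d + 1) * ?c * (V + N)) + 4 * (1 + 1 / \<epsilon>) * J)"
      by simp
    also have "\<dots> = 4 * ?d * N + (?d * (4 * (\<epsilon> / \<rho>) * ((?d + 1) * ?c))) * (V + N) + 4 * ?d * (1 + 1 / \<epsilon>) * J"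
      by (simp only: distrib_left mult_ac)
    finally have "V \<le> 4 * ?d * N + 1 / 2 * (V + N) + 4 * ?d * (1 + 1 / \<epsilon>) * J"
      unfolding absorb .
    moreover have "v \<le> 2 * a + n + 2 * b" if "v \<le> a + 1 / 2 * (v + n) + b" for a b n v :: real
      using that by (simp add: field_simps)
    ultimately have "V \<le> 2 * (4 * ?d * N) + N + 2 * (4 * ?d * (1 + 1 / \<epsilon>) * J)" by blast
    also have "\<dots> = (8 * ?d + 1) * N + 8 * ?d * (1 + 1 / \<epsilon>) * J" by (simp add: algebra_simps)
    also have "\<dots> \<le> korn_constant CARD('n) \<rho> * N + korn_constant CARD('n) \<rho> * J"
    proof (intro add_mono[OF mult_right_mono mult_right_mono] N J)
      show "8 * ?d + 1 \<le> korn_constant CARD('n) \<rho>" "8 * ?d * (1 + 1 / \<epsilon>) \<le> korn_constant CARD('n) \<rho>"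
        unfolding korn_constant_def \<epsilon>_def[symmetric] using \<epsilon> by auto
    qed
    finally have "V \<le> korn_constant CARD('n) \<rho> * (N + J)" by (simp add: distrib_left)
    moreover have "0 \<le> korn_constant CARD('n) \<rho>"
      unfolding korn_constant_def \<epsilon>_def[symmetric] using \<epsilon> by simp
    ultimately show ?thesis unfolding V(1) N(1) J(1) using N J
      by (simp add: ennreal_mult[symmetric] ennreal_plus[symmetric] ennreal_leI del: ennreal_plus)
  qed
qed

end

section \<open>Polynomial fields and the discrete norms\<close>

text \<open>Continuity of the derivative is stated for each direction separately, which is easier to verify
  for products than continuity in operator norm and suffices for \<open>strain_bounded\<close>.\<close>

definition C1_map :: "('a::real_normed_vector \<Rightarrow> 'b::real_normed_vector) \<Rightarrow> bool" where
  "C1_map f \<longleftrightarrow> (\<exists>D. (\<forall>x. (f has_derivative D x) (at x)) \<and> (\<forall>h. continuous_on UNIV (\<lambda>x. D x h)))"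

lemma C1_map_const: "C1_map (\<lambda>x. c)"
  unfolding C1_map_def by (intro exI[of _ "\<lambda>x h. 0"]) auto

lemma C1_map_component: "C1_map (\<lambda>x::real^'n. x $ i)"
  unfolding C1_map_def
  by (intro exI[of _ "\<lambda>x h. h $ i"]) (auto intro!: derivative_eq_intros bounded_linear_vec_nth bounded_linear_imp_has_derivative)

lemma C1_map_imp_continuous:
  assumes "C1_map f"
  shows "continuous_on UNIV f"
proof -
  obtain D where "\<And>x. (f has_derivative D x) (at x)"
    using assms unfolding C1_map_def by blast
  then show ?thesis by (intro has_derivative_continuous_on[of UNIV f D]) auto
qed

lemma C1_map_scaleR:
  fixes f :: "'a::real_normed_vector \<Rightarrow> real"
  assumes "C1_map f" "C1_map g"
  shows "C1_map (\<lambda>x. f x *\<^sub>R g x)"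
proof -
  obtain D E where D: "\<And>x. (f has_derivative D x) (at x)" "\<And>h. continuous_on UNIV (\<lambda>x. D x h)"
    and E: "\<And>x. (g has_derivative E x) (at x)" "\<And>h. continuous_on UNIV (\<lambda>x. E x h)"
    using assms unfolding C1_map_def by blast
  have "((\<lambda>x. f x *\<^sub>R g x) has_derivative (\<lambda>h. f x *\<^sub>R E x h + D x h *\<^sub>R g x)) (at x)" for x
    by (rule has_derivative_scaleR[OF D(1) E(1)])
  moreover have "continuous_on UNIV (\<lambda>x. f x *\<^sub>R E x h + D x h *\<^sub>R g x)" for h
    by (intro continuous_intros D(2) E(2) C1_map_imp_continuous assms)
  ultimately show ?thesis unfolding C1_map_def
    by (intro exI[of _ "\<lambda>x h. f x *\<^sub>R E x h + D x h *\<^sub>R g x"]) blast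
qed

lemma C1_map_add:
  assumes "C1_map f" "C1_map g"
  shows "C1_map (\<lambda>x. f x + g x)"
proof -
  obtain D E where D: "\<And>x. (f has_derivative D x) (at x)" "\<And>h. continuous_on UNIV (\<lambda>x. D x h)"
    and E: "\<And>x. (g has_derivative E x) (at x)" "\<And>h. continuous_on UNIV (\<lambda>x. E x h)"
    using assms unfolding C1_map_def by blast
  have "((\<lambda>x. f x + g x) has_derivative (\<lambda>h. D x h + E x h)) (at x)" for x
    by (rule has_derivative_add[OF D(1) E(1)])
  moreover have "continuous_on UNIV (\<lambda>x. D x h + E x h)" for h
    by (intro continuous_intros D(2) E(2))
  ultimately show ?thesis unfolding C1_map_def
    by (intro exI[of _ "\<lambda>x h. D x h + E x h"]) blast
qed

lemma C1_map_sum: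
  assumes "\<And>i. i \<in> A \<Longrightarrow> C1_map (f i)"
  shows "C1_map (\<lambda>x. \<Sum>i\<in>A. f i x)"
proof (cases "finite A")
  case True
  then show ?thesis using assms
    by (induction A) (auto intro: C1_map_const C1_map_add)
qed (simp add: C1_map_const)

lemma C1_map_mult:
  fixes f g :: "'a::real_normed_vector \<Rightarrow> real"
  assumes "C1_map f" "C1_map g"
  shows "C1_map (\<lambda>x. f x * g x)"
  using C1_map_scaleR[OF assms] by simp

lemma C1_map_power:
  fixes f :: "'a::real_normed_vector \<Rightarrow> real"
  assumes "C1_map f"
  shows "C1_map (\<lambda>x. f x ^ n)"
  by (induction n) (auto intro: C1_map_const C1_map_mult assms)

lemma C1_map_prod:
  fixes f :: "'i \<Rightarrow> 'a::real_normed_vector \<Rightarrow> real"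
  assumes "finite A" "\<And>i. i \<in> A \<Longrightarrow> C1_map (f i)"
  shows "C1_map (\<lambda>x. \<Prod>i\<in>A. f i x)"
  using assms
  by (induction A) (auto intro: C1_map_const C1_map_mult)

lemma C1_map_vec_poly:
  assumes "p \<in> vec_poly k"
  shows "C1_map p"
proof -
  obtain c where "\<forall>x. p x = (\<Sum>\<alpha> | (\<Sum>i\<in>UNIV. \<alpha> i) \<le> k. (\<Prod>i\<in>UNIV. (x $ i) ^ \<alpha> i) *\<^sub>R c \<alpha>)"
    using assms unfolding vec_poly_def by blast
  then have "p = (\<lambda>x. \<Sum>\<alpha> | (\<Sum>i\<in>UNIV. \<alpha> i) \<le> k. (\<Prod>i\<in>UNIV. (x $ i) ^ \<alpha> i) *\<^sub>R c \<alpha>)" by auto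
  then show ?thesis
    by (auto intro!: C1_map_sum C1_map_scaleR C1_map_prod
        C1_map_power C1_map_component C1_map_const)
qed

lemma norm_matrix_vector_mult_le:
  fixes A :: "real^'n^'m"
  shows "norm (A *v x) \<le> norm A * norm x"
proof -
  have "norm (A *v x) = L2_set (\<lambda>i. norm (A $ i \<bullet> x)) UNIV"
    by (simp add: norm_vec_def matrix_vector_mul_component)
  also have "\<dots> \<le> L2_set (\<lambda>i. norm (A $ i) * norm x) UNIV"
    by (intro L2_set_mono) (auto simp: Cauchy_Schwarz_ineq2)
  also have "\<dots> = norm A * norm x"
    by (simp add: norm_vec_def[of A] L2_set_left_distrib)
  finally show ?thesis .
qed

text \<open>The skew part of the Jacobian \<open>J\<close> does not contribute to \<open>J \<eta> \<bullet> \<eta>\<close>, the derivative of \<open>p \<bullet> \<eta>\<close> along \<open>\<eta>\<close>.\<close>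

lemma strain_bounded_sym_grad:
  fixes p :: "real^'n \<Rightarrow> real^'n"
  assumes "C1_map p"
  shows "strain_bounded p (\<lambda>x. norm (sym_grad p x))"
proof -
  obtain D where D: "\<And>x. (p has_derivative D x) (at x)" "\<And>h. continuous_on UNIV (\<lambda>x. D x h)"
    using assms unfolding C1_map_def by blast
  have jac: "jacobian p (at x) = matrix (D x)" for x
    using frechet_derivative_at[OF D(1)[of x]] by (simp add: jacobian_def)
  have lin: "D x h = jacobian p (at x) *v h" for x h
    unfolding jac using has_derivative_linear[OF D(1)[of x]] by (simp add: matrix_works)
  have sym: "(jacobian p (at x) *v \<eta>) \<bullet> \<eta> = (sym_grad p x *v \<eta>) \<bullet> \<eta>" for x \<eta>
  proof -
    let ?J = "jacobian p (at x)"
    have "(transpose ?J *v \<eta>) \<bullet> \<eta> = (?J *v \<eta>) \<bullet> \<eta>"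
      by (metis dot_lmul_matrix inner_commute transpose_matrix_vector)
    moreover have "sym_grad p x *v \<eta> = (1/2) *\<^sub>R (?J *v \<eta> + transpose ?J *v \<eta>)"
      by (simp add: sym_grad_def matrix_vector_mult_add_rdistrib scaleR_matrix_vector_assoc[symmetric])
    ultimately show ?thesis by (simp add: inner_add_left)
  qed
  have cont: "continuous_on UNIV (\<lambda>x. sym_grad p x)"
    unfolding sym_grad_def jac transpose_def matrix_def by (intro continuous_intros D(2)) auto
  have "\<exists>w'. continuous_on UNIV w' \<and>
      (\<forall>t. ((\<lambda>t. p (x + t *\<^sub>R \<eta>) \<bullet> \<eta>) has_real_derivative w' t) (at t) \<and>
        \<bar>w' t\<bar> \<le> (norm \<eta>)\<^sup>2 * norm (sym_grad p (x + t *\<^sub>R \<eta>)))" for x \<eta>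
  proof (intro exI conjI allI)
    show "continuous_on UNIV (\<lambda>t. D (x + t *\<^sub>R \<eta>) \<eta> \<bullet> \<eta>)"
      by (intro continuous_intros continuous_on_compose2[OF D(2)]) auto
    fix t
    have "((\<lambda>t. p (x + t *\<^sub>R \<eta>)) has_derivative (\<lambda>s. D (x + t *\<^sub>R \<eta>) (s *\<^sub>R \<eta>))) (at t)"
      by (rule has_derivative_compose[OF _ D(1)]) (auto intro!: derivative_eq_intros)
    then have "((\<lambda>t. p (x + t *\<^sub>R \<eta>) \<bullet> \<eta>) has_derivative (\<lambda>s. D (x + t *\<^sub>R \<eta>) (s *\<^sub>R \<eta>) \<bullet> \<eta>)) (at t)"
      by (rule has_derivative_inner_left)
    moreover have "(\<lambda>s. D (x + t *\<^sub>R \<eta>) (s *\<^sub>R \<eta>) \<bullet> \<eta>) = (*) (D (x + t *\<^sub>R \<eta>) \<eta> \<bullet> \<eta>)"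
      by (simp add: lin matrix_vector_mult_scaleR mult.commute fun_eq_iff)
    ultimately show "((\<lambda>t. p (x + t *\<^sub>R \<eta>) \<bullet> \<eta>) has_real_derivative D (x + t *\<^sub>R \<eta>) \<eta> \<bullet> \<eta>) (at t)"
      by (simp add: has_field_derivative_def)
    have "\<bar>(sym_grad p (x + t *\<^sub>R \<eta>) *v \<eta>) \<bullet> \<eta>\<bar> \<le> norm (sym_grad p (x + t *\<^sub>R \<eta>) *v \<eta>) * norm \<eta>"
      by (rule Cauchy_Schwarz_ineq2)
    also have "\<dots> \<le> norm (sym_grad p (x + t *\<^sub>R \<eta>)) * norm \<eta> * norm \<eta>"
      by (intro mult_right_mono norm_matrix_vector_mult_le) auto
    finally show "\<bar>D (x + t *\<^sub>R \<eta>) \<eta> \<bullet> \<eta>\<bar> \<le> (norm \<eta>)\<^sup>2 * norm (sym_grad p (x + t *\<^sub>R \<eta>))"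
      by (simp add: lin sym power2_eq_square mult_ac)
  qed
  then show ?thesis
    unfolding strain_bounded_def
    using cont C1_map_imp_continuous[OF assms] by (auto intro: continuous_on_norm)
qed

lemma sym_grad_cong_open:
  assumes "open T" "x \<in> T" "\<And>y. y \<in> T \<Longrightarrow> f y = g y"
  shows "sym_grad f x = sym_grad g x"
proof -
  have "(f has_derivative D) (at x) \<longleftrightarrow> (g has_derivative D) (at x)" for D
    using has_derivative_transform_within_open[OF _ assms(1,2)] assms(3) by metis
  then show ?thesis by (simp add: sym_grad_def jacobian_def frechet_derivative_def)
qed

lemma L2_norm_on_sq: "(L2_norm_on \<mu> X v)\<^sup>2 = (LINT x:X|\<mu>. (norm (v x))\<^sup>2)"
proof -
  have "0 \<le> (LINT x:X|\<mu>. (norm (v x))\<^sup>2)"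
    unfolding set_lebesgue_integral_def by (intro integral_nonneg_AE) auto
  then show ?thesis by (simp add: L2_norm_on_def)
qed

text \<open>The Bochner integral in the norm vanishes for functions that are not integrable; measurability and
  finiteness make it agree with the extended integral.\<close>

lemma ennreal_L2_norm_on_sq:
  assumes "(\<lambda>x. indicator X x * (norm (w x))\<^sup>2) \<in> borel_measurable \<mu>"
    and "(\<integral>\<^sup>+x. ennreal (indicator X x * (norm (w x))\<^sup>2) \<partial>\<mu>) < \<infinity>"
    and "\<And>x. x \<in> X \<Longrightarrow> norm (v x) = norm (w x)"
  shows "ennreal ((L2_norm_on \<mu> X v)\<^sup>2) = (\<integral>\<^sup>+x. ennreal (indicator X x * (norm (w x))\<^sup>2) \<partial>\<mu>)"
proof -
  have "(LINT x:X|\<mu>. (norm (v x))\<^sup>2) = (LINT x|\<mu>. indicator X x * (norm (w x))\<^sup>2)"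
    unfolding set_lebesgue_integral_def
    using assms(3) by (intro Bochner_Integration.integral_cong) (auto simp: indicator_def)
  also have "\<dots> = enn2real (\<integral>\<^sup>+x. ennreal (indicator X x * (norm (w x))\<^sup>2) \<partial>\<mu>)"
    by (rule integral_eq_nn_integral[OF assms(1)]) auto
  finally show ?thesis using assms(2) by (simp add: L2_norm_on_sq ennreal_enn2real_if)
qed

context hybrid_field
begin

text \<open>Off the boundaries of the simplices a point lies in at most one simplex, and then in its element.\<close>

lemma strain_energy_le:
  "strain_energy \<le> (\<Sum>T\<in>elements M. nn_integral_on T (\<lambda>x. (strain T x)\<^sup>2))"
proof -
  note [measurable] = strain_borel simplex_borel strain_borel[OF element_of(1)] borel_open[OF open_element]
  have "negligible (\<Union>(frontier ` \<S>))"
    using finite_submesh negligible_convex_frontier[OF convex_simplex[OF simplex]] by (intro negligible_Union) auto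
  then have AE: "AE x in lborel. x \<notin> \<Union>(frontier ` \<S>)" by (rule negligible_AE_lborel)
  have "strain_energy = (\<integral>\<^sup>+x. (\<Sum>S\<in>\<S>. indicator S x * ennreal ((strain (element_of S) x)\<^sup>2)) \<partial>lborel)"
    unfolding strain_energy_def by (rule nn_integral_sum[symmetric]) measurable
  also have "\<dots> \<le> (\<integral>\<^sup>+x. (\<Sum>T\<in>elements M. indicator T x * ennreal ((strain T x)\<^sup>2)) \<partial>lborel)"
  proof (rule nn_integral_mono_AE, rule AE_mp[OF AE], rule AE_I2, rule impI)
    fix x assume x: "x \<notin> \<Union>(frontier ` \<S>)"
    have int: "x \<in> interior S" if "S \<in> \<S>" "x \<in> S" for S
      using x that closure_subset by (auto simp: frontier_def)
    show "(\<Sum>S\<in>\<S>. indicator S x * ennreal ((strain (element_of S) x)\<^sup>2))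
        \<le> (\<Sum>T\<in>elements M. indicator T x * ennreal ((strain T x)\<^sup>2))"
    proof (cases "\<exists>S\<in>\<S>. x \<in> S")
      case True
      then obtain S where S: "S \<in> \<S>" "x \<in> S" by blast
      have "indicator S' x * ennreal ((strain (element_of S') x)\<^sup>2) =
          (if S' = S then ennreal ((strain (element_of S) x)\<^sup>2) else 0)" if "S' \<in> \<S>" for S'
        using S that interior_disjoint[OF S(1) that] int[OF S] by (auto simp: indicator_def)
      then have "(\<Sum>S\<in>\<S>. indicator S x * ennreal ((strain (element_of S) x)\<^sup>2)) = ennreal ((strain (element_of S) x)\<^sup>2)"
        using S(1) finite_submesh by simp
      also have "\<dots> = indicator (element_of S) x * ennreal ((strain (element_of S) x)\<^sup>2)"
        using int[OF S] element_of(2)[OF S(1)] by auto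
      also have "\<dots> \<le> (\<Sum>T\<in>elements M. indicator T x * ennreal ((strain T x)\<^sup>2))"
        using element_of(1)[OF S(1)] finite_elements by (intro member_le_sum) auto
      finally show ?thesis .
    next
      case False
      then have "(\<Sum>S\<in>\<S>. indicator S x * ennreal ((strain (element_of S) x)\<^sup>2)) = 0"
        by (intro sum.neutral) auto
      then show ?thesis by simp
    qed
  qed
  also have "\<dots> = (\<Sum>T\<in>elements M. nn_integral_on T (\<lambda>x. (strain T x)\<^sup>2))"
    by (rule nn_integral_sum) measurable
  finally show ?thesis .
qed

lemma jump_integral_finite:
  assumes T: "T \<in> elements M" and F: "F \<in> faces_of_element M T"
  shows "(\<integral>\<^sup>+x. ennreal (indicator F x * (norm (Q F x - P T x))\<^sup>2) \<partial>face_measure F) < \<infinity>"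
proof -
  have F': "F \<in> faces M" using F by (simp add: faces_of_element_def)
  have bF: "bounded F" by (rule face_diameter(4)[OF T F])
  have "continuous_on (closure F) (\<lambda>x. (norm (Q F x - P T x))\<^sup>2)"
    using strain_bounded_continuous(1)[OF strain_bounded[OF T]] continuous_on_subset[OF continuous_face_field[OF F']]
    by (intro continuous_intros) auto
  then have "bounded ((\<lambda>x. (norm (Q F x - P T x))\<^sup>2) ` closure F)"
    using bF by (intro compact_imp_bounded compact_continuous_image) auto
  then obtain B where B: "\<And>x. x \<in> closure F \<Longrightarrow> \<bar>(norm (Q F x - P T x))\<^sup>2\<bar> \<le> B" by (auto simp: bounded_iff)
  have "(\<integral>\<^sup>+x. ennreal (indicator F x * (norm (Q F x - P T x))\<^sup>2) \<partial>face_measure F)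
      \<le> (\<integral>\<^sup>+x. ennreal B * indicator F x \<partial>face_measure F)"
    using B closure_subset[of F] by (intro nn_integral_mono) (force simp: indicator_def intro!: ennreal_leI)
  also have "\<dots> = ennreal B * emeasure (face_measure F) F"
    using face_borel[OF F'] by (intro nn_integral_cmult_indicator) simp
  also have "\<dots> < \<infinity>"
    using emeasure_affine_lborel_bounded[OF unit_normal(1)[OF face_aff_dim[OF F']] bF face_borel[OF F']]
    unfolding unit_normal(2)[OF face_aff_dim[OF F']] by (simp add: ennreal_mult_less_top)
  finally show ?thesis .
qed

text \<open>Translation of \<open>broken_korn_energy\<close>: by the matching property the simplices of an element exhaust it,
  and the unknowns agree with \<open>P\<close> and \<open>Q\<close> wherever the norms evaluate them.\<close>

theorem broken_korn_inequality:
  fixes v :: "'n hybrid"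
  assumes PT: "\<And>T x. T \<in> elements M \<Longrightarrow> x \<in> closure T \<Longrightarrow> fst v T x = P T x"
    and QF: "\<And>F x. F \<in> faces M \<Longrightarrow> x \<in> F \<Longrightarrow> snd v F x = Q F x"
    and str: "\<And>T x. T \<in> elements M \<Longrightarrow> strain T x = norm (sym_grad (P T) x)"
  shows "L2_norm_on lborel \<Omega> (broken_field M v) \<le> sqrt (korn_constant CARD('n) \<rho>) * strain_norm M v"
proof -
  let ?K = "korn_constant CARD('n) \<rho>"
  let ?s = "\<lambda>T. (L2_norm_on lborel T (sym_grad (fst v T)))\<^sup>2"
  let ?j = "\<lambda>T F. inverse (diameter F) * (L2_norm_on (face_measure F) F (\<lambda>x. snd v F x - fst v T x))\<^sup>2"
  have K: "0 \<le> ?K" using \<rho>_pos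
    by (simp add: korn_constant_def absorption_parameter_def trace_constant_def)
  have elem: "ennreal (?s T) = (nn_integral_on T (\<lambda>x. (strain T x)\<^sup>2))" if T: "T \<in> elements M" for T
  proof -
    note [measurable] = strain_borel[OF T] borel_open[OF open_element[OF T]]
    have "bounded (closure T)"
      by (rule bounded_subset[OF bounded_closure[OF bounded_domain] element_subset[OF T]])
    then have bT: "compact (closure T)" by (simp add: compact_eq_bounded_closed)
    have eq: "ennreal (indicator T x * (norm (strain T x))\<^sup>2) = indicator T x * ennreal ((strain T x)\<^sup>2)" for x
      by (simp add: indicator_def)
    have "(nn_integral_on T (\<lambda>x. (strain T x)\<^sup>2))
        \<le> (nn_integral_on (closure T) (\<lambda>x. (strain T x)\<^sup>2))"
      using closure_subset[of T] by (intro nn_integral_mono) (auto simp: indicator_def)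
    also have "\<dots> < \<infinity>"
      using strain_bounded_continuous(2)[OF strain_bounded[OF T]]
      by (intro nn_integral_bounded_continuous_finite bT continuous_intros) auto
    finally have fin: "(nn_integral_on T (\<lambda>x. (strain T x)\<^sup>2)) < \<infinity>" .
    have same: "norm (sym_grad (fst v T) x) = norm (strain T x)" if "x \<in> T" for x
    proof -
      have "sym_grad (fst v T) x = sym_grad (P T) x"
        using PT[OF T] closure_subset[of T] by (intro sym_grad_cong_open[OF open_element[OF T] that]) auto
      then show ?thesis using str[OF T] by simp
    qed
    have "ennreal (?s T) = (\<integral>\<^sup>+x. ennreal (indicator T x * (norm (strain T x))\<^sup>2) \<partial>lborel)"
    proof (rule ennreal_L2_norm_on_sq)
      show "(\<integral>\<^sup>+x. ennreal (indicator T x * (norm (strain T x))\<^sup>2) \<partial>lborel) < \<infinity>"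
        using fin by (simp only: eq)
    qed (measurable, rule same)
    then show ?thesis by (simp only: eq)
  qed
  have jump: "ennreal (?j T F) = (\<integral>\<^sup>+x. ennreal (jump_density T F x) \<partial>face_measure F)"
    if T: "T \<in> elements M" and F: "F \<in> faces_of_element M T" for T F
  proof -
    have F': "F \<in> faces M" "F \<subseteq> closure T" using F by (auto simp: faces_of_element_def frontier_def)
    note [measurable] = P_borel[OF T] Q_borel[OF F'(1)] face_borel[OF F'(1)]
    have h: "0 \<le> inverse (diameter F)" using face_diameter(1)[OF T F] by simp
    have "ennreal ((L2_norm_on (face_measure F) F (\<lambda>x. snd v F x - fst v T x))\<^sup>2)
        = (\<integral>\<^sup>+x. ennreal (indicator F x * (norm (Q F x - P T x))\<^sup>2) \<partial>face_measure F)"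
    proof (rule ennreal_L2_norm_on_sq[OF _ jump_integral_finite[OF T F]])
      show "norm (snd v F x - fst v T x) = norm (Q F x - P T x)" if "x \<in> F" for x
        using PT[OF T, of x] QF[OF F'(1) that] F'(2) that by auto
    qed measurable
    then have "ennreal (?j T F) = ennreal (inverse (diameter F)) *
        (\<integral>\<^sup>+x. ennreal (indicator F x * (norm (Q F x - P T x))\<^sup>2) \<partial>face_measure F)"
      using h by (simp add: ennreal_mult)
    also have "\<dots> = (\<integral>\<^sup>+x. ennreal (inverse (diameter F)) * ennreal (indicator F x * (norm (Q F x - P T x))\<^sup>2) \<partial>face_measure F)"
      by (rule nn_integral_cmult[symmetric]) measurable
    also have "\<dots> = (\<integral>\<^sup>+x. ennreal (jump_density T F x) \<partial>face_measure F)"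
      using h by (intro nn_integral_cong) (simp add: jump_density_def ennreal_mult[symmetric] mult_ac)
    finally show ?thesis .
  qed
  have j_nonneg: "0 \<le> ?j T F" if "T \<in> elements M" "F \<in> faces_of_element M T" for T F
    using face_diameter(1)[OF that] by simp
  have norm_nonneg: "0 \<le> (\<Sum>T\<in>elements M. ?s T + (\<Sum>F\<in>faces_of_element M T. ?j T F))"
    by (intro sum_nonneg add_nonneg_nonneg j_nonneg) auto
  have norm_sq: "(strain_norm M v)\<^sup>2 = (\<Sum>T\<in>elements M. ?s T + (\<Sum>F\<in>faces_of_element M T. ?j T F))"
    using norm_nonneg by (simp add: strain_norm_def)
  have "ennreal ((strain_norm M v)\<^sup>2) = (\<Sum>T\<in>elements M. ennreal (?s T)) + (\<Sum>T\<in>elements M. \<Sum>F\<in>faces_of_element M T. ennreal (?j T F))"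
  proof -
    have "ennreal ((strain_norm M v)\<^sup>2) = ennreal ((\<Sum>T\<in>elements M. ?s T) + (\<Sum>T\<in>elements M. \<Sum>F\<in>faces_of_element M T. ?j T F))"
      unfolding norm_sq sum.distrib ..
    also have "\<dots> = ennreal (\<Sum>T\<in>elements M. ?s T) + ennreal (\<Sum>T\<in>elements M. \<Sum>F\<in>faces_of_element M T. ?j T F)"
      by (intro ennreal_plus sum_nonneg j_nonneg) auto
    also have "ennreal (\<Sum>T\<in>elements M. \<Sum>F\<in>faces_of_element M T. ?j T F) = (\<Sum>T\<in>elements M. \<Sum>F\<in>faces_of_element M T. ennreal (?j T F))"
      by (rule ennreal_double_sum) (rule j_nonneg)
    finally show ?thesis by (simp only: sum_ennreal zero_le_power2)
  qed
  also have "\<dots> = (\<Sum>T\<in>elements M. nn_integral_on T (\<lambda>x. (strain T x)\<^sup>2)) + jump_energy"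
    unfolding jump_energy_def by (intro arg_cong2[where f="(+)"] sum.cong refl elem jump)
  finally have rhs: "strain_energy + jump_energy \<le> ennreal ((strain_norm M v)\<^sup>2)"
    using strain_energy_le by (simp add: add_right_mono)
  let ?f = "\<lambda>x. \<Sum>T\<in>elements M. indicator T x *\<^sub>R P T x"
  note [measurable] = P_borel borel_open[OF open_element] P_borel[OF element_of(1)] simplex_borel
  have bf: "broken_field M v x = ?f x" for x
    unfolding broken_field_def using PT closure_subset by (intro sum.cong) (force simp: indicator_def)+
  have pointwise: "ennreal (indicator \<Omega> x * (norm (?f x))\<^sup>2) \<le> (\<Sum>S\<in>\<S>. indicator S x * ennreal ((norm (P (element_of S) x))\<^sup>2))" for x
  proof (cases "\<exists>T\<in>elements M. x \<in> T")
    case True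
    then obtain T where T: "T \<in> elements M" "x \<in> T" by blast
    have "?f x = (\<Sum>T'\<in>elements M. if T' = T then P T x else 0)"
      using T elements_disjoint by (intro sum.cong) (auto simp: indicator_def)
    then have fx: "?f x = P T x" using T(1) finite_elements by simp
    obtain S where S: "S \<in> \<S>" "element_of S = T" "x \<in> S"
      using closure_element_covered[OF T(1), of x] T(2) closure_subset by blast
    have "ennreal (indicator \<Omega> x * (norm (?f x))\<^sup>2) \<le> indicator S x * ennreal ((norm (P (element_of S) x))\<^sup>2)"
      unfolding fx using S by (auto simp: indicator_def)
    also have "\<dots> \<le> (\<Sum>S\<in>\<S>. indicator S x * ennreal ((norm (P (element_of S) x))\<^sup>2))"
      using S(1) finite_submesh by (intro member_le_sum) auto
    finally show ?thesis .
  next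
    case False
    then have "?f x = 0" by (intro sum.neutral) (auto simp: indicator_def)
    then show ?thesis by simp
  qed
  have le: "(\<integral>\<^sup>+x. ennreal (indicator \<Omega> x * (norm (?f x))\<^sup>2) \<partial>lborel) \<le> field_energy"
  proof -
    have "(\<integral>\<^sup>+x. ennreal (indicator \<Omega> x * (norm (?f x))\<^sup>2) \<partial>lborel)
      \<le> (\<integral>\<^sup>+x. (\<Sum>S\<in>\<S>. indicator S x * ennreal ((norm (P (element_of S) x))\<^sup>2)) \<partial>lborel)"
      by (rule nn_integral_mono) (rule pointwise)
    also have "\<dots> = field_energy" unfolding field_energy_def by (rule nn_integral_sum) measurable
    finally show ?thesis .
  qed
  have "ennreal ((L2_norm_on lborel \<Omega> (broken_field M v))\<^sup>2) \<le> field_energy"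
  \<comment> \<open>If the integrand were not measurable, the integral would have its default value 0.\<close>
  proof (cases "(\<lambda>x. indicator \<Omega> x * (norm (?f x))\<^sup>2) \<in> borel_measurable lborel")
    case True
    have "ennreal ((L2_norm_on lborel \<Omega> (broken_field M v))\<^sup>2) = (\<integral>\<^sup>+x. ennreal (indicator \<Omega> x * (norm (?f x))\<^sup>2) \<partial>lborel)"
      by (rule ennreal_L2_norm_on_sq[OF True order_le_less_trans[OF le field_energy_finite]]) (simp add: bf)
    then show ?thesis using le by simp
  next
    case False
    then have "\<not> integrable lborel (\<lambda>x. indicator \<Omega> x * (norm (?f x))\<^sup>2)" by (meson borel_measurable_integrable)
    then have "(L2_norm_on lborel \<Omega> (broken_field M v))\<^sup>2 = 0"
      unfolding L2_norm_on_sq set_lebesgue_integral_def bf by (simp add: not_integrable_integral_eq)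
    then show ?thesis by simp
  qed
  also have "\<dots> \<le> ennreal ?K * (strain_energy + jump_energy)" by (rule broken_korn_energy)
  also have "\<dots> \<le> ennreal ?K * ennreal ((strain_norm M v)\<^sup>2)" by (rule mult_left_mono[OF rhs]) simp
  also have "\<dots> = ennreal (?K * (strain_norm M v)\<^sup>2)" using K by (simp add: ennreal_mult)
  finally have "(L2_norm_on lborel \<Omega> (broken_field M v))\<^sup>2 \<le> ?K * (strain_norm M v)\<^sup>2"
    using K by (simp add: ennreal_le_iff)
  also have "\<dots> = (sqrt ?K * strain_norm M v)\<^sup>2" using K by (simp add: power_mult_distrib)
  finally show ?thesis
    by (rule power2_le_imp_le) (use K in \<open>simp add: strain_norm_def norm_nonneg\<close>)
qed

end

theorem proposition3:
  fixes \<Omega> :: "(real^'n) set" and \<rho> :: real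
  assumes "CARD('n) = 2 \<or> CARD('n) = 3"
    and "polyhedral_domain \<Omega>" and "diameter \<Omega> = 1"
    and "0 < \<rho>" and "\<rho> < 1"
  shows "\<exists>C\<^sub>K>0. \<forall>\<M> :: nat \<Rightarrow> 'n mesh. regular_mesh_sequence \<Omega> \<rho> \<M> \<longrightarrow>
    (\<forall>k::nat. k \<ge> 1 \<longrightarrow> (\<forall>i. \<forall>v\<in>hybrid_space_D \<Omega> k (\<M> i).
      L2_norm_on lborel \<Omega> (broken_field (\<M> i) v) \<le> C\<^sub>K * strain_norm (\<M> i) v))"
proof (intro exI conjI allI impI ballI)
  show "0 < sqrt (korn_constant CARD('n) \<rho>)"
    using assms(4) by (simp add: korn_constant_def absorption_parameter_def trace_constant_def add_pos_nonneg)
  fix \<M> :: "nat \<Rightarrow> 'n mesh" and k i :: nat and v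
  assume reg: "regular_mesh_sequence \<Omega> \<rho> \<M>" and v: "v \<in> hybrid_space_D \<Omega> k (\<M> i)"
  obtain \<S> where \<S>: "matching_simplicial_submesh \<Omega> (\<M> i) \<S>" "submesh_regular \<rho> (\<M> i) \<S>"
    using reg unfolding regular_mesh_sequence_def by blast
  have mesh: "polyhedral_mesh \<Omega> (\<M> i)" using reg unfolding regular_mesh_sequence_def by blast
  have vh: "\<And>T. T \<in> elements (\<M> i) \<Longrightarrow> fst v T \<in> vec_poly_on k (closure T)"
    "\<And>F. F \<in> faces (\<M> i) \<Longrightarrow> snd v F \<in> vec_poly_on k F"
    and v0: "\<And>F x. F \<in> boundary_faces \<Omega> (\<M> i) \<Longrightarrow> x \<in> F \<Longrightarrow> snd v F x = 0"
    using v unfolding hybrid_space_D_def hybrid_space_def by blast+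
  \<comment> \<open>The unknowns are polynomials on their own cell only; extend them to the whole space.\<close>
  have "\<forall>T\<in>elements (\<M> i). \<exists>p\<in>vec_poly k. \<forall>x\<in>closure T. fst v T x = p x"
    using vh(1) unfolding vec_poly_on_def by blast
  then obtain P where P: "\<And>T. T \<in> elements (\<M> i) \<Longrightarrow> P T \<in> vec_poly k"
    "\<And>T x. T \<in> elements (\<M> i) \<Longrightarrow> x \<in> closure T \<Longrightarrow> fst v T x = P T x"
    by metis
  have "\<forall>F\<in>faces (\<M> i). \<exists>p\<in>vec_poly k. \<forall>x\<in>F. snd v F x = p x"
    using vh(2) unfolding vec_poly_on_def by blast
  then obtain Q where Q: "\<And>F. F \<in> faces (\<M> i) \<Longrightarrow> Q F \<in> vec_poly k"
    "\<And>F x. F \<in> faces (\<M> i) \<Longrightarrow> x \<in> F \<Longrightarrow> snd v F x = Q F x"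
    by metis
  interpret hybrid_field \<Omega> "\<M> i" \<S> \<rho> P "\<lambda>T x. norm (sym_grad (P T) x)" Q
  proof unfold_locales
    show "bounded \<Omega>" using assms(2) by (simp add: polyhedral_domain_def)
    show "diameter \<Omega> = 1" "polyhedral_mesh \<Omega> (\<M> i)" "matching_simplicial_submesh \<Omega> (\<M> i) \<S>"
      "submesh_regular \<rho> (\<M> i) \<S>" "0 < \<rho>" by fact+
    show "2 \<le> CARD('n)" using assms(1) by auto
    show "strain_bounded (P T) (\<lambda>x. norm (sym_grad (P T) x))" if "T \<in> elements (\<M> i)" for T
      by (rule strain_bounded_sym_grad[OF C1_map_vec_poly[OF P(1)[OF that]]])
    show "continuous_on UNIV (Q F)" if "F \<in> faces (\<M> i)" for F
      by (rule C1_map_imp_continuous[OF C1_map_vec_poly[OF Q(1)[OF that]]])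
    show "Q F x = 0" if "F \<in> boundary_faces \<Omega> (\<M> i)" "x \<in> F" for F x
    proof -
      have "F \<in> faces (\<M> i)" using that(1) by (simp add: boundary_faces_def)
      then show ?thesis using v0[OF that] Q(2) that(2) by simp
    qed
  qed
  show "L2_norm_on lborel \<Omega> (broken_field (\<M> i) v) \<le> sqrt (korn_constant CARD('n) \<rho>) * strain_norm (\<M> i) v"
    by (rule broken_korn_inequality[OF P(2) Q(2) refl])
qed

end
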